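(* Let $f_1,f_2:\mathbb{R}^n\to\mathbb{R}^n$ and $h:\mathbb{R}^n\to\mathbb{R}$, put $C:=\{x\in\mathbb{R}^n: h(x)\le0\}$, and let $U:=\{(u_1,u_2)\in\mathbb{R}^2:u_1^2+u_2^2\le1\}$. Assume the standing hypotheses (1)–(6) listed in the context. Let $\mathscr L:\mathbb{R}^n\times U\to\mathbb{R}$ be bounded and continuous, and Lipschitz continuous with respect to $x$ with a constant $k_{\mathscr L}>0$ uniform in $u$. Assume furthermore that $\partial C$ is compact. Then the value function $V:C\to\mathbb{R}$, $$V(\xi):=\inf\Big\{\int_0^{+\infty}e^{-t}\mathscr L\big(x_\xi^u(t),u(t)\big)\,dt:\ u(\cdot)\in U_\xi\Big\},$$ is bounded and uniformly continuous on $C$.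
   Context: For a measurable control $u=(u_1,u_2):[0,+\infty)\to U$ and $\xi\in\mathbb{R}^n$, $x_\xi^u(\cdot)$ denotes the solution of $\dot x=u_1f_1(x)+u_2f_2(x)$, $x(0)=\xi$. For $\xi\in C$, $U_\xi$ is the set of measurable $u:[0,+\infty)\to U$ such that $x_\xi^u(t)\in C$ for all $t\ge0$ (it is nonempty). The Lie bracket is $[f_1,f_2]:=Df_2\,f_1-Df_1\,f_2$. For $x\in\mathbb{R}^n$, $\mathbf S(x)$ is the quadratic form on $\mathbb{R}^2$ given by the symmetric $2\times2$ matrix with entries $$S_{\ell m}(x)=\tfrac12\nabla h(x)\cdot\big(Df_\ell(x)f_m(x)+Df_m(x)f_\ell(x)\big)+f_\ell(x)\cdot D^2h(x)f_m(x),\quad \ell,m\in\{1,2\}.$$ The singular set is $\mathbb S:=\{x\in C:\nabla h(x)\cdot f_1(x)=\nabla h(x)\cdot f_2(x)=0\}$, and $d_{\mathbb S}(x)$ denotes the Euclidean distance from $x$ to $\mathbb S$. $\mathbb B$ denotes the closed unit ball of $\mathbb{R}^n$. Standing hypotheses: (1) $f_1,f_2$ are of class $C^2$, Lipschitz with a common constant $k_f$, and there is $k_0>0$ with $|f_1(x)|+|f_2(x)|\le k_0$ for all $x\in\mathbb{R}^n$. (2) Controls take values in the closed unit disc $U$ of $\mathbb{R}^2$. (3) $h$ is of class $C^{2,1}$ ($C^2$ with Lipschitz continuous second derivatives) and Lipschitz with constant $k_h$; $C$ is nonempty; $\nabla h(x)\ne0$ for every $x$ with $h(x)=0$. (4)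 There is $\alpha>0$ such that $|\nabla h(x)\cdot[f_1,f_2](x)|>\alpha$ for all $x\in\mathbb S$. (5) For every $x\in\mathbb S$ the quadratic form $\mathbf S(x)$ is either negative semidefinite (negative definite included) or indefinite (i.e. $S_{11}S_{22}-S_{12}^2<0$). (6) There are $\delta>0$ and $d_0>0$ such that $\sqrt{(\nabla h(x)\cdot f_1(x))^2+(\nabla h(x)\cdot f_2(x))^2}\ge d_0\,d_{\mathbb S}(x)$ for all $x\in\mathbb S+\delta\mathbb B$. *)

theory Defs
  imports "HOL-Analysis.Analysis"
begin

definition gradient :: "(real ^ 'n \<Rightarrow> real) \<Rightarrow> real ^ 'n \<Rightarrow> real ^ 'n"
  where "gradient h x = (\<chi> i. frechet_derivative h (at x) (axis i 1))"

definition hessian :: "(real ^ 'n \<Rightarrow> real) \<Rightarrow> real ^ 'n \<Rightarrow> real ^ 'n ^ 'n"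
  where "hessian h x = jacobian (gradient h) (at x)"

definition class_C2 :: "(real ^ 'n \<Rightarrow> real) \<Rightarrow> bool"
  where "class_C2 h \<longleftrightarrow>
    (\<forall>x. h differentiable at x) \<and> (\<forall>x. gradient h differentiable at x) \<and>
    continuous_on UNIV (hessian h)"

text \<open>The norm on matrices is the library's one, i.e. the Frobenius norm; the choice of norm
  only affects the Lipschitz constant.\<close>

definition class_C21 :: "(real ^ 'n \<Rightarrow> real) \<Rightarrow> bool"
  where "class_C21 h \<longleftrightarrow> class_C2 h \<and> (\<exists>K. K-lipschitz_on UNIV (hessian h))"

definition lie_bracket ::
    "(real ^ 'n \<Rightarrow> real ^ 'n) \<Rightarrow> (real ^ 'n \<Rightarrow> real ^ 'n) \<Rightarrow> real ^ 'n \<Rightarrow> real ^ 'n"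
  where "lie_bracket f g x = jacobian g (at x) *v f x - jacobian f (at x) *v g x"

text \<open>The pair of vector fields \<open>f\<^sub>1, f\<^sub>2\<close> is a family indexed by the two-element type \<open>2\<close>, whose
  elements are \<open>1\<close> and \<open>2\<close> (the latter being equal to \<open>0\<close>).\<close>

definition S_matrix ::
    "(2 \<Rightarrow> real ^ 'n \<Rightarrow> real ^ 'n) \<Rightarrow> (real ^ 'n \<Rightarrow> real) \<Rightarrow> real ^ 'n \<Rightarrow> real ^ 2 ^ 2"
  where "S_matrix f h x = (\<chi> l m.
    1 / 2 * (gradient h x \<bullet> (jacobian (f l) (at x) *v f m x + jacobian (f m) (at x) *v f l x))
      + f l x \<bullet> (hessian h x *v f m x))"

definition negative_semidefinite :: "real ^ 2 ^ 2 \<Rightarrow> bool"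
  where "negative_semidefinite A \<longleftrightarrow> (\<forall>v. v \<bullet> (A *v v) \<le> 0)"

definition indefinite :: "real ^ 2 ^ 2 \<Rightarrow> bool"
  where "indefinite A \<longleftrightarrow> A $ 1 $ 1 * A $ 2 $ 2 - (A $ 1 $ 2)\<^sup>2 < 0"

definition constraint_set :: "(real ^ 'n \<Rightarrow> real) \<Rightarrow> (real ^ 'n) set"
  where "constraint_set h = {x. h x \<le> 0}"

definition singular_set ::
    "(2 \<Rightarrow> real ^ 'n \<Rightarrow> real ^ 'n) \<Rightarrow> (real ^ 'n \<Rightarrow> real) \<Rightarrow> (real ^ 'n) set"
  where "singular_set f h =
    {x \<in> constraint_set h. gradient h x \<bullet> f 1 x = 0 \<and> gradient h x \<bullet> f 2 x = 0}"

definition control_values :: "(real ^ 2) set"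
  where "control_values = {u. (u $ 1)\<^sup>2 + (u $ 2)\<^sup>2 \<le> 1}"

text \<open>Controls and trajectories are total functions of time whose values at negative times are
  irrelevant.\<close>

definition controls :: "(real \<Rightarrow> real ^ 2) set"
  where "controls =
    {u. u \<in> borel_measurable (lebesgue_on {0..}) \<and> (\<forall>t\<ge>0. u t \<in> control_values)}"

text \<open>Since controls are merely measurable, solutions are understood in the sense of Caratheodory.
  The Lebesgue integral equation on every \<open>[0,t]\<close> says that \<open>x\<close> is locally absolutely continuous on
  \<open>[0,\<infinity>)\<close>, satisfies the differential equation almost everywhere and starts at \<open>\<xi>\<close>.\<close>

definition is_solution ::
    "(2 \<Rightarrow> real ^ 'n \<Rightarrow> real ^ 'n) \<Rightarrow> (real \<Rightarrow> real ^ 2) \<Rightarrow> real ^ 'n \<Rightarrow> (real \<Rightarrow> real ^ 'n) \<Rightarrow> bool"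
  where "is_solution f u \<xi> x \<longleftrightarrow> (\<forall>t\<ge>0.
    (\<lambda>s. u s $ 1 *\<^sub>R f 1 (x s) + u s $ 2 *\<^sub>R f 2 (x s)) absolutely_integrable_on {0..t} \<and>
    x t = \<xi> + (LINT s:{0..t}|lebesgue. u s $ 1 *\<^sub>R f 1 (x s) + u s $ 2 *\<^sub>R f 2 (x s)))"

text \<open>For bounded Lipschitz vector fields and \<open>u \<in> controls\<close> a solution exists and is unique on
  \<open>[0,\<infinity>)\<close>, so the choice below only concerns the irrelevant negative times.\<close>

definition trajectory ::
    "(2 \<Rightarrow> real ^ 'n \<Rightarrow> real ^ 'n) \<Rightarrow> (real \<Rightarrow> real ^ 2) \<Rightarrow> real ^ 'n \<Rightarrow> real \<Rightarrow> real ^ 'n"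
  where "trajectory f u \<xi> = (SOME x. is_solution f u \<xi> x)"

definition admissible_controls ::
    "(2 \<Rightarrow> real ^ 'n \<Rightarrow> real ^ 'n) \<Rightarrow> (real ^ 'n \<Rightarrow> real) \<Rightarrow> real ^ 'n \<Rightarrow> (real \<Rightarrow> real ^ 2) set"
  where "admissible_controls f h \<xi> =
    {u \<in> controls. \<forall>t\<ge>0. trajectory f u \<xi> t \<in> constraint_set h}"

text \<open>For \<open>\<xi>\<close> in the constraint set the zero control is admissible, so the infimum is never over
  the empty set there.\<close>

definition value_function ::
    "(2 \<Rightarrow> real ^ 'n \<Rightarrow> real ^ 'n) \<Rightarrow> (real ^ 'n \<Rightarrow> real) \<Rightarrow> (real ^ 'n \<Rightarrow> real ^ 2 \<Rightarrow> real) \<Rightarrow>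
      real ^ 'n \<Rightarrow> real"
  where "value_function f h L \<xi> =
    (INF u\<in>admissible_controls f h \<xi>.
      LINT t:{0..}|lebesgue. exp (- t) * L (trajectory f u \<xi> t) (u t))"

end

theory Submission
  imports Defs
begin

text \<open>Near every point of the boundary one can gain an amount \<open>c r\<^sup>2\<close> in \<open>- h\<close> inside the constraint
  set, in time \<open>O(r)\<close> and with a displacement of only \<open>O(r\<^sup>2)\<close>. Where \<open>\<nabla>h \<bullet> f\<^sub>1\<close> or \<open>\<nabla>h \<bullet> f\<^sub>2\<close> does not
  vanish a constant control does this. Near the singular set one uses a control whose primitive is
  a loop \<open>w\<close> of radius \<open>r\<close> in the plane: with \<open>a\<^sub>l = \<nabla>h \<bullet> f\<^sub>l\<close>, along the trajectory \<open>h\<close> changes by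
  \<open>a \<bullet> w + w \<bullet> S w / 2 + (\<nabla>h \<bullet> [f\<^sub>1, f\<^sub>2]) A\<close> up to a cubic error, where \<open>A\<close> is the signed area swept by \<open>w\<close>.
  For the right orientation the area term is negative, and it absorbs the cubic error when \<open>r\<close> is
  small. The starting angle of the loop has to make the first two terms essentially nonpositive;
  this is possible because of the hypotheses on \<open>S\<close> and on the distance to the singular set, with a
  full circle if \<open>S\<close> is negative semidefinite and with a thin loop in a sector on which \<open>S\<close> is
  negative if it is indefinite.

  After an inward move whose gain is a large multiple of \<open>\<bar>\<xi> - \<eta>\<bar>\<close>, the controls admissible at \<open>\<xi>\<close> remain
  admissible for a time \<open>\<tau>\<close> that does not depend on \<open>\<xi>\<close> and \<open>\<eta>\<close>. By dynamic programming the
  asymptotic modulus of continuity of the value function, as the distance tends to \<open>0\<close>, is at most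
  \<open>exp (- \<tau>)\<close> times itself, and hence vanishes.\<close>

section \<open>Trajectories\<close>

text \<open>The size of the displacement is decisive. The gain must be proportional to
  \<open>norm (\<xi> - \<eta>)\<close>, so \<open>r\<close> is of the order of its square root; a
  displacement of order \<open>r\<close> would carry the moved point too far from \<xi>, and the
  error made by copying controls from \<xi> would exceed the gain. Because the loop closes, its
  displacement of order \<open>r\<close> cancels, and the moved point is within a multiple of
  \<open>norm (\<xi> - \<eta>)\<close> of \<xi>. The copying error then grows like this distance
  times the elapsed time, whereas the gain is there from the beginning, so it lasts for a fixed
  time. The duration of the move, of order \<open>r\<close>, is paid for in running cost only. The
  other obstacle is that h has to stay nonpositive during the whole move. The area swept by a loop
  is cubic in time at the start, so the first and second order terms cannot be averaged out over the
  loop: at every single time they must be dominated by a cubic term, and this is what the starting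
  angle has to achieve.\<close>

lemma gronwall:
  fixes g :: "real \<Rightarrow> real"
  assumes cont: "continuous_on {0..T} g" and k: "0 \<le> k"
    and bound: "\<And>t. t \<in> {0..T} \<Longrightarrow> g t \<le> A + k * integral {0..t} g"
    and t: "t \<in> {0..T}"
  shows "g t \<le> A * exp (k * t)"
proof -
  \<comment> \<open>Up to the damping factor this is the right-hand side of the bound. The bound
    itself makes the derivative nonpositive, so the function stays below its value A at time
    0.\<close>
  define \<phi> where "\<phi> s = exp (- k * s) * (A + k * integral {0..s} g)" for s
  have "\<phi> t \<le> \<phi> 0"
  proof (rule DERIV_nonpos_imp_decreasing_open[of 0 t \<phi>])
    show "0 \<le> t" using t by simp
    have int: "g integrable_on {0..T}" by (rule integrable_continuous_real[OF cont])
    show "continuous_on {0..t} \<phi>" unfolding \<phi>_def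
      by (intro continuous_intros continuous_on_subset[OF indefinite_integral_continuous_1[OF int]])
        (use t in auto)
    fix s assume s: "0 < s" "s < t"
    have "((\<lambda>s. integral {0..s} g) has_vector_derivative g s) (at s within {0..T})"
      by (rule integral_has_vector_derivative[OF cont]) (use s t in auto)
    then have "((\<lambda>s. integral {0..s} g) has_real_derivative g s) (at s)"
      using s t at_within_Icc_at[of 0 s T] by (simp add: has_real_derivative_iff_has_vector_derivative)
    then have "(\<phi> has_real_derivative exp (- k * s) * (k * g s) + (- k * exp (- k * s)) * (A + k * integral {0..s} g)) (at s)"
      unfolding \<phi>_def by (auto intro!: derivative_eq_intros)
    moreover have "exp (- k * s) * (k * g s) + (- k * exp (- k * s)) * (A + k * integral {0..s} g)
        = exp (- k * s) * k * (g s - (A + k * integral {0..s} g))"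
      by (simp add: algebra_simps)
    moreover have "\<dots> \<le> 0"
      by (intro mult_nonneg_nonpos) (use bound[of s] s t k in auto)
    ultimately show "\<exists>y. (\<phi> has_real_derivative y) (at s) \<and> y \<le> 0" by metis
  qed
  then have "exp (- k * t) * (A + k * integral {0..t} g) \<le> A" by (simp add: \<phi>_def)
  then have "A + k * integral {0..t} g \<le> A * exp (k * t)"
    by (simp add: exp_minus field_simps)
  with bound[OF t] show ?thesis by linarith
qed

definition velocity :: "(2 \<Rightarrow> real ^ 'n \<Rightarrow> real ^ 'n) \<Rightarrow> real ^ 2 \<Rightarrow> real ^ 'n \<Rightarrow> real ^ 'n"
  where "velocity f w p = w $ 1 *\<^sub>R f 1 p + w $ 2 *\<^sub>R f 2 p"

lemma control_values_component_le:
  assumes "w \<in> control_values" shows "\<bar>w $ 1\<bar> \<le> 1" "\<bar>w $ 2\<bar> \<le> 1"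
proof -
  have "(w $ 1)\<^sup>2 \<le> 1" "(w $ 2)\<^sup>2 \<le> 1"
    using assms zero_le_power2[of "w $ 1"] zero_le_power2[of "w $ 2"]
    unfolding control_values_def mem_Collect_eq by linarith+
  then show "\<bar>w $ 1\<bar> \<le> 1" "\<bar>w $ 2\<bar> \<le> 1" by (simp_all add: abs_square_le_1)
qed

lemma controls_value: "u \<in> controls \<Longrightarrow> 0 \<le> t \<Longrightarrow> u t \<in> control_values"
  by (simp add: controls_def)

lemma controls_measurable: "u \<in> controls \<Longrightarrow> u \<in> borel_measurable (lebesgue_on {0..})"
  by (simp add: controls_def)

locale control_system =
  fixes f :: "2 \<Rightarrow> real ^ 'n \<Rightarrow> real ^ 'n" and k k\<^sub>0 :: real
  assumes f_lip: "\<And>l. k-lipschitz_on UNIV (f l)"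
    and f_bnd: "\<And>x. norm (f 1 x) + norm (f 2 x) \<le> k\<^sub>0"
begin

lemma k_nonneg: "0 \<le> k"
  using f_lip[of 1] lipschitz_on_nonneg by blast

lemma k\<^sub>0_nonneg: "0 \<le> k\<^sub>0"
  using f_bnd[of 0] norm_ge_zero[of "f 1 0"] norm_ge_zero[of "f 2 0"] by linarith

lemma continuous_on_f: "continuous_on A (f l)"
  by (rule continuous_on_subset[OF lipschitz_on_continuous_on[OF f_lip]]) simp

lemma norm_velocity_le:
  assumes "w \<in> control_values" shows "norm (velocity f w p) \<le> k\<^sub>0"
proof -
  have "norm (velocity f w p) \<le> \<bar>w $ 1\<bar> * norm (f 1 p) + \<bar>w $ 2\<bar> * norm (f 2 p)"
    unfolding velocity_def by (metis norm_scaleR norm_triangle_ineq)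
  also have "\<dots> \<le> 1 * norm (f 1 p) + 1 * norm (f 2 p)"
    using control_values_component_le[OF assms] by (intro add_mono mult_right_mono) auto
  finally show ?thesis using f_bnd[of p] by linarith
qed

text \<open>Both coefficients of a control value are at most 1 in modulus and there are two fields;
  this is the origin of the rate \<open>2 * k\<close> in all stability estimates.\<close>

lemma velocity_lipschitz:
  assumes "w \<in> control_values"
  shows "norm (velocity f w p - velocity f w q) \<le> 2 * k * norm (p - q)"
proof -
  have *: "norm (f l p - f l q) \<le> k * norm (p - q)" for l
    using lipschitz_onD[OF f_lip, of p q l] by (simp add: dist_norm)
  have "velocity f w p - velocity f w q = w $ 1 *\<^sub>R (f 1 p - f 1 q) + w $ 2 *\<^sub>R (f 2 p - f 2 q)"
    by (simp add: velocity_def algebra_simps)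
  also have "norm \<dots> \<le> \<bar>w $ 1\<bar> * norm (f 1 p - f 1 q) + \<bar>w $ 2\<bar> * norm (f 2 p - f 2 q)"
    by (metis norm_scaleR norm_triangle_ineq)
  also have "\<dots> \<le> 1 * norm (f 1 p - f 1 q) + 1 * norm (f 2 p - f 2 q)"
    using control_values_component_le[OF assms] by (intro add_mono mult_right_mono) auto
  finally show ?thesis using *[of 1] *[of 2] by linarith
qed

lemma velocity_measurable:
  assumes u: "u \<in> controls" and x: "continuous_on {0..} x"
  shows "(\<lambda>s. velocity f (u s) (x s)) \<in> borel_measurable (lebesgue_on {0..})"
proof -
  have "(\<lambda>s. f l (x s)) \<in> borel_measurable (lebesgue_on {0..})" for l
    by (rule continuous_imp_measurable_on_sets_lebesgue)
      (auto intro: continuous_on_compose2[OF continuous_on_f x])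
  moreover have "(\<lambda>s. u s $ l) \<in> borel_measurable (lebesgue_on {0..})" for l
    by (rule borel_measurable_continuous_on[OF _ controls_measurable[OF u]]) (intro continuous_intros)
  ultimately show ?thesis unfolding velocity_def by (intro borel_measurable_add borel_measurable_scaleR)
qed

lemma velocity_absolutely_integrable:
  assumes u: "u \<in> controls" and x: "continuous_on {0..} x" and a: "0 \<le> a"
  shows "(\<lambda>s. velocity f (u s) (x s)) absolutely_integrable_on {a..b}"
proof (rule measurable_bounded_by_integrable_imp_absolutely_integrable)
  show "(\<lambda>s. velocity f (u s) (x s)) \<in> borel_measurable (lebesgue_on {a..b})"
    by (rule measurable_restrict_mono[OF velocity_measurable[OF u x]]) (use a in auto)
  show "(\<lambda>_. k\<^sub>0) integrable_on {a..b}" by (rule integrable_const_ivl)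
qed (use a norm_velocity_le controls_value[OF u] in auto)

lemma is_solution_velocity:
  "is_solution f u \<xi> x \<longleftrightarrow> (\<forall>t\<ge>0. (\<lambda>s. velocity f (u s) (x s)) absolutely_integrable_on {0..t} \<and>
    x t = \<xi> + (LINT s:{0..t}|lebesgue. velocity f (u s) (x s)))"
  by (simp add: is_solution_def velocity_def)

lemma is_solutionI:
  assumes u: "u \<in> controls" and x: "continuous_on {0..} x"
    and eq: "\<And>t. 0 \<le> t \<Longrightarrow> x t = \<xi> + integral {0..t} (\<lambda>s. velocity f (u s) (x s))"
  shows "is_solution f u \<xi> x"
  unfolding is_solution_velocity
  using velocity_absolutely_integrable[OF u x] eq by (auto simp: set_lebesgue_integral_eq_integral)

text \<open>Bridge from the Lebesgue integral of the definition to the gauge integral, in which the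
  later estimates along trajectories are made.\<close>

lemma is_solution_has_integral_0:
  assumes "is_solution f u \<xi> x" "0 \<le> t"
  shows "((\<lambda>s. velocity f (u s) (x s)) has_integral x t - \<xi>) {0..t}"
proof -
  have "(\<lambda>s. velocity f (u s) (x s)) absolutely_integrable_on {0..t}"
    and "x t - \<xi> = (LINT s:{0..t}|lebesgue. velocity f (u s) (x s))"
    using assms by (simp_all add: is_solution_velocity)
  then show ?thesis using has_integral_set_lebesgue by simp
qed

lemma is_solution_init: "is_solution f u \<xi> x \<Longrightarrow> x 0 = \<xi>"
  using is_solution_has_integral_0[of u \<xi> x 0] has_integral_unique[OF has_integral_refl(2)]
  by force

lemma is_solution_has_integral:
  assumes "is_solution f u \<xi> x" "0 \<le> s" "s \<le> t"
  shows "((\<lambda>s. velocity f (u s) (x s)) has_integral x t - x s) {s..t}"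
proof -
  let ?v = "\<lambda>s. velocity f (u s) (x s)"
  have t: "(?v has_integral x t - \<xi>) {0..t}" and s: "(?v has_integral x s - \<xi>) {0..s}"
    using is_solution_has_integral_0 assms by auto
  have "?v integrable_on {s..t}"
    using integrable_subinterval_real[OF has_integral_integrable[OF t]] assms by auto
  moreover have "integral {0..s} ?v + integral {s..t} ?v = integral {0..t} ?v"
    using Henstock_Kurzweil_Integration.integral_combine[OF assms(2,3) has_integral_integrable[OF t]] .
  ultimately show ?thesis
    using integral_unique[OF s] integral_unique[OF t] by (simp add: has_integral_iff algebra_simps)
qed

lemma is_solution_lipschitz:
  assumes u: "u \<in> controls" and x: "is_solution f u \<xi> x" and st: "0 \<le> s" "s \<le> t"
  shows "norm (x t - x s) \<le> k\<^sub>0 * (t - s)"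
  using has_integral_bound_real[OF k\<^sub>0_nonneg finite.emptyI is_solution_has_integral[OF x st]]
    norm_velocity_le controls_value[OF u] st by auto

lemma is_solution_continuous:
  assumes u: "u \<in> controls" and x: "is_solution f u \<xi> x"
  shows "continuous_on {0..} x"
proof -
  have "norm (x t - x s) \<le> k\<^sub>0 * \<bar>t - s\<bar>" if "0 \<le> s" "0 \<le> t" for s t
  proof (cases "s \<le> t")
    case True then show ?thesis using is_solution_lipschitz[OF u x, of s t] that by simp
  next
    case False then show ?thesis using is_solution_lipschitz[OF u x, of t s] that
      by (simp add: norm_minus_commute)
  qed
  then have "k\<^sub>0-lipschitz_on {0..} x"
    using k\<^sub>0_nonneg by (auto simp: lipschitz_on_def dist_norm)
  then show ?thesis by (rule lipschitz_on_continuous_on)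
qed

text \<open>Two controls that agree only before T serve two purposes: \<open>u = v\<close> gives the
  dependence on the initial point, and \<open>\<xi> = \<eta>\<close> gives uniqueness, also for
  concatenated controls.\<close>

lemma solution_stability:
  assumes u: "u \<in> controls" and v: "v \<in> controls"
    and x: "is_solution f u \<xi> x" and y: "is_solution f v \<eta> y"
    and uv: "\<And>s. 0 \<le> s \<Longrightarrow> s < T \<Longrightarrow> u s = v s" and t: "0 \<le> t" "t \<le> T"
  shows "norm (x t - y t) \<le> norm (\<xi> - \<eta>) * exp (2 * k * t)"
proof (rule gronwall[where T = T and g = "\<lambda>t. norm (x t - y t)"])
  have cx: "continuous_on {0..T} x" and cy: "continuous_on {0..T} y"
    using is_solution_continuous[OF u x] is_solution_continuous[OF v y]
    by (auto intro: continuous_on_subset)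
  show cont: "continuous_on {0..T} (\<lambda>t. norm (x t - y t))"
    by (intro continuous_intros cx cy)
  fix t assume t: "t \<in> {0..T}"
  have "((\<lambda>s. velocity f (u s) (x s)) has_integral x t - \<xi>) {0..t}"
    using is_solution_has_integral_0[OF x] t by simp
  \<comment> \<open>At \<open>t = T\<close> the controls may differ at the endpoint; a single point
    does not change the integral.\<close>
  moreover have "((\<lambda>s. velocity f (u s) (y s)) has_integral y t - \<eta>) {0..t}"
    by (rule has_integral_spike_finite[of "{t}" _ _ "\<lambda>s. velocity f (v s) (y s)"])
      (use t uv is_solution_has_integral_0[OF y] in auto)
  ultimately have "((\<lambda>s. velocity f (u s) (x s) - velocity f (u s) (y s)) has_integral
      (x t - \<xi>) - (y t - \<eta>)) {0..t}"
    by (rule has_integral_diff)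
  moreover have "(\<lambda>s. 2 * k * norm (x s - y s)) integrable_on {0..t}"
    by (intro integrable_continuous_real continuous_intros continuous_on_subset[OF cx]
        continuous_on_subset[OF cy]) (use t in auto)
  ultimately have "norm ((x t - \<xi>) - (y t - \<eta>)) \<le> integral {0..t} (\<lambda>s. 2 * k * norm (x s - y s))"
    using velocity_lipschitz controls_value[OF u]
    by (metis (no_types, lifting) Henstock_Kurzweil_Integration.integral_norm_bound_integral
        atLeastAtMost_iff has_integral_iff)
  also have "\<dots> = 2 * k * integral {0..t} (\<lambda>s. norm (x s - y s))" by simp
  finally have *: "norm ((x t - \<xi>) - (y t - \<eta>)) \<le> 2 * k * integral {0..t} (\<lambda>s. norm (x s - y s))" .
  have "norm (x t - y t) = norm (((x t - \<xi>) - (y t - \<eta>)) + (\<xi> - \<eta>))" by simp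
  also have "\<dots> \<le> norm ((x t - \<xi>) - (y t - \<eta>)) + norm (\<xi> - \<eta>)" by (rule norm_triangle_ineq)
  finally show "norm (x t - y t) \<le> norm (\<xi> - \<eta>) + 2 * k * integral {0..t} (\<lambda>s. norm (x s - y s))"
    using * by linarith
qed (use k_nonneg t in auto)


lemma solution_exists:
  assumes u: "u \<in> controls"
  shows "\<exists>x. is_solution f u \<xi> x"
proof -
  \<comment> \<open>The contraction factor of the weighted operator is \<open>2 * k / \<mu>\<close>;
    the summand 1 keeps the weight positive when \<open>k = 0\<close>.\<close>
  define \<mu> where "\<mu> = 4 * k + 1"
  have \<mu>: "0 < \<mu>" "2 * k / \<mu> \<le> 1 / 2" using k_nonneg by (auto simp: \<mu>_def field_simps)
  \<comment> \<open>The weight \<open>exp (-\<mu> t)\<close> makes the Picard operator a contraction on the whole half line.\<close>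
  define X where "X z t = \<xi> + exp (\<mu> * t) *\<^sub>R apply_bcontfun z t" for z :: "real \<Rightarrow>\<^sub>C (real ^ 'n)" and t
  have X_cont: "continuous_on A (X z)" for z A
    unfolding X_def by (intro continuous_intros continuous_on_apply_bcontfun)
  define I where "I z t = integral {0..t} (\<lambda>s. velocity f (u s) (X z s))" for z t
  have int: "(\<lambda>s. velocity f (u s) (X z s)) integrable_on {0..t}" for z t
    using velocity_absolutely_integrable[OF u X_cont order_refl]
    by (rule set_lebesgue_integral_eq_integral)
  have I_bound: "norm (I z t) \<le> k\<^sub>0 * t" if "0 \<le> t" for z t
    using has_integral_bound_real[OF k\<^sub>0_nonneg finite.emptyI integrable_integral[OF int[of z t]]]
      norm_velocity_le controls_value[OF u] that by (simp add: I_def)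
  have I_cont: "continuous_on {0..} (I z)" for z
  proof -
    show ?thesis
      unfolding continuous_on_def
    proof
      fix t :: real assume t: "t \<in> {0..}"
      obtain n where n: "t < real n" using reals_Archimedean2 by blast
      have "continuous_on {0..real n} (I z)"
        unfolding I_def by (rule indefinite_integral_continuous_1[OF int])
      then have "(I z \<longlongrightarrow> I z t) (at t within {0..real n})"
        using t n by (auto simp: continuous_on_def)
      moreover have "at t within {0..real n} = at t within {0..}"
        by (rule at_within_nhd[of t "{..<real n}"]) (use n in auto)
      ultimately show "(I z \<longlongrightarrow> I z t) (at t within {0..})" by simp
    qed
  qed
  \<comment> \<open>Clamping the time at 0 extends the image to negative times, so that it is a
    continuous function on the whole line. It is bounded because \<open>norm (I z t)\<close> grows
    at most linearly.\<close>
  define \<Phi> where "\<Phi> z t = exp (- \<mu> * max 0 t) *\<^sub>R I z (max 0 t)" for z t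
  have bc: "\<Phi> z \<in> bcontfun" for z
  proof -
    have "continuous_on UNIV (\<Phi> z)" unfolding \<Phi>_def
      by (intro continuous_intros continuous_on_compose2[OF I_cont]) auto
    moreover have "norm (\<Phi> z t) \<le> k\<^sub>0 / \<mu>" for t
    proof -
      define s where "s = max 0 t"
      have "norm (\<Phi> z t) = exp (- \<mu> * s) * norm (I z s)" by (simp add: \<Phi>_def s_def)
      also have "\<dots> \<le> exp (- \<mu> * s) * (k\<^sub>0 * s)" by (intro mult_left_mono I_bound) (auto simp: s_def)
      also have "\<dots> = (k\<^sub>0 / \<mu>) * ((\<mu> * s) / exp (\<mu> * s))" using \<mu> by (simp add: exp_minus field_simps)
      also have "\<dots> \<le> (k\<^sub>0 / \<mu>) * 1"
      proof (intro mult_left_mono)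
        show "\<mu> * s / exp (\<mu> * s) \<le> 1" using exp_ge_add_one_self[of "\<mu> * s"] by (simp del: exp_ge_add_one_self; linarith)
      qed (use \<mu> k\<^sub>0_nonneg in auto)
      finally show ?thesis by simp
    qed
    ultimately show ?thesis by (auto simp: bcontfun_def bounded_iff)
  qed
  define P where "P z = Bcontfun (\<Phi> z)" for z
  have P: "apply_bcontfun (P z) = \<Phi> z" for z unfolding P_def by (rule Bcontfun_inverse[OF bc])
  have contr: "dist (P z) (P y) \<le> (1 / 2) * dist z y" for z y
  proof (rule dist_bound)
    fix t :: real
    define s where "s = max 0 t"
    have s0: "0 \<le> s" by (simp add: s_def)
    define D where "D = dist z y"
    have D: "norm (z r - y r) \<le> D" for r using dist_bounded[of z r y] by (simp add: D_def dist_norm)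
    have "0 \<le> D" by (simp add: D_def)
    have exp_int: "((\<lambda>r. 2 * k * D * exp (\<mu> * r)) has_integral
        2 * k * D * (exp (\<mu> * s) / \<mu>) - 2 * k * D * (exp (\<mu> * 0) / \<mu>)) {0..s}"
      by (rule fundamental_theorem_of_calculus[OF s0])
        (use \<mu> in \<open>auto intro!: derivative_eq_intros simp flip: has_real_derivative_iff_has_vector_derivative\<close>)
    have "norm (I z s - I y s) = norm (integral {0..s} (\<lambda>r. velocity f (u r) (X z r) - velocity f (u r) (X y r)))"
      unfolding I_def by (simp add: Henstock_Kurzweil_Integration.integral_diff[OF int int])
    also have "\<dots> \<le> integral {0..s} (\<lambda>r. 2 * k * D * exp (\<mu> * r))"
    proof (rule Henstock_Kurzweil_Integration.integral_norm_bound_integral)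
      show "(\<lambda>r. velocity f (u r) (X z r) - velocity f (u r) (X y r)) integrable_on {0..s}"
        by (intro integrable_diff int)
      fix r assume r: "r \<in> {0..s}"
      have "norm (velocity f (u r) (X z r) - velocity f (u r) (X y r)) \<le> 2 * k * norm (X z r - X y r)"
        using velocity_lipschitz controls_value[OF u] r by simp
      also have "X z r - X y r = exp (\<mu> * r) *\<^sub>R (z r - y r)" by (simp add: X_def algebra_simps)
      also have "2 * k * norm \<dots> \<le> 2 * k * (exp (\<mu> * r) * D)"
        using k_nonneg D[of r] by (intro mult_left_mono) (auto simp: mult_left_mono)
      finally show "norm (velocity f (u r) (X z r) - velocity f (u r) (X y r)) \<le> 2 * k * D * exp (\<mu> * r)"
        by (simp add: mult_ac)
    qed (use exp_int in auto)
    also have "\<dots> = 2 * k * D * (exp (\<mu> * s) / \<mu>) - 2 * k * D * (exp (\<mu> * 0) / \<mu>)"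
      using exp_int by blast
    also have "\<dots> \<le> 2 * k * D * (exp (\<mu> * s) / \<mu>)" using k_nonneg \<open>0 \<le> D\<close> \<mu>(1) by simp
    also have "\<dots> = (2 * k / \<mu>) * (D * exp (\<mu> * s))" by simp
    also have "\<dots> \<le> (1 / 2) * (D * exp (\<mu> * s))" using \<mu>(2) \<open>0 \<le> D\<close> by (intro mult_right_mono) auto
    finally have "norm (I z s - I y s) \<le> (1 / 2) * (D * exp (\<mu> * s))" .
    then have "exp (- \<mu> * s) * norm (I z s - I y s) \<le> exp (- \<mu> * s) * ((1 / 2) * (D * exp (\<mu> * s)))"
      by (intro mult_left_mono) auto
    also have "\<dots> = (1 / 2) * D" by (simp add: exp_minus field_simps)
    finally have "norm (\<Phi> z t - \<Phi> y t) \<le> (1 / 2) * D"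
      by (simp add: \<Phi>_def flip: s_def scaleR_diff_right)
    then show "dist (P z t) (P y t) \<le> (1 / 2) * dist z y"
      by (simp add: P dist_norm D_def)
  qed
  obtain z where z: "P z = z"
    using banach_fix_type[of "1/2" P] contr by auto
  have "is_solution f u \<xi> (X z)"
  proof (rule is_solutionI[OF u X_cont])
    fix t :: real assume t: "0 \<le> t"
    have "z t = exp (- \<mu> * t) *\<^sub>R I z t"
      using P[of z] t by (simp add: z \<Phi>_def)
    then show "X z t = \<xi> + integral {0..t} (\<lambda>s. velocity f (u s) (X z s))"
      by (simp add: X_def I_def exp_minus)
  qed
  then show ?thesis by blast
qed

lemma is_solution_trajectory: "u \<in> controls \<Longrightarrow> is_solution f u \<xi> (trajectory f u \<xi>)"
  unfolding trajectory_def by (rule someI_ex[OF solution_exists])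

lemma trajectory_0: "u \<in> controls \<Longrightarrow> trajectory f u \<xi> 0 = \<xi>"
  using is_solution_init[OF is_solution_trajectory] .

lemma trajectory_stability:
  assumes "u \<in> controls" "0 \<le> t"
  shows "norm (trajectory f u \<xi> t - trajectory f u \<eta> t) \<le> norm (\<xi> - \<eta>) * exp (2 * k * t)"
  by (rule solution_stability[OF assms(1,1) is_solution_trajectory is_solution_trajectory])
    (use assms in auto)

lemma trajectory_unique:
  assumes u: "u \<in> controls" and v: "v \<in> controls" and x: "is_solution f v \<xi> x"
    and uv: "\<And>s. 0 \<le> s \<Longrightarrow> s < T \<Longrightarrow> u s = v s" and t: "0 \<le> t" "t \<le> T"
  shows "trajectory f u \<xi> t = x t"
  using solution_stability[OF u v is_solution_trajectory[OF u, of \<xi>] x uv t] by simp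

lemma norm_trajectory_diff:
  assumes "u \<in> controls" "0 \<le> s" "s \<le> t"
  shows "norm (trajectory f u \<xi> t - trajectory f u \<xi> s) \<le> k\<^sub>0 * (t - s)"
  using is_solution_lipschitz[OF assms(1) is_solution_trajectory] assms by blast

lemma trajectory_continuous: "u \<in> controls \<Longrightarrow> continuous_on {0..} (trajectory f u \<xi>)"
  using is_solution_continuous[OF _ is_solution_trajectory] .

end

section \<open>Shifting and concatenating controls\<close>

definition shift_control :: "real \<Rightarrow> (real \<Rightarrow> real ^ 2) \<Rightarrow> real \<Rightarrow> real ^ 2"
  where "shift_control T u s = u (T + s)"

text \<open>The value at the switching time belongs to the second control, in accordance with the
  half-open agreement in \<open>trajectory_unique\<close>.\<close>

definition concat_control :: "real \<Rightarrow> (real \<Rightarrow> real ^ 2) \<Rightarrow> (real \<Rightarrow> real ^ 2) \<Rightarrow> real \<Rightarrow> real ^ 2"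
  where "concat_control T u v s = (if s < T then u s else v (s - T))"

lemma measurable_shift:
  fixes u :: "real \<Rightarrow> 'a::euclidean_space"
  assumes u: "u \<in> borel_measurable (lebesgue_on A)" and A: "A \<in> sets lebesgue"
    and B: "B \<in> sets lebesgue" and AB: "\<And>s. s \<in> B \<Longrightarrow> c + s \<in> A"
  shows "(\<lambda>s. u (c + s)) \<in> borel_measurable (lebesgue_on B)"
proof -
  have "(\<lambda>s. c + s) \<in> lebesgue \<rightarrow>\<^sub>M lebesgue"
    using lebesgue_affine_measurable[of "\<lambda>_. 1" c] by simp
  then have "(\<lambda>s. c + s) \<in> lebesgue_on B \<rightarrow>\<^sub>M lebesgue_on A"
    using AB by (intro measurable_restrict_space2 measurable_restrict_space1) auto
  from measurable_compose[OF this u] show ?thesis .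
qed

lemma shift_control_in_controls:
  assumes "u \<in> controls" "0 \<le> T" shows "shift_control T u \<in> controls"
  using assms measurable_shift[of u "{0..}" "{0..}" T]
  by (auto simp: controls_def shift_control_def[abs_def])

lemma concat_control_in_controls:
  assumes u: "u \<in> controls" and v: "v \<in> controls" and T: "0 \<le> T"
  shows "concat_control T u v \<in> controls"
proof -
  have "(\<lambda>s. if s < T then u s else v (s - T)) \<in> borel_measurable (lebesgue_on {0..})"
  proof (subst measurable_If_restrict_space_iff)
    show "{x \<in> space (lebesgue_on {0..}). x < T} \<in> sets (lebesgue_on {0..})"
      by (auto simp: sets_restrict_space image_iff intro!: exI[of _ "{0..<T}"])
    have "u \<in> borel_measurable (lebesgue_on {0..<T})"
      by (rule measurable_restrict_mono[OF controls_measurable[OF u]]) auto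
    moreover have "(\<lambda>s. v (- T + s)) \<in> borel_measurable (lebesgue_on {T..})"
      by (rule measurable_shift[OF controls_measurable[OF v]]) auto
    moreover have "{0..} \<inter> {x. x < T} = {0..<T}" "{0..} \<inter> {x. \<not> x < T} = {T..}" using T by auto
    ultimately show "u \<in> borel_measurable (restrict_space (lebesgue_on {0..}) {x. x < T}) \<and>
        (\<lambda>s. v (s - T)) \<in> borel_measurable (restrict_space (lebesgue_on {0..}) {x. \<not> x < T})"
      by (simp add: restrict_restrict_space)
  qed
  then show ?thesis
    using controls_value[OF u] controls_value[OF v]
    unfolding controls_def concat_control_def[abs_def] by auto
qed

context control_system
begin

text \<open>The fields do not depend on time, so the translated trajectory solves the equation of
  the shifted control, and uniqueness identifies the two.\<close>

lemma trajectory_shift: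
  assumes u: "u \<in> controls" and T: "0 \<le> T" and t: "0 \<le> t"
  shows "trajectory f (shift_control T u) (trajectory f u \<xi> T) t = trajectory f u \<xi> (T + t)"
proof (rule trajectory_unique[where T = t and v = "shift_control T u"])
  show sc: "shift_control T u \<in> controls" "shift_control T u \<in> controls"
    by (rule shift_control_in_controls[OF u T])+
  let ?x = "trajectory f u \<xi>"
  have c: "continuous_on {0..} (\<lambda>t. ?x (T + t))"
    by (rule continuous_on_compose2[OF trajectory_continuous[OF u]]) (use T in \<open>auto intro!: continuous_intros\<close>)
  show "is_solution f (shift_control T u) (?x T) (\<lambda>t. ?x (T + t))"
  proof (rule is_solutionI[OF sc(1) c])
    fix t :: real assume t: "0 \<le> t"
    have "((\<lambda>s. velocity f (u s) (?x s)) has_integral ?x (T + t) - ?x T) {T..T + t}"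
      using is_solution_has_integral[OF is_solution_trajectory[OF u]] T t by simp
    then have "((\<lambda>s. velocity f (u s) (?x s)) has_integral ?x (T + t) - ?x T) {0 + T..t + T}"
      by (simp add: add.commute)
    then have "((\<lambda>s. velocity f (u (T + s)) (?x (T + s))) has_integral ?x (T + t) - ?x T) {0..t}"
      by (simp only: has_integral_shift_Icc_real[symmetric] comp_def)
    then show "?x (T + t) = ?x T + integral {0..t} (\<lambda>s. velocity f (shift_control T u s) (?x (T + s)))"
      by (simp add: has_integral_iff shift_control_def)
  qed
qed (use t in auto)

lemma trajectory_concat_left:
  assumes u: "u \<in> controls" and v: "v \<in> controls" and "0 \<le> t" "t \<le> T"
  shows "trajectory f (concat_control T u v) \<xi> t = trajectory f u \<xi> t"
  by (rule trajectory_unique[OF concat_control_in_controls u is_solution_trajectory])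
    (use assms in \<open>auto simp: concat_control_def\<close>)

lemma trajectory_concat_right:
  assumes u: "u \<in> controls" and v: "v \<in> controls" and T: "0 \<le> T" and t: "0 \<le> t"
  shows "trajectory f (concat_control T u v) \<xi> (T + t) = trajectory f v (trajectory f u \<xi> T) t"
proof -
  let ?w = "concat_control T u v"
  have w: "?w \<in> controls" by (rule concat_control_in_controls[OF u v T])
  have "trajectory f ?w \<xi> (T + t) = trajectory f (shift_control T ?w) (trajectory f ?w \<xi> T) t"
    using trajectory_shift[OF w T t] by simp
  also have "\<dots> = trajectory f v (trajectory f ?w \<xi> T) t"
    by (rule trajectory_unique[OF shift_control_in_controls[OF w T] v is_solution_trajectory[OF v], of t])
      (use T t in \<open>auto simp: shift_control_def concat_control_def\<close>)
  finally show ?thesis using trajectory_concat_left[OF u v T order_refl] by simp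
qed

end

section \<open>Second order expansion along trajectories\<close>

context control_system
begin

text \<open>A solution is only Lipschitz and its velocity only measurable, so F along x need not be
  differentiable everywhere and the classical chain rule does not apply. Instead, the difference D
  between F along x and the indefinite integral of the expected derivative is shown to have
  derivative zero at every time, hence to be constant.\<close>

lemma chain_rule_solution:
  fixes F :: "real ^ 'n \<Rightarrow> real" and G :: "real ^ 'n \<Rightarrow> real ^ 'n"
  assumes F: "\<And>p. (F has_derivative (\<lambda>v. G p \<bullet> v)) (at p)" and G: "continuous_on UNIV G"
    and u: "u \<in> controls" and x: "is_solution f u \<xi> x" and t: "0 \<le> t"
  shows "((\<lambda>s. G (x s) \<bullet> velocity f (u s) (x s)) has_integral F (x t) - F \<xi>) {0..t}"
proof -
  define g where "g s = velocity f (u s) (x s)" for s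
  define \<phi> where "\<phi> s = G (x s) \<bullet> g s" for s
  have x_cont: "continuous_on {0..} x" by (rule is_solution_continuous[OF u x])
  have Gx: "continuous_on {0..} (\<lambda>s. G (x s))"
    by (rule continuous_on_compose2[OF G x_cont]) auto
  have "(\<lambda>s. G (x s) \<bullet> g s) absolutely_integrable_on {0..t}"
  proof (rule absolutely_integrable_bounded_measurable_product[where h = "(\<bullet>)"])
    show "bilinear ((\<bullet>) :: real ^ 'n \<Rightarrow> _)" using bilinear_conv_bounded_bilinear bounded_bilinear_inner by blast
    have c: "continuous_on {0..t} (\<lambda>s. G (x s))" by (rule continuous_on_subset[OF Gx]) auto
    show "(\<lambda>s. G (x s)) \<in> borel_measurable (lebesgue_on {0..t})"
      by (rule continuous_imp_measurable_on_sets_lebesgue[OF c]) auto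
    show "bounded ((\<lambda>s. G (x s)) ` {0..t})"
      by (rule compact_imp_bounded[OF compact_continuous_image[OF c]]) auto
    show "g absolutely_integrable_on {0..t}"
      unfolding g_def by (rule velocity_absolutely_integrable[OF u x_cont]) simp
  qed auto
  then have \<phi>_int: "\<phi> integrable_on {0..t}"
    unfolding \<phi>_def by (rule set_lebesgue_integral_eq_integral)
  define D where "D s = F (x s) - integral {0..s} \<phi>" for s
  \<comment> \<open>On a short interval the integral of \<phi> is the increment of x paired with a
    frozen vector c, up to the oscillation m of G along x times the speed bound.\<close>
  have lin: "\<bar>integral {0..b} \<phi> - integral {0..a} \<phi> - c \<bullet> (x b - x a)\<bar> \<le> m * k\<^sub>0 * (b - a)"
    if ab: "0 \<le> a" "a \<le> b" "b \<le> t" and m: "\<And>r. r \<in> {a..b} \<Longrightarrow> norm (G (x r) - c) \<le> m" "0 \<le> m" for a b c m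
  proof -
    have 1: "\<phi> integrable_on {0..b}" "\<phi> integrable_on {a..b}"
      using integrable_subinterval_real[OF \<phi>_int] ab by auto
    have "integral {0..b} \<phi> - integral {0..a} \<phi> = integral {a..b} \<phi>"
      using Henstock_Kurzweil_Integration.integral_combine[OF ab(1,2) 1(1)] by simp
    then have "(\<phi> has_integral integral {0..b} \<phi> - integral {0..a} \<phi>) {a..b}"
      using 1(2) by (simp add: has_integral_iff)
    moreover have "((\<lambda>s. c \<bullet> g s) has_integral c \<bullet> (x b - x a)) {a..b}"
      unfolding g_def
      by (rule has_integral_linear[OF is_solution_has_integral[OF x ab(1,2)], of "(\<bullet>) c", unfolded comp_def])
        (rule bounded_linear_inner_right)
    ultimately have "((\<lambda>s. \<phi> s - c \<bullet> g s) has_integral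
        integral {0..b} \<phi> - integral {0..a} \<phi> - c \<bullet> (x b - x a)) {a..b}"
      by (rule has_integral_diff)
    moreover have "norm (\<phi> s - c \<bullet> g s) \<le> m * k\<^sub>0" if "s \<in> {a..b}" for s
    proof -
      have "\<phi> s - c \<bullet> g s = (G (x s) - c) \<bullet> g s" by (simp add: \<phi>_def inner_diff_left)
      then have "norm (\<phi> s - c \<bullet> g s) \<le> norm (G (x s) - c) * norm (g s)"
        by (metis Cauchy_Schwarz_ineq2 real_norm_def)
      also have "\<dots> \<le> m * k\<^sub>0"
        unfolding g_def using m that ab norm_velocity_le controls_value[OF u]
        by (intro mult_mono) auto
      finally show ?thesis .
    qed
    ultimately show ?thesis
      using has_integral_bound_real[of "m * k\<^sub>0" "{}"
          "\<lambda>s. \<phi> s - c \<bullet> g s" "integral {0..b} \<phi> - integral {0..a} \<phi> - c \<bullet> (x b - x a)" a b]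
        ab m(2) k\<^sub>0_nonneg by simp
  qed
  have "(D has_derivative (\<lambda>_. 0)) (at s within {0..t})" if s: "s \<in> {0..t}" for s
    unfolding has_derivative_within_alt
  proof (intro conjI allI impI bounded_linear_zero)
    fix e :: real assume e: "0 < e"
    \<comment> \<open>Two errors of relative size \<open>e' * k\<^sub>0\<close> have to fit into e:
      one from the differentiability of F at \<open>x s\<close>, one from freezing G.\<close>
    define e' where "e' = e / (2 * k\<^sub>0 + 1)"
    have e': "0 < e'" "e' * k\<^sub>0 + e' * k\<^sub>0 \<le> e"
      proof -
      show "0 < e'" using e k\<^sub>0_nonneg by (simp add: e'_def)
      have "e' * (2 * k\<^sub>0 + 1) = e" using k\<^sub>0_nonneg by (simp add: e'_def)
      then have "e' * k\<^sub>0 + e' * k\<^sub>0 + e' = e" by (simp add: algebra_simps)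
      then show "e' * k\<^sub>0 + e' * k\<^sub>0 \<le> e" using \<open>0 < e'\<close> by linarith
    qed
    define c where "c = G (x s)"
    from F[of "x s"] e' obtain d1 where d1: "0 < d1"
      "\<And>q. norm (q - x s) < d1 \<Longrightarrow> norm (F q - F (x s) - c \<bullet> (q - x s)) \<le> e' * norm (q - x s)"
      unfolding has_derivative_at_alt c_def by metis
    have "continuous (at s within {0..t}) (\<lambda>s. G (x s))"
      using continuous_on_subset[OF Gx, of "{0..t}"] s by (auto simp: continuous_on_eq_continuous_within)
    with e' obtain d2 where d2: "0 < d2"
      "\<And>r. r \<in> {0..t} \<Longrightarrow> \<bar>r - s\<bar> < d2 \<Longrightarrow> norm (G (x r) - c) < e'"
      unfolding continuous_within_eps_delta c_def dist_norm by (metis real_norm_def)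
    define d where "d = min d2 (d1 / (k\<^sub>0 + 1))"
    have d: "0 < d" using d1 d2 k\<^sub>0_nonneg by (auto simp: d_def)
    have "norm (D s' - D s - 0) \<le> e * norm (s' - s)" if s': "s' \<in> {0..t}" "norm (s' - s) < d" for s'
    proof -
      have xd: "norm (x s' - x s) \<le> k\<^sub>0 * \<bar>s' - s\<bar>"
        using is_solution_lipschitz[OF u x, of s s'] is_solution_lipschitz[OF u x, of s' s] s s'
        by (cases "s \<le> s'") (auto simp: norm_minus_commute)
      have "k\<^sub>0 * \<bar>s' - s\<bar> \<le> (k\<^sub>0 + 1) * \<bar>s' - s\<bar>" by (simp add: mult_right_mono)
      also have "\<dots> < d1" using s' k\<^sub>0_nonneg by (auto simp: d_def field_simps)
      finally have "norm (F (x s') - F (x s) - c \<bullet> (x s' - x s)) \<le> e' * norm (x s' - x s)"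
        using xd by (intro d1) simp
      also have "\<dots> \<le> e' * (k\<^sub>0 * \<bar>s' - s\<bar>)" using xd e' by (intro mult_left_mono) auto
      finally have F1: "\<bar>F (x s') - F (x s) - c \<bullet> (x s' - x s)\<bar> \<le> e' * k\<^sub>0 * \<bar>s' - s\<bar>" by simp
      have "\<bar>integral {0..s'} \<phi> - integral {0..s} \<phi> - c \<bullet> (x s' - x s)\<bar> \<le> e' * k\<^sub>0 * \<bar>s' - s\<bar>"
      proof (cases "s \<le> s'")
        case True
        have "norm (G (x r) - c) \<le> e'" if "r \<in> {s..s'}" for r
          using d2(2)[of r] that s s' by (force simp: d_def)
        from lin[of s s' c e', OF _ _ _ this] show ?thesis using True s s' e' by auto
      next
        case False
        have "norm (G (x r) - c) \<le> e'" if "r \<in> {s'..s}" for r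
          using d2(2)[of r] that s s' by (force simp: d_def)
        from lin[of s' s c e', OF _ _ _ this] show ?thesis using False s s' e'
          by (auto simp: inner_diff_right)
      qed
      with F1 have "\<bar>D s' - D s\<bar> \<le> (e' * k\<^sub>0 + e' * k\<^sub>0) * \<bar>s' - s\<bar>"
        unfolding D_def distrib_right by linarith
      also have "\<dots> \<le> e * \<bar>s' - s\<bar>" using e' by (intro mult_right_mono) auto
      finally show ?thesis by simp
    qed
    then show "\<exists>d>0. \<forall>y\<in>{0..t}. norm (y - s) < d \<longrightarrow> norm (D y - D s - 0) \<le> e * norm (y - s)"
      using d by blast
  qed
  then obtain c where "\<And>s. s \<in> {0..t} \<Longrightarrow> D s = c"
    using has_derivative_zero_constant[of "{0..t}" D] by auto
  then have "D t = D 0" using t by simp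
  then have "integral {0..t} \<phi> = F (x t) - F \<xi>"
    using is_solution_init[OF x] by (simp add: D_def)
  then show ?thesis using \<phi>_int by (simp add: has_integral_iff \<phi>_def[abs_def] g_def)
qed

end

section \<open>Functions that are Lipschitz on bounded sets\<close>

definition lipschitz_on_cballs :: "('a::real_normed_vector \<Rightarrow> 'b::real_normed_vector) \<Rightarrow> bool"
  where "lipschitz_on_cballs F \<longleftrightarrow> (\<forall>R. \<exists>K. K-lipschitz_on (cball 0 R) F)"

lemma lipschitz_on_imp_cballs: "K-lipschitz_on UNIV F \<Longrightarrow> lipschitz_on_cballs F"
  unfolding lipschitz_on_cballs_def by (meson lipschitz_on_subset subset_UNIV)

lemma lipschitz_on_cballsE:
  assumes "lipschitz_on_cballs F"
  obtains K where "0 < K" "\<And>p q. norm p \<le> R \<Longrightarrow> norm q \<le> R \<Longrightarrow> norm (F p - F q) \<le> K * norm (p - q)"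
proof -
  obtain K where K: "K-lipschitz_on (cball 0 R) F" using assms unfolding lipschitz_on_cballs_def by blast
  have "norm (F p - F q) \<le> (K + 1) * norm (p - q)" if "norm p \<le> R" "norm q \<le> R" for p q
  proof -
    have "norm (F p - F q) \<le> K * norm (p - q)" using lipschitz_onD[OF K, of p q] that by (simp add: dist_norm)
    also have "\<dots> \<le> (K + 1) * norm (p - q)" by (intro mult_right_mono) auto
    finally show ?thesis .
  qed
  then show ?thesis using that[of "K + 1"] lipschitz_on_nonneg[OF K] by auto
qed

lemma lipschitz_on_cballs_add:
  assumes "lipschitz_on_cballs F" "lipschitz_on_cballs G"
  shows "lipschitz_on_cballs (\<lambda>x. F x + G x)"
  using assms lipschitz_on_add unfolding lipschitz_on_cballs_def by blast

lemma lipschitz_on_cballs_sum: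
  assumes "finite I" "\<And>i. i \<in> I \<Longrightarrow> lipschitz_on_cballs (F i)"
  shows "lipschitz_on_cballs (\<lambda>x. \<Sum>i\<in>I. F i x)"
  using assms
proof (induction I rule: finite_induct)
  case empty
  show ?case by (rule lipschitz_on_imp_cballs[of 0]) (auto simp: lipschitz_on_def)
qed (auto intro: lipschitz_on_cballs_add)

lemma lipschitz_on_cballs_mult:
  fixes F G :: "'a::real_normed_vector \<Rightarrow> real"
  assumes F: "lipschitz_on_cballs F" and G: "lipschitz_on_cballs G"
  shows "lipschitz_on_cballs (\<lambda>x. F x * G x)"
  unfolding lipschitz_on_cballs_def
proof
  fix R :: real
  show "\<exists>K. K-lipschitz_on (cball 0 R) (\<lambda>x. F x * G x)"
  proof (cases "0 \<le> R")
    case R: True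
    obtain K where K: "0 < K" "\<And>p q. norm p \<le> R \<Longrightarrow> norm q \<le> R \<Longrightarrow> norm (F p - F q) \<le> K * norm (p - q)"
      using lipschitz_on_cballsE[OF F, of R] by blast
    obtain M where M: "0 < M" "\<And>p q. norm p \<le> R \<Longrightarrow> norm q \<le> R \<Longrightarrow> norm (G p - G q) \<le> M * norm (p - q)"
      using lipschitz_on_cballsE[OF G, of R] by blast
    define bF bG where "bF = \<bar>F 0\<bar> + K * R" and "bG = \<bar>G 0\<bar> + M * R"
    have bF: "\<bar>F p\<bar> \<le> bF" if "norm p \<le> R" for p
    proof -
      have "\<bar>F p - F 0\<bar> \<le> K * norm p" using K(2)[of p 0] that R by simp
      moreover have "K * norm p \<le> K * R" using that K(1) by simp
      ultimately show ?thesis unfolding bF_def by linarith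
    qed
    have bG: "\<bar>G p\<bar> \<le> bG" if "norm p \<le> R" for p
    proof -
      have "\<bar>G p - G 0\<bar> \<le> M * norm p" using M(2)[of p 0] that R by simp
      moreover have "M * norm p \<le> M * R" using that M(1) by simp
      ultimately show ?thesis unfolding bG_def by linarith
    qed
    have nn: "0 \<le> bF" "0 \<le> bG" using bF[of 0] bG[of 0] R by auto
    have "(bF * M + K * bG)-lipschitz_on (cball 0 R) (\<lambda>x. F x * G x)"
    proof (rule lipschitz_onI)
      fix p q :: 'a assume pq: "p \<in> cball 0 R" "q \<in> cball 0 R"
      have "\<bar>F p * G p - F q * G q\<bar> = \<bar>F p * (G p - G q) + (F p - F q) * G q\<bar>" by (simp add: algebra_simps)
      also have "\<dots> \<le> \<bar>F p\<bar> * \<bar>G p - G q\<bar> + \<bar>F p - F q\<bar> * \<bar>G q\<bar>"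
        by (metis abs_mult abs_triangle_ineq)
      also have "\<dots> \<le> bF * (M * norm (p - q)) + (K * norm (p - q)) * bG"
        using pq bF[of p] bG[of q] M(2)[of p q] K(2)[of p q] nn K(1) M(1)
        by (intro add_mono mult_mono) auto
      finally show "dist (F p * G p) (F q * G q) \<le> (bF * M + K * bG) * dist p q"
        by (simp add: dist_norm algebra_simps)
    qed (use nn K M in auto)
    then show ?thesis by blast
  next
    case False
    then have "cball (0::'a) R = {}" by simp
    then show ?thesis by (intro exI[of _ 0]) (auto simp: lipschitz_on_def)
  qed
qed

lemma continuous_lipschitz_on_cballs:
  fixes F :: "'a::real_normed_vector \<Rightarrow> 'b::real_normed_vector"
  assumes "lipschitz_on_cballs F" shows "continuous_on UNIV F"
proof (rule continuous_at_imp_continuous_on, rule ballI)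
  fix x :: 'a
  obtain K where K: "K-lipschitz_on (cball 0 (norm x + 1)) F"
    using assms unfolding lipschitz_on_cballs_def by blast
  have "continuous_on (ball 0 (norm x + 1)) F"
    using lipschitz_on_continuous_on[OF K] ball_subset_cball continuous_on_subset by blast
  then show "isCont F x" by (simp add: continuous_on_eq_continuous_at)
qed

text \<open>A closed ball is compact and convex: G is bounded on it, and the mean value inequality
  applies.\<close>

lemma C1_imp_lipschitz_on_cballs:
  fixes F :: "real ^ 'n \<Rightarrow> real"
  assumes F: "\<And>p. (F has_derivative (\<lambda>v. G p \<bullet> v)) (at p)" and G: "continuous_on UNIV G"
  shows "lipschitz_on_cballs F"
  unfolding lipschitz_on_cballs_def
proof
  fix R :: real
  have "bounded (G ` cball 0 R)"
    by (rule compact_imp_bounded[OF compact_continuous_image[OF continuous_on_subset[OF G]]]) auto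
  then obtain K where K: "0 < K" "\<And>p. p \<in> cball 0 R \<Longrightarrow> norm (G p) \<le> K"
    unfolding bounded_pos by auto
  have "K-lipschitz_on (cball 0 R) F"
  proof (rule bounded_derivative_imp_lipschitz)
    show "(F has_derivative (\<lambda>v. G p \<bullet> v)) (at p within cball 0 R)" for p
      by (rule has_derivative_at_withinI[OF F])
    show "onorm ((\<bullet>) (G p)) \<le> K" if "p \<in> cball 0 R" for p
    proof (rule onorm_bound)
      fix v show "norm (G p \<bullet> v) \<le> K * norm v"
        using Cauchy_Schwarz_ineq2[of "G p" v] mult_right_mono[OF K(2)[OF that], of "norm v"] by simp
    qed (use K in simp)
  qed (use K in auto)
  then show "\<exists>K. K-lipschitz_on (cball 0 R) F" by blast
qed

section \<open>Gradients and Hessians of functions of class C2\<close>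

lemma has_derivative_gradient:
  fixes h :: "real ^ 'n \<Rightarrow> real"
  assumes "h differentiable at x"
  shows "(h has_derivative (\<lambda>v. gradient h x \<bullet> v)) (at x)"
proof -
  define h' where "h' = frechet_derivative h (at x)"
  have h': "(h has_derivative h') (at x)"
    using assms frechet_derivative_works unfolding h'_def by blast
  then have lin: "linear h'" by (rule has_derivative_linear)
  have "h' = (\<lambda>v. gradient h x \<bullet> v)"
  proof
    fix v
    have "h' v = h' (\<Sum>i\<in>UNIV. v $ i *\<^sub>R axis i 1)"
      by (metis (no_types) basis_expansion vector_scaleR_component sum.cong scalar_mult_eq_scaleR)
    also have "\<dots> = (\<Sum>i\<in>UNIV. v $ i * h' (axis i 1))"
      by (simp add: linear_sum[OF lin] linear_cmul[OF lin])
    finally show "h' v = gradient h x \<bullet> v" by (simp add: gradient_def inner_vec_def h'_def mult.commute)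
  qed
  with h' show ?thesis by simp
qed

lemma class_C2_gradient:
  assumes "class_C2 h"
  shows "(h has_derivative (\<lambda>v. gradient h x \<bullet> v)) (at x)"
    and "(gradient h has_derivative (\<lambda>v. hessian h x *v v)) (at x)"
    and "continuous_on UNIV (gradient h)"
    and "continuous_on UNIV (hessian h)"
proof -
  show "(h has_derivative (\<lambda>v. gradient h x \<bullet> v)) (at x)"
    using assms by (intro has_derivative_gradient) (simp add: class_C2_def)
  show g: "(gradient h has_derivative (\<lambda>v. hessian h x *v v)) (at x)" for x
    using assms unfolding hessian_def jacobian_works[symmetric] by (simp add: class_C2_def)
  show "continuous_on UNIV (gradient h)"
    using g has_derivative_continuous by (metis continuous_at_imp_continuous_on)
  show "continuous_on UNIV (hessian h)" using assms by (simp add: class_C2_def)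
qed

lemma has_derivative_gradient_component:
  assumes "class_C2 h"
  shows "((\<lambda>x. gradient h x $ i) has_derivative (\<lambda>v. hessian h x $ i \<bullet> v)) (at x)"
    and "continuous_on UNIV (\<lambda>x. hessian h x $ i)"
    and "lipschitz_on_cballs (\<lambda>x. gradient h x $ i)"
proof -
  show d: "((\<lambda>x. gradient h x $ i) has_derivative (\<lambda>v. hessian h x $ i \<bullet> v)) (at x)" for x
    using bounded_linear.has_derivative[OF bounded_linear_vec_nth class_C2_gradient(2)[OF assms]]
    by (simp add: matrix_vector_mult_def inner_vec_def)
  show c: "continuous_on UNIV (\<lambda>x. hessian h x $ i)"
    by (intro continuous_intros class_C2_gradient(4)[OF assms])
  show "lipschitz_on_cballs (\<lambda>x. gradient h x $ i)"
    by (rule C1_imp_lipschitz_on_cballs[OF d c])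
qed

text \<open>The second difference of \<open>h\<close> in the directions \<open>a\<close> and \<open>b\<close> is symmetric in \<open>a\<close> and \<open>b\<close>,
  and by the mean value theorem it is \<open>s\<^sup>2\<close> times a value of the second derivative nearby.\<close>

lemma second_difference:
  fixes h :: "real ^ 'n \<Rightarrow> real"
  assumes h: "class_C2 h" and s: "0 < s"
  obtains p where "norm (p - x) \<le> s * (norm a + norm b)"
    "h (x + s *\<^sub>R a + s *\<^sub>R b) - h (x + s *\<^sub>R a) - (h (x + s *\<^sub>R b) - h x) = s\<^sup>2 * (a \<bullet> (hessian h p *v b))"
proof -
  define \<phi> where "\<phi> t = h (x + t *\<^sub>R a + s *\<^sub>R b) - h (x + t *\<^sub>R a)" for t
  define \<phi>' where "\<phi>' t = gradient h (x + t *\<^sub>R a + s *\<^sub>R b) \<bullet> a - gradient h (x + t *\<^sub>R a) \<bullet> a" for t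
  have hd: "((\<lambda>t. h (y + t *\<^sub>R a)) has_real_derivative gradient h (y + t *\<^sub>R a) \<bullet> a) (at t)" for y t
  proof -
    have "((\<lambda>t. y + t *\<^sub>R a) has_derivative (\<lambda>r. r *\<^sub>R a)) (at t)"
      by (auto intro!: derivative_eq_intros)
    from has_derivative_compose[OF this class_C2_gradient(1)[OF h]]
    show ?thesis unfolding has_field_derivative_def by (simp add: mult_commute_abs)
  qed
  have \<phi>: "(\<phi> has_real_derivative \<phi>' t) (at t)" for t
    using DERIV_diff[OF hd[of "x + s *\<^sub>R b" t] hd[of x t]] by (simp add: \<phi>_def[abs_def] \<phi>'_def add_ac)
  obtain z where z: "0 < z" "z < s" "\<phi> s - \<phi> 0 = (s - 0) * \<phi>' z"
    using MVT2[OF s, of \<phi> \<phi>'] \<phi> by auto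
  define y where "y = x + z *\<^sub>R a"
  have gd: "((\<lambda>t. gradient h (y + t *\<^sub>R b) \<bullet> a) has_real_derivative (hessian h (y + t *\<^sub>R b) *v b) \<bullet> a) (at t)" for t
  proof -
    have "((\<lambda>t. y + t *\<^sub>R b) has_derivative (\<lambda>r. r *\<^sub>R b)) (at t)"
      by (auto intro!: derivative_eq_intros)
    from has_derivative_inner_left[OF has_derivative_compose[OF this class_C2_gradient(2)[OF h]], of a]
    show ?thesis unfolding has_field_derivative_def
      by (simp add: mult_commute_abs matrix_vector_mult_scaleR)
  qed
  obtain w where w: "0 < w" "w < s"
    "gradient h (y + s *\<^sub>R b) \<bullet> a - gradient h (y + 0 *\<^sub>R b) \<bullet> a = (s - 0) * ((hessian h (y + w *\<^sub>R b) *v b) \<bullet> a)"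
    using MVT2[OF s, of "\<lambda>t. gradient h (y + t *\<^sub>R b) \<bullet> a" "\<lambda>t. (hessian h (y + t *\<^sub>R b) *v b) \<bullet> a"] gd by auto
  show thesis
  proof (rule that)
    have "norm (z *\<^sub>R a + w *\<^sub>R b) \<le> z * norm a + w * norm b"
      using norm_triangle_ineq[of "z *\<^sub>R a" "w *\<^sub>R b"] z w by simp
    also have "\<dots> \<le> s * norm a + s * norm b" using z w by (intro add_mono mult_right_mono) auto
    finally show "norm (y + w *\<^sub>R b - x) \<le> s * (norm a + norm b)" by (simp add: y_def algebra_simps)
    show "h (x + s *\<^sub>R a + s *\<^sub>R b) - h (x + s *\<^sub>R a) - (h (x + s *\<^sub>R b) - h x)
        = s\<^sup>2 * (a \<bullet> (hessian h (y + w *\<^sub>R b) *v b))"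
      using z(3) w(3) by (simp add: \<phi>_def \<phi>'_def y_def power2_eq_square inner_commute algebra_simps)
  qed
qed

text \<open>Schwarz's theorem. The same second difference, read in both orders of a and b, is a
  value of either mixed derivative at a point near x, and these points converge to x as the step
  \<open>inverse (Suc n)\<close> tends to 0.\<close>

lemma hessian_symmetric:
  fixes h :: "real ^ 'n \<Rightarrow> real"
  assumes h: "class_C2 h"
  shows "a \<bullet> (hessian h x *v b) = b \<bullet> (hessian h x *v a)"
proof -
  define q where "q a b p = a \<bullet> (hessian h p *v b)" for a b p
  have cont: "isCont (q a b) x" for a b
  proof -
    have "continuous_on UNIV (q a b)"
      unfolding q_def matrix_vector_mult_def inner_vec_def
      by (auto intro!: continuous_intros class_C2_gradient(4)[OF h])
    then show ?thesis by (simp add: continuous_on_eq_continuous_at)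
  qed
  have "\<exists>p p'. norm (p - x) \<le> inverse (Suc n) * (norm a + norm b) \<and>
      norm (p' - x) \<le> inverse (Suc n) * (norm a + norm b) \<and> q a b p = q b a p'" for n
  proof -
    define s where "s = inverse (real (Suc n))"
    have s: "0 < s" by (simp add: s_def)
    obtain p where p: "norm (p - x) \<le> s * (norm a + norm b)"
      "h (x + s *\<^sub>R a + s *\<^sub>R b) - h (x + s *\<^sub>R a) - (h (x + s *\<^sub>R b) - h x) = s\<^sup>2 * q a b p"
      using second_difference[OF h s, where x = x and a = a and b = b] unfolding q_def by blast
    obtain p' where p': "norm (p' - x) \<le> s * (norm b + norm a)"
      "h (x + s *\<^sub>R b + s *\<^sub>R a) - h (x + s *\<^sub>R b) - (h (x + s *\<^sub>R a) - h x) = s\<^sup>2 * q b a p'"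
      using second_difference[OF h s, where x = x and a = b and b = a] unfolding q_def by blast
    have "s\<^sup>2 * q a b p = s\<^sup>2 * q b a p'"
      unfolding p(2)[symmetric] p'(2)[symmetric] by (simp add: add_ac)
    then have "q a b p = q b a p'" using s by simp
    then show ?thesis using p(1) p'(1) unfolding s_def by (metis add.commute)
  qed
  then obtain p p' where p: "\<And>n. norm (p n - x) \<le> inverse (Suc n) * (norm a + norm b)"
    and p': "\<And>n. norm (p' n - x) \<le> inverse (Suc n) * (norm a + norm b)"
    and eq: "\<And>n. q a b (p n) = q b a (p' n)" by metis
  have lim: "(\<lambda>n. inverse (real (Suc n)) * (norm a + norm b)) \<longlonglongrightarrow> 0 * (norm a + norm b)"
    by (intro tendsto_intros LIMSEQ_inverse_real_of_nat)
  have "r \<longlonglongrightarrow> x" if r: "\<And>n. norm (r n - x) \<le> inverse (Suc n) * (norm a + norm b)" for r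
  proof -
    have "(\<lambda>n. r n - x) \<longlonglongrightarrow> 0"
      by (rule Lim_null_comparison[OF _ lim[simplified]]) (use r in auto)
    then show ?thesis using LIM_zero_iff by blast
  qed
  then have "p \<longlonglongrightarrow> x" "p' \<longlonglongrightarrow> x" using p p' by blast+
  then have "(\<lambda>n. q a b (p n)) \<longlonglongrightarrow> q a b x" "(\<lambda>n. q b a (p' n)) \<longlonglongrightarrow> q b a x"
    using cont isCont_tendsto_compose by blast+
  then have "q a b x = q b a x" using eq LIMSEQ_unique by force
  then show ?thesis by (simp add: q_def)
qed


section \<open>Lie derivatives of the constraint function\<close>

locale constrained_system = control_system f k k\<^sub>0
  for f :: "2 \<Rightarrow> real ^ 'n \<Rightarrow> real ^ 'n" and k k\<^sub>0 :: real +
  fixes h :: "real ^ 'n \<Rightarrow> real"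
  assumes f_C2: "\<And>l i. class_C2 (\<lambda>x. f l x $ i)"
    and h_C21: "class_C21 h"
begin

definition lie1 :: "2 \<Rightarrow> real ^ 'n \<Rightarrow> real"
  where "lie1 l x = gradient h x \<bullet> f l x"

text \<open>The derivative of \<open>lie1 l\<close> in the direction \<open>f m\<close>. The two
  orders of the indices differ by a bracket term; \<open>S_matrix_lie2\<close> and
  \<open>lie_bracket_lie2\<close> extract the symmetric and the antisymmetric part.\<close>

definition lie2 :: "2 \<Rightarrow> 2 \<Rightarrow> real ^ 'n \<Rightarrow> real"
  where "lie2 l m x = f l x \<bullet> (hessian h x *v f m x) + gradient h x \<bullet> (jacobian (f l) (at x) *v f m x)"

definition lie1_gradient :: "2 \<Rightarrow> real ^ 'n \<Rightarrow> real ^ 'n"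
  where "lie1_gradient l x = f l x v* hessian h x + gradient h x v* jacobian (f l) (at x)"

lemma h_C2: "class_C2 h"
  using h_C21 by (simp add: class_C21_def)

lemma hessian_lipschitz_on_cballs: "lipschitz_on_cballs (\<lambda>x. hessian h x $ i $ j)"
proof -
  obtain K where K: "K-lipschitz_on UNIV (hessian h)" using h_C21 by (auto simp: class_C21_def)
  have "K-lipschitz_on UNIV (\<lambda>x. hessian h x $ i $ j)"
  proof (rule lipschitz_onI)
    fix x y
    have "dist (hessian h x $ i $ j) (hessian h y $ i $ j) \<le> dist (hessian h x) (hessian h y)"
      by (rule order_trans[OF dist_vec_nth_le dist_vec_nth_le])
    also have "\<dots> \<le> K * dist x y" using lipschitz_onD[OF K] by blast
    finally show "dist (hessian h x $ i $ j) (hessian h y $ i $ j) \<le> K * dist x y" .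
  qed (rule lipschitz_on_nonneg[OF K])
  then show ?thesis by (rule lipschitz_on_imp_cballs)
qed

lemma f_differentiable: "f l differentiable at x"
proof -
  have "(\<lambda>x. f l x $ i) differentiable at x" for i
    using f_C2 by (simp add: class_C2_def)
  then show ?thesis
    by (subst differentiable_componentwise_within) (auto simp: Basis_vec_def inner_axis)
qed

lemma f_has_derivative: "(f l has_derivative (\<lambda>v. jacobian (f l) (at x) *v v)) (at x)"
  using f_differentiable jacobian_works by blast

lemma jacobian_f_component: "jacobian (f l) (at x) $ i = gradient (\<lambda>x. f l x $ i) x"
proof -
  have "((\<lambda>x. f l x $ i) has_derivative (\<lambda>v. jacobian (f l) (at x) $ i \<bullet> v)) (at x)"
    using bounded_linear.has_derivative[OF bounded_linear_vec_nth f_has_derivative[of l x]]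
    by (simp add: matrix_vector_mult_def inner_vec_def)
  from has_derivative_unique[OF this class_C2_gradient(1)[OF f_C2]]
  have "jacobian (f l) (at x) $ i \<bullet> v = gradient (\<lambda>x. f l x $ i) x \<bullet> v" for v
    by (rule fun_cong)
  then show ?thesis using vector_eq_rdot by blast
qed

lemma lie1_has_derivative: "(lie1 l has_derivative (\<lambda>v. lie1_gradient l x \<bullet> v)) (at x)"
proof -
  have "(lie1 l has_derivative (\<lambda>v. gradient h x \<bullet> (jacobian (f l) (at x) *v v) + (hessian h x *v v) \<bullet> f l x)) (at x)"
    unfolding lie1_def
    by (rule has_derivative_inner[OF class_C2_gradient(2)[OF h_C2] f_has_derivative])
  moreover have "gradient h x \<bullet> (jacobian (f l) (at x) *v v) + (hessian h x *v v) \<bullet> f l x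
      = lie1_gradient l x \<bullet> v" for v
    by (simp add: lie1_gradient_def inner_add_left dot_lmul_matrix inner_commute[of "hessian h x *v v"])
  ultimately show ?thesis by simp
qed

lemma lie1_gradient_inner: "lie1_gradient l x \<bullet> f m x = lie2 l m x"
  by (simp add: lie1_gradient_def lie2_def inner_add_left dot_lmul_matrix)

lemma lie1_gradient_velocity:
  "lie1_gradient l x \<bullet> velocity f w x = w $ 1 * lie2 l 1 x + w $ 2 * lie2 l 2 x"
  by (simp add: velocity_def inner_add_right lie1_gradient_inner)

lemma gradient_velocity: "gradient h x \<bullet> velocity f w x = w $ 1 * lie1 1 x + w $ 2 * lie1 2 x"
  by (simp add: velocity_def inner_add_right lie1_def)

lemma continuous_on_lie1_gradient: "continuous_on UNIV (lie1_gradient l)"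
proof -
  have "continuous_on UNIV (\<lambda>x. hessian h x $ j $ i)" "continuous_on UNIV (\<lambda>x. gradient h x $ i)"
    "continuous_on UNIV (\<lambda>x. f l x $ i)"
    "continuous_on UNIV (\<lambda>x. gradient (\<lambda>x. f l x $ j) x $ i)" for i j
    by (intro continuous_intros class_C2_gradient[OF h_C2] class_C2_gradient[OF f_C2] continuous_on_f)+
  then show ?thesis
    unfolding lie1_gradient_def[abs_def] vector_matrix_mult_def jacobian_f_component
    by (auto intro!: continuous_on_add continuous_on_vec_lambda continuous_on_sum continuous_on_mult)
qed

lemma lie1_lipschitz: "lipschitz_on_cballs (lie1 l)"
  by (rule C1_imp_lipschitz_on_cballs[OF lie1_has_derivative continuous_on_lie1_gradient])

text \<open>Every summand is a product of components of f, of first derivatives of f and h, and of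
  second derivatives of h. The second derivatives of f are only known to be continuous, hence
  bounded on balls, which is why Lipschitz continuity is claimed on balls only.\<close>

lemma lie2_lipschitz: "lipschitz_on_cballs (lie2 l m)"
proof -
  have g: "lipschitz_on_cballs (\<lambda>x. gradient h x $ i)" for i
    by (rule has_derivative_gradient_component(3)[OF h_C2])
  have fl: "lipschitz_on_cballs (\<lambda>x. f l x $ i)" for l i
    by (rule C1_imp_lipschitz_on_cballs[OF class_C2_gradient(1,3)[OF f_C2]])
  have J: "lipschitz_on_cballs (\<lambda>x. gradient (\<lambda>x. f l x $ i) x $ j)" for i j
    by (rule has_derivative_gradient_component(3)[OF f_C2])
  show ?thesis
    unfolding lie2_def[abs_def] inner_vec_def matrix_vector_mult_def jacobian_f_component vec_lambda_beta inner_real_def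
    by (intro lipschitz_on_cballs_add lipschitz_on_cballs_sum lipschitz_on_cballs_mult
        hessian_lipschitz_on_cballs g fl J finite)
qed

lemma S_matrix_lie2: "S_matrix f h x $ l $ m = (lie2 l m x + lie2 m l x) / 2"
  using hessian_symmetric[OF h_C2, of "f m x" x "f l x"]
  by (simp add: S_matrix_def lie2_def inner_add_right algebra_simps)

text \<open>The Hessian contributes a symmetric form, which drops out of the antisymmetric part;
  only the Jacobian terms survive.\<close>

lemma lie_bracket_lie2: "gradient h x \<bullet> lie_bracket (f 1) (f 2) x = lie2 2 1 x - lie2 1 2 x"
  using hessian_symmetric[OF h_C2, of "f 1 x" x "f 2 x"]
  by (simp add: lie_bracket_def lie2_def inner_diff_right)

lemma h_along_trajectory:
  assumes "u \<in> controls" "0 \<le> t"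
  shows "((\<lambda>s. u s $ 1 * lie1 1 (trajectory f u \<xi> s) + u s $ 2 * lie1 2 (trajectory f u \<xi> s))
    has_integral h (trajectory f u \<xi> t) - h \<xi>) {0..t}"
  using chain_rule_solution[OF class_C2_gradient(1)[OF h_C2] class_C2_gradient(3)[OF h_C2] assms(1)
      is_solution_trajectory[OF assms(1), of \<xi>] assms(2)]
  by (simp add: gradient_velocity)

lemma lie1_along_trajectory:
  assumes "u \<in> controls" "0 \<le> t"
  shows "((\<lambda>s. u s $ 1 * lie2 l 1 (trajectory f u \<xi> s) + u s $ 2 * lie2 l 2 (trajectory f u \<xi> s))
    has_integral lie1 l (trajectory f u \<xi> t) - lie1 l \<xi>) {0..t}"
  using chain_rule_solution[OF lie1_has_derivative continuous_on_lie1_gradient assms(1)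
      is_solution_trajectory[OF assms(1), of \<xi>] assms(2)]
  by (simp add: lie1_gradient_velocity)

lemma norm_trajectory_le:
  assumes "u \<in> controls" "0 \<le> t" "t \<le> 1" "norm \<xi> \<le> R"
  shows "norm (trajectory f u \<xi> t) \<le> R + k\<^sub>0"
proof -
  have "norm (trajectory f u \<xi> t - \<xi>) \<le> k\<^sub>0 * t"
    using norm_trajectory_diff[OF assms(1) order_refl assms(2), of \<xi>] trajectory_0[OF assms(1)] by simp
  also have "\<dots> \<le> k\<^sub>0" using mult_left_mono[OF assms(3) k\<^sub>0_nonneg] by simp
  finally show ?thesis using norm_triangle_sub[of "trajectory f u \<xi> t" \<xi>] assms(4) by linarith
qed

text \<open>A second order expansion in the primitive \<open>(w1, w2)\<close> of the control,
  uniform over bounded starting points. The integral of one component of w against the other is half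
  their product plus or minus the signed area A. So the symmetric part of \<open>lie2\<close>
  multiplies the products, and its antisymmetric part multiplies the area.\<close>

lemma trajectory_expansion:
  obtains K where "0 < K" "\<And>\<xi> u w1 w2 A T t. norm \<xi> \<le> R \<Longrightarrow> u \<in> controls \<Longrightarrow> T \<le> 1 \<Longrightarrow> t \<in> {0..T} \<Longrightarrow>
      w1 0 = 0 \<Longrightarrow> w2 0 = 0 \<Longrightarrow> A 0 = 0 \<Longrightarrow>
      (\<And>s. s \<in> {0..T} \<Longrightarrow> (w1 has_real_derivative u s $ 1) (at s within {0..T})) \<Longrightarrow>
      (\<And>s. s \<in> {0..T} \<Longrightarrow> (w2 has_real_derivative u s $ 2) (at s within {0..T})) \<Longrightarrow>
      (\<And>s. s \<in> {0..T} \<Longrightarrow> (A has_real_derivative (w1 s * u s $ 2 - w2 s * u s $ 1) / 2) (at s within {0..T})) \<Longrightarrow>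
      \<bar>h (trajectory f u \<xi> t) - h \<xi> - (lie1 1 \<xi> * w1 t + lie1 2 \<xi> * w2 t
        + (lie2 1 1 \<xi> * (w1 t)\<^sup>2 + (lie2 1 2 \<xi> + lie2 2 1 \<xi>) * w1 t * w2 t + lie2 2 2 \<xi> * (w2 t)\<^sup>2) / 2
        + (lie2 2 1 \<xi> - lie2 1 2 \<xi>) * A t)\<bar> \<le> K * t ^ 3 \<and>
      norm (trajectory f u \<xi> t - \<xi> - (w1 t *\<^sub>R f 1 \<xi> + w2 t *\<^sub>R f 2 \<xi>)) \<le> K * t\<^sup>2"
proof -
  have "\<exists>K. 0 < K \<and> (\<forall>p q. norm p \<le> R + k\<^sub>0 \<longrightarrow> norm q \<le> R + k\<^sub>0 \<longrightarrow> norm (lie2 l m p - lie2 l m q) \<le> K * norm (p - q))" for l m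
    using lipschitz_on_cballsE[OF lie2_lipschitz, of "R + k\<^sub>0" l m] by metis
  then obtain M where M: "\<And>l m. 0 < M l m" "\<And>l m p q. norm p \<le> R + k\<^sub>0 \<Longrightarrow> norm q \<le> R + k\<^sub>0 \<Longrightarrow>
      norm (lie2 l m p - lie2 l m q) \<le> M l m * norm (p - q)" by metis
  define N where "N = M 1 1 + M 1 2 + M 2 1 + M 2 2"
  have "M l m \<le> N" for l m
    using M(1)[of 1 1] M(1)[of 1 2] M(1)[of 2 1] M(1)[of 2 2] exhaust_2[of l] exhaust_2[of m]
    unfolding N_def by auto
  then have N: "\<bar>lie2 l m p - lie2 l m q\<bar> \<le> N * norm (p - q)" if "norm p \<le> R + k\<^sub>0" "norm q \<le> R + k\<^sub>0" for l m p q
    using M(2)[OF that] by (smt (verit) mult_right_mono norm_ge_zero real_norm_def)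
  have "0 < N" unfolding N_def using M(1) by (simp add: add_pos_pos)
  define K where "K = 4 * N * k\<^sub>0 + 2 * k * k\<^sub>0 + 1"
  show thesis
  proof (rule that)
    show "0 < K" using \<open>0 < N\<close> k\<^sub>0_nonneg k_nonneg unfolding K_def by (simp add: add_nonneg_pos)
    fix \<xi> :: "real ^ 'n" and u w1 w2 A and T t :: real
    assume \<xi>: "norm \<xi> \<le> R" and u: "u \<in> controls" and T: "T \<le> 1" and t: "t \<in> {0..T}"
      and init: "w1 0 = 0" "w2 0 = 0" "A 0 = 0"
      and w1: "\<And>s. s \<in> {0..T} \<Longrightarrow> (w1 has_real_derivative u s $ 1) (at s within {0..T})"
      and w2: "\<And>s. s \<in> {0..T} \<Longrightarrow> (w2 has_real_derivative u s $ 2) (at s within {0..T})"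
      and A: "\<And>s. s \<in> {0..T} \<Longrightarrow> (A has_real_derivative (w1 s * u s $ 2 - w2 s * u s $ 1) / 2) (at s within {0..T})"
    define y where "y = trajectory f u \<xi>"
    have u1: "\<bar>u s $ 1\<bar> \<le> 1" "\<bar>u s $ 2\<bar> \<le> 1" if "0 \<le> s" for s
      using control_values_component_le[OF controls_value[OF u that]] by auto
    have y\<xi>: "norm (y s - \<xi>) \<le> k\<^sub>0 * s" if "0 \<le> s" for s
      using norm_trajectory_diff[OF u order_refl that, of \<xi>] trajectory_0[OF u] by (simp add: y_def)
    have yR: "norm (y s) \<le> R + k\<^sub>0" if "0 \<le> s" "s \<le> T" for s
      using norm_trajectory_le[OF u that(1) _ \<xi>] that T by (simp add: y_def)
    have \<xi>R: "norm \<xi> \<le> R + k\<^sub>0" using \<xi> k\<^sub>0_nonneg by simp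
    have int: "((\<lambda>s. w' s) has_integral w s - w 0) {0..s}"
      if "\<And>s. s \<in> {0..T} \<Longrightarrow> (w has_real_derivative w' s) (at s within {0..T})" "0 \<le> s" "s \<le> T" for w w' and s :: real
      by (rule fundamental_theorem_of_calculus[OF that(2)])
        (use that in \<open>auto simp: has_real_derivative_iff_has_vector_derivative[symmetric] intro!: DERIV_subset[OF that(1)]\<close>)
    \<comment> \<open>First stage: \<open>lie2\<close> is frozen at \<xi>. Up to time s the state
      moves by at most \<open>k\<^sub>0 * s\<close>, so freezing costs order s in the integrand and
      order \<open>s\<^sup>2\<close> after integration.\<close>
    have lie1_bound: "\<bar>lie1 l (y s) - lie1 l \<xi> - (lie2 l 1 \<xi> * w1 s + lie2 l 2 \<xi> * w2 s)\<bar> \<le> 2 * N * k\<^sub>0 * s\<^sup>2"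
      if s: "0 \<le> s" "s \<le> T" for l s
    proof -
      have "((\<lambda>s. u s $ 1 * lie2 l 1 (y s) + u s $ 2 * lie2 l 2 (y s)) has_integral lie1 l (y s) - lie1 l \<xi>) {0..s}"
        unfolding y_def by (rule lie1_along_trajectory[OF u s(1)])
      moreover have "((\<lambda>s. lie2 l 1 \<xi> * u s $ 1 + lie2 l 2 \<xi> * u s $ 2) has_integral lie2 l 1 \<xi> * w1 s + lie2 l 2 \<xi> * w2 s) {0..s}"
        using int[OF w1 s] int[OF w2 s] init by (intro has_integral_add has_integral_mult_right) auto
      ultimately have "((\<lambda>s. (u s $ 1 * lie2 l 1 (y s) + u s $ 2 * lie2 l 2 (y s)) - (lie2 l 1 \<xi> * u s $ 1 + lie2 l 2 \<xi> * u s $ 2))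
          has_integral (lie1 l (y s) - lie1 l \<xi>) - (lie2 l 1 \<xi> * w1 s + lie2 l 2 \<xi> * w2 s)) {0..s}"
        by (rule has_integral_diff)
      moreover have "norm ((u r $ 1 * lie2 l 1 (y r) + u r $ 2 * lie2 l 2 (y r)) - (lie2 l 1 \<xi> * u r $ 1 + lie2 l 2 \<xi> * u r $ 2))
          \<le> 2 * N * (k\<^sub>0 * s)" if r: "r \<in> {0..s}" for r
      proof -
        have "N * norm (y r - \<xi>) \<le> N * (k\<^sub>0 * s)"
          using y\<xi>[of r] r \<open>0 < N\<close> mult_left_mono[of r s k\<^sub>0] k\<^sub>0_nonneg by (intro mult_left_mono) auto
        then have d: "\<bar>lie2 l m (y r) - lie2 l m \<xi>\<bar> \<le> N * (k\<^sub>0 * s)" for m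
          using N[OF yR \<xi>R, of r l m] r s by auto
        have "(u r $ 1 * lie2 l 1 (y r) + u r $ 2 * lie2 l 2 (y r)) - (lie2 l 1 \<xi> * u r $ 1 + lie2 l 2 \<xi> * u r $ 2)
            = u r $ 1 * (lie2 l 1 (y r) - lie2 l 1 \<xi>) + u r $ 2 * (lie2 l 2 (y r) - lie2 l 2 \<xi>)"
          by (simp add: algebra_simps)
        also have "norm \<dots> \<le> \<bar>u r $ 1\<bar> * \<bar>lie2 l 1 (y r) - lie2 l 1 \<xi>\<bar> + \<bar>u r $ 2\<bar> * \<bar>lie2 l 2 (y r) - lie2 l 2 \<xi>\<bar>"
          using abs_triangle_ineq by (simp flip: abs_mult)
        also have "\<dots> \<le> 1 * (N * (k\<^sub>0 * s)) + 1 * (N * (k\<^sub>0 * s))"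
          using d u1 r by (intro add_mono mult_mono) auto
        finally show ?thesis by simp
      qed
      ultimately have "norm ((lie1 l (y s) - lie1 l \<xi>) - (lie2 l 1 \<xi> * w1 s + lie2 l 2 \<xi> * w2 s)) \<le> 2 * N * (k\<^sub>0 * s) * Henstock_Kurzweil_Integration.content {0..s}"
        using \<open>0 < N\<close> k\<^sub>0_nonneg s by (intro has_integral_bound_real[OF _ finite.emptyI]) auto
      then show ?thesis using s by (simp add: power2_eq_square mult_ac)
    qed
    have t0: "0 \<le> t" "t \<le> T" using t by auto
    define Q where "Q s = lie1 1 \<xi> * w1 s + lie1 2 \<xi> * w2 s
        + (lie2 1 1 \<xi> * (w1 s)\<^sup>2 + (lie2 1 2 \<xi> + lie2 2 1 \<xi>) * w1 s * w2 s + lie2 2 2 \<xi> * (w2 s)\<^sup>2) / 2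
        + (lie2 2 1 \<xi> - lie2 1 2 \<xi>) * A s" for s
    \<comment> \<open>Second stage: q is the derivative of h along the trajectory with
      \<open>lie1\<close> replaced by its first order expansion. Q is its primitive, the derivative
      of A supplying the antisymmetric part.\<close>
    define q where "q s = u s $ 1 * (lie1 1 \<xi> + (lie2 1 1 \<xi> * w1 s + lie2 1 2 \<xi> * w2 s))
        + u s $ 2 * (lie1 2 \<xi> + (lie2 2 1 \<xi> * w1 s + lie2 2 2 \<xi> * w2 s))" for s
    have "(Q has_real_derivative q s) (at s within {0..T})" if "s \<in> {0..T}" for s
      unfolding Q_def q_def
      by (rule derivative_eq_intros w1[OF that] w2[OF that] A[OF that] refl | simp)+
        (simp add: field_simps)
    from int[OF this t0] have "(q has_integral Q t) {0..t}" by (simp add: Q_def init)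
    moreover have "((\<lambda>s. u s $ 1 * lie1 1 (y s) + u s $ 2 * lie1 2 (y s)) has_integral h (y t) - h \<xi>) {0..t}"
      unfolding y_def by (rule h_along_trajectory[OF u t0(1)])
    ultimately have "((\<lambda>s. (u s $ 1 * lie1 1 (y s) + u s $ 2 * lie1 2 (y s)) - q s) has_integral (h (y t) - h \<xi>) - Q t) {0..t}"
      by (intro has_integral_diff)
    moreover have "norm ((u s $ 1 * lie1 1 (y s) + u s $ 2 * lie1 2 (y s)) - q s) \<le> 4 * N * k\<^sub>0 * t\<^sup>2" if s: "s \<in> {0..t}" for s
    proof -
      have "2 * N * k\<^sub>0 * s\<^sup>2 \<le> 2 * N * k\<^sub>0 * t\<^sup>2"
        using s \<open>0 < N\<close> k\<^sub>0_nonneg by (intro mult_left_mono power_mono) auto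
      then have d: "\<bar>lie1 l (y s) - lie1 l \<xi> - (lie2 l 1 \<xi> * w1 s + lie2 l 2 \<xi> * w2 s)\<bar> \<le> 2 * N * k\<^sub>0 * t\<^sup>2" for l
        using lie1_bound[of s l] s t0 by auto
      define e1 where "e1 = lie1 1 (y s) - lie1 1 \<xi> - (lie2 1 1 \<xi> * w1 s + lie2 1 2 \<xi> * w2 s)"
      define e2 where "e2 = lie1 2 (y s) - lie1 2 \<xi> - (lie2 2 1 \<xi> * w1 s + lie2 2 2 \<xi> * w2 s)"
      have eq: "(u s $ 1 * lie1 1 (y s) + u s $ 2 * lie1 2 (y s)) - q s = u s $ 1 * e1 + u s $ 2 * e2"
        by (simp add: q_def e1_def e2_def algebra_simps)
      have "norm (u s $ 1 * e1 + u s $ 2 * e2) \<le> \<bar>u s $ 1\<bar> * \<bar>e1\<bar> + \<bar>u s $ 2\<bar> * \<bar>e2\<bar>"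
        by (rule order_trans[OF norm_triangle_ineq]) (simp only: real_norm_def abs_mult order_refl)
      also have "\<dots> \<le> 1 * (2 * N * k\<^sub>0 * t\<^sup>2) + 1 * (2 * N * k\<^sub>0 * t\<^sup>2)"
        using d[of 1] d[of 2] u1[of s] s unfolding e1_def[symmetric] e2_def[symmetric]
        by (intro add_mono mult_mono) auto
      finally show ?thesis unfolding eq by simp
    qed
    ultimately have "norm ((h (y t) - h \<xi>) - Q t) \<le> 4 * N * k\<^sub>0 * t\<^sup>2 * Henstock_Kurzweil_Integration.content {0..t}"
      using \<open>0 < N\<close> k\<^sub>0_nonneg t0 by (intro has_integral_bound_real[OF _ finite.emptyI]) auto
    also have "\<dots> = 4 * N * k\<^sub>0 * t ^ 3" using t0 by (simp add: power2_eq_square power3_eq_cube)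
    also have "\<dots> \<le> K * t ^ 3"
      using t0 k_nonneg k\<^sub>0_nonneg by (intro mult_right_mono) (auto simp: K_def)
    finally have 1: "\<bar>h (y t) - h \<xi> - Q t\<bar> \<le> K * t ^ 3" by simp
    have "((\<lambda>s. velocity f (u s) (y s)) has_integral y t - \<xi>) {0..t}"
      unfolding y_def by (rule is_solution_has_integral_0[OF is_solution_trajectory[OF u] t0(1)])
    moreover have "((\<lambda>s. velocity f (u s) \<xi>) has_integral w1 t *\<^sub>R f 1 \<xi> + w2 t *\<^sub>R f 2 \<xi>) {0..t}"
      unfolding velocity_def using int[OF w1 t0] int[OF w2 t0] init
      by (intro has_integral_add has_integral_scaleR_left) auto
    ultimately have "((\<lambda>s. velocity f (u s) (y s) - velocity f (u s) \<xi>) has_integral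
        (y t - \<xi>) - (w1 t *\<^sub>R f 1 \<xi> + w2 t *\<^sub>R f 2 \<xi>)) {0..t}" by (rule has_integral_diff)
    moreover have "norm (velocity f (u s) (y s) - velocity f (u s) \<xi>) \<le> 2 * k * (k\<^sub>0 * t)" if s: "s \<in> {0..t}" for s
    proof -
      have "norm (velocity f (u s) (y s) - velocity f (u s) \<xi>) \<le> 2 * k * norm (y s - \<xi>)"
        using s controls_value[OF u] by (intro velocity_lipschitz) auto
      also have "\<dots> \<le> 2 * k * (k\<^sub>0 * t)"
        using y\<xi>[of s] s k_nonneg mult_left_mono[of s t k\<^sub>0] k\<^sub>0_nonneg by (intro mult_left_mono) auto
      finally show ?thesis .
    qed
    ultimately have "norm ((y t - \<xi>) - (w1 t *\<^sub>R f 1 \<xi> + w2 t *\<^sub>R f 2 \<xi>)) \<le> 2 * k * (k\<^sub>0 * t) * Henstock_Kurzweil_Integration.content {0..t}"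
      using k_nonneg k\<^sub>0_nonneg t0 by (intro has_integral_bound_real[OF _ finite.emptyI]) auto
    also have "\<dots> = 2 * k * k\<^sub>0 * t\<^sup>2" using t0 by (simp add: power2_eq_square)
    also have "\<dots> \<le> K * t\<^sup>2"
      using \<open>0 < N\<close> k\<^sub>0_nonneg by (intro mult_right_mono) (auto simp: K_def)
    finally have 2: "norm (y t - \<xi> - (w1 t *\<^sub>R f 1 \<xi> + w2 t *\<^sub>R f 2 \<xi>)) \<le> K * t\<^sup>2" .
    show "\<bar>h (trajectory f u \<xi> t) - h \<xi> - (lie1 1 \<xi> * w1 t + lie1 2 \<xi> * w2 t
        + (lie2 1 1 \<xi> * (w1 t)\<^sup>2 + (lie2 1 2 \<xi> + lie2 2 1 \<xi>) * w1 t * w2 t + lie2 2 2 \<xi> * (w2 t)\<^sup>2) / 2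
        + (lie2 2 1 \<xi> - lie2 1 2 \<xi>) * A t)\<bar> \<le> K * t ^ 3 \<and>
      norm (trajectory f u \<xi> t - \<xi> - (w1 t *\<^sub>R f 1 \<xi> + w2 t *\<^sub>R f 2 \<xi>)) \<le> K * t\<^sup>2"
      using 1 2 unfolding Q_def y_def by simp
  qed
qed

end

section \<open>Starting angles of loops\<close>

text \<open>The right side is the area swept by a loop, up to a factor. Its expansion at 0 starts
  with \<open>2 / 3 * t ^ 3\<close>, which leaves ample room up to 1; a constant of the size of 1/40
  comes from the crude bounds \<open>t \<le> 4\<close> and \<open>sin t * cos t \<le> 1 / 2\<close>
  used beyond 1.\<close>

lemma cubic_le_sub_sin_cos:
  assumes "0 \<le> t" "t \<le> pi"
  shows "t ^ 3 / 40 \<le> t - sin t * cos t"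
proof (cases "t \<le> 1")
  case True
  have "\<bar>sin (2 * t) - (\<Sum>m<5. sin_coeff m * (2 * t) ^ m)\<bar> \<le> inverse (fact 5) * \<bar>2 * t\<bar> ^ 5"
    by (rule Maclaurin_sin_bound)
  moreover have "{..<5::nat} = {0, 1, 2, 3, 4}" by auto
  then have "(\<Sum>m<5. sin_coeff m * (2 * t) ^ m) = 2 * t - (2 * t) ^ 3 / 6"
    by (simp add: sin_coeff_def fact_numeral)
  moreover have "inverse (fact 5) * \<bar>2 * t\<bar> ^ 5 = (2 * t) ^ 5 / 120"
    using assms(1) by (simp add: fact_numeral divide_simps)
  ultimately have "sin (2 * t) \<le> 2 * t - (2 * t) ^ 3 / 6 + (2 * t) ^ 5 / 120"
    by linarith
  moreover have "t ^ 5 \<le> t ^ 3" using assms(1) True by (intro power_decreasing) auto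
  moreover have "0 \<le> t ^ 3" using assms(1) by simp
  moreover have "(2 * t) ^ 3 = 8 * t ^ 3" "(2 * t) ^ 5 = 32 * t ^ 5"
    by (simp_all add: power_mult_distrib)
  ultimately show ?thesis unfolding sin_double by linarith
next
  case False
  have "t \<le> 4" using assms(2) pi_less_4 by linarith
  then have "t * t \<le> 4 * 4" using assms(1) by (intro mult_mono) auto
  then have "(t * t) * t \<le> 16 * t" using assms(1) by (intro mult_right_mono) auto
  moreover have "sin t * cos t \<le> 1 / 2" using sin_le_one[of "2 * t"] by (simp add: sin_double)
  ultimately show ?thesis using False unfolding power3_eq_cube by linarith
qed

lemma sin_add_squared_le: "(sin (a + b))\<^sup>2 \<le> 2 * (sin a)\<^sup>2 + 2 * (sin b :: real)\<^sup>2"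
proof -
  have "(sin (a + b))\<^sup>2 \<le> 2 * (sin a * cos b)\<^sup>2 + 2 * (cos a * sin b)\<^sup>2"
    unfolding sin_add using zero_le_power2[of "sin a * cos b - cos a * sin b"]
    by (simp add: power2_sum power2_diff del: zero_le_power2)
  also have "\<dots> \<le> 2 * (sin a)\<^sup>2 + 2 * (sin b)\<^sup>2"
    using mult_left_mono[of "(cos b)\<^sup>2" 1 "(sin a)\<^sup>2"] mult_right_mono[of "(cos a)\<^sup>2" 1 "(sin b)\<^sup>2"]
    by (simp add: power_mult_distrib abs_square_le_1)
  finally show ?thesis .
qed

text \<open>\<open>g\<close> and \<open>\<phi>a\<close> are the rescaled modulus and the argument of the first order term. If \<open>g\<close> is not too
  small the loop starts tangentially to its level line, otherwise along the direction \<open>\<phi>0\<close> on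
  which the second order term is nonpositive.\<close>

lemma degenerate_start_angle:
  fixes \<gamma> g c \<phi>a \<phi>0 \<sigma> :: real
  assumes \<gamma>: "0 < \<gamma>" and g: "0 \<le> g" and c: "0 \<le> c" "c \<le> 1" and \<sigma>: "\<sigma> = 1 \<or> \<sigma> = - 1"
  obtains \<phi> where "\<And>t. 0 \<le> t \<Longrightarrow> t \<le> pi \<Longrightarrow>
    g * cos (\<phi> + \<sigma> * t - \<phi>a) + sin t * (\<gamma> / 32 * (sin (\<phi> + \<sigma> * t - \<phi>0))\<^sup>2 + g * c) / 2 \<le> \<gamma> * t\<^sup>2"
proof -
  define \<epsilon> where "\<epsilon> = \<gamma> / 32"
  have \<epsilon>: "0 < \<epsilon>" "\<gamma> = 32 * \<epsilon>" using \<gamma> by (auto simp: \<epsilon>_def)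
  have gc: "0 \<le> g * c" "g * c \<le> g" using g c by (auto simp: mult_left_le)
  have sin_sigma: "(sin (\<sigma> * t))\<^sup>2 = (sin t)\<^sup>2" for t using \<sigma> by auto
  \<comment> \<open>The threshold decides whether the linear term is strong enough. For the
    tangential start it equals \<open>- g * sin t\<close>, while the form in the starting direction
    is \<open>\<epsilon> * (cos (\<phi>a - \<phi>0))\<^sup>2\<close>; the factor 4 makes twice this
    at most \<open>g / 2\<close>.\<close>
  show thesis
  proof (cases "4 * \<epsilon> * (cos (\<phi>a - \<phi>0))\<^sup>2 \<le> g")
    case True
    show thesis
    proof (rule that)
      fix t :: real assume t: "0 \<le> t" "t \<le> pi"
      let ?\<phi> = "\<phi>a + \<sigma> * pi / 2"
      have s: "0 \<le> sin t" "sin t \<le> 1" using t by (auto simp: sin_ge_zero)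
      have "sin t \<le> t" using t sin_x_le_x by blast
      then have st: "(sin t)\<^sup>2 \<le> t\<^sup>2" using s by (intro power_mono) auto
      have 1: "cos (?\<phi> + \<sigma> * t - \<phi>a) = - sin t"
        using \<sigma> by (auto simp: cos_add cos_diff)
      have 2: "(sin (?\<phi> - \<phi>0))\<^sup>2 = (cos (\<phi>a - \<phi>0))\<^sup>2"
      proof -
        have "?\<phi> - \<phi>0 = (\<phi>a - \<phi>0) + \<sigma> * pi / 2" by simp
        then show ?thesis using \<sigma> by (auto simp only: sin_add) auto
      qed
      have "(sin (?\<phi> + \<sigma> * t - \<phi>0))\<^sup>2 \<le> 2 * (cos (\<phi>a - \<phi>0))\<^sup>2 + 2 * (sin t)\<^sup>2"
        using sin_add_squared_le[of "?\<phi> - \<phi>0" "\<sigma> * t"] unfolding 2 sin_sigma by (simp add: algebra_simps)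
      then have "\<epsilon> * (sin (?\<phi> + \<sigma> * t - \<phi>0))\<^sup>2 \<le> \<epsilon> * (2 * (cos (\<phi>a - \<phi>0))\<^sup>2 + 2 * (sin t)\<^sup>2)"
        using \<epsilon> by (intro mult_left_mono) auto
      also have "\<dots> \<le> g / 2 + 2 * \<epsilon> * (sin t)\<^sup>2" using True by (simp add: algebra_simps)
      finally have "sin t * (\<epsilon> * (sin (?\<phi> + \<sigma> * t - \<phi>0))\<^sup>2 + g * c) \<le> sin t * (2 * g + 2 * \<epsilon> * (sin t)\<^sup>2)"
        using s gc g by (intro mult_left_mono) auto
      moreover have "sin t * (\<epsilon> * (sin t)\<^sup>2) \<le> 1 * (\<epsilon> * (sin t)\<^sup>2)"
        using s \<epsilon> by (intro mult_right_mono) auto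
      moreover have "\<epsilon> * (sin t)\<^sup>2 \<le> \<gamma> * t\<^sup>2"
        using st \<epsilon> by (intro mult_mono) auto
      ultimately show "g * cos (?\<phi> + \<sigma> * t - \<phi>a) + sin t * (\<gamma> / 32 * (sin (?\<phi> + \<sigma> * t - \<phi>0))\<^sup>2 + g * c) / 2 \<le> \<gamma> * t\<^sup>2"
        unfolding 1 \<epsilon>_def[symmetric] by (simp add: algebra_simps)
    qed
  next
    case False
    define C where "C = \<bar>cos (\<phi>0 - \<phi>a)\<bar>"
    have C: "0 \<le> C" "C \<le> 1" by (auto simp: C_def)
    have "g < 4 * \<epsilon> * C\<^sup>2" using False by (simp add: C_def cos_diff mult.commute)
    also have "\<dots> \<le> 4 * \<epsilon> * C" using C \<epsilon> by (simp add: power2_eq_square mult_left_le)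
    \<comment> \<open>The linear term is weak not merely against \<epsilon> but against
      \<open>\<epsilon> * C\<close>, so that \<open>g\<^sup>2\<close> can later be absorbed by a
      multiple of \<open>\<epsilon> * g * C\<close>.\<close>
    finally have gC: "g \<le> 4 * \<epsilon> * C" by simp
    have g4: "g \<le> 4 * \<epsilon>" using gC C(2) \<epsilon>(1) mult_left_mono[of C 1 "4 * \<epsilon>"] by linarith
    \<comment> \<open>Opposite directions have the same squared sine and opposite linear terms, so
      one of \<phi>0 and \<open>\<phi>0 + pi\<close> gives the linear term the favourable sign at
      the start.\<close>
    obtain \<phi> where \<phi>: "cos (\<phi> - \<phi>a) = - C" "\<And>x. (sin (\<phi> + x - \<phi>0))\<^sup>2 = (sin x)\<^sup>2"
    proof (cases "0 < cos (\<phi>0 - \<phi>a)")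
      case True
      have "cos (\<phi>0 + pi - \<phi>a) = - C" using True by (simp add: C_def cos_diff cos_add)
      moreover have "(sin (\<phi>0 + pi + x - \<phi>0))\<^sup>2 = (sin x)\<^sup>2" for x by (simp add: sin_add)
      ultimately show ?thesis using that by blast
    next
      case False
      then show ?thesis using that[of \<phi>0] by (simp add: C_def)
    qed
    show thesis
    proof (rule that)
      fix t :: real assume t: "0 \<le> t" "t \<le> pi"
      have s: "0 \<le> sin t" "sin t \<le> 1" using t by (auto simp: sin_ge_zero)
      have st: "sin t \<le> t" using t sin_x_le_x by blast
      have "cos (\<phi> + \<sigma> * t - \<phi>a) = cos (\<phi> - \<phi>a) * cos t - sin (\<phi> - \<phi>a) * \<sigma> * sin t"
        using cos_add[of "\<phi> - \<phi>a" "\<sigma> * t"] \<sigma> by (auto simp: algebra_simps)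
      moreover have "- (sin (\<phi> - \<phi>a) * \<sigma> * sin t) \<le> sin t"
      proof -
        have "- (sin (\<phi> - \<phi>a) * \<sigma>) \<le> 1" using \<sigma> by auto
        then show ?thesis using mult_right_mono[of "- (sin (\<phi> - \<phi>a) * \<sigma>)" 1 "sin t"] s by simp
      qed
      ultimately have 1: "cos (\<phi> + \<sigma> * t - \<phi>a) \<le> - C * cos t + sin t" using \<phi>(1) by simp
      have 2: "(sin (\<phi> + \<sigma> * t - \<phi>0))\<^sup>2 = (sin t)\<^sup>2" unfolding \<phi>(2) sin_sigma ..
      have st2: "(sin t)\<^sup>2 \<le> t\<^sup>2" using s st by (intro power_mono) auto
      have "g * cos (\<phi> + \<sigma> * t - \<phi>a) \<le> g * (- C * cos t + sin t)" using 1 g by (intro mult_left_mono)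
      moreover have "sin t * (\<epsilon> * (sin t)\<^sup>2 + g * c) \<le> \<epsilon> * t\<^sup>2 + g * sin t"
      proof -
        have "sin t * (\<epsilon> * (sin t)\<^sup>2) \<le> 1 * (\<epsilon> * t\<^sup>2)" using s \<epsilon> st2 by (intro mult_mono) auto
        moreover have "sin t * (g * c) \<le> sin t * g" using s gc by (intro mult_left_mono) auto
        ultimately show ?thesis by (simp add: algebra_simps)
      qed
      ultimately
      have le: "g * cos (\<phi> + \<sigma> * t - \<phi>a) + sin t * (\<epsilon> * (sin t)\<^sup>2 + g * c) / 2
          \<le> - (g * C * cos t) + 2 * (g * sin t) + \<epsilon> * t\<^sup>2"
      proof -
        have "g * (- C * cos t + sin t) = - (g * C * cos t) + g * sin t" by (simp add: algebra_simps)
        moreover have "0 \<le> g * sin t" "0 \<le> \<epsilon> * t\<^sup>2" using g s \<epsilon> by auto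
        ultimately show ?thesis
          using \<open>g * cos (\<phi> + \<sigma> * t - \<phi>a) \<le> g * (- C * cos t + sin t)\<close>
            \<open>sin t * (\<epsilon> * (sin t)\<^sup>2 + g * c) \<le> \<epsilon> * t\<^sup>2 + g * sin t\<close> by linarith
      qed
      have "- (g * C * cos t) + 2 * (g * sin t) + \<epsilon> * t\<^sup>2 \<le> \<gamma> * t\<^sup>2"
      proof (cases "t \<le> 1")
        case True
        have "1 / 2 \<le> cos t"
        proof -
          have "cos (pi / 3) \<le> cos t" using t True pi_gt3 by (intro cos_monotone_0_pi_le) auto
          then show ?thesis by (simp add: cos_60)
        qed
        then have "g * C * (1 / 2) \<le> g * C * cos t" using g C by (intro mult_left_mono) auto
        moreover have "g * sin t \<le> g * t" using st g by (intro mult_left_mono)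
        \<comment> \<open>Weighted arithmetic-geometric mean. The weight 16 keeps the remainder
          below \<open>g * C / 4\<close>, half of what \<open>- (g * C * cos t)\<close> provides as
          long as \<open>cos t\<close> is at least 1/2.\<close>
        moreover have "2 * (g * t) \<le> 16 * \<epsilon> * t\<^sup>2 + g\<^sup>2 / (16 * \<epsilon>)"
        proof -
          have "0 \<le> (16 * \<epsilon> * t - g)\<^sup>2 / (16 * \<epsilon>)" using \<epsilon> by simp
          also have "\<dots> = 16 * \<epsilon> * t\<^sup>2 - 2 * (g * t) + g\<^sup>2 / (16 * \<epsilon>)"
            using \<epsilon>(1) by (simp add: power2_eq_square field_simps)
          finally show ?thesis by simp
        qed
        moreover have "g\<^sup>2 / (16 * \<epsilon>) \<le> g * C / 4"
        proof -
          have "g * g \<le> g * (4 * \<epsilon> * C)" using gC g by (intro mult_left_mono)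
          then show ?thesis using \<epsilon>(1) by (simp add: power2_eq_square field_simps)
        qed
        moreover have "0 \<le> g * C" "0 \<le> \<epsilon> * t\<^sup>2" using g C \<epsilon> by auto
        ultimately show ?thesis unfolding \<epsilon>(2) by linarith
      next
        case False
        \<comment> \<open>Away from 0 no cancellation is required: each term is at most a multiple
          of \<open>\<epsilon> * t\<^sup>2\<close>, and the factor 32 between \<gamma> and
          \<epsilon> covers their sum.\<close>
        have "- (g * C * cos t) \<le> g * C * 1"
          using mult_left_mono[of "- cos t" 1 "g * C"] g C by (simp add: minus_le_iff)
        also have "\<dots> \<le> g" using g C by (simp add: mult_left_le)
        finally have "- (g * C * cos t) \<le> 4 * \<epsilon>" using g4 by simp
        moreover have "g * sin t \<le> 4 * \<epsilon>" using g4 s g mult_left_le[of "sin t" g] by linarith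
        moreover have "\<epsilon> \<le> \<epsilon> * t\<^sup>2"
          using mult_left_mono[of 1 "t\<^sup>2" \<epsilon>] False \<epsilon>(1) one_le_power[of t 2] by simp
        ultimately have "- (g * C * cos t) + 2 * (g * sin t) + \<epsilon> * t\<^sup>2 \<le> 32 * (\<epsilon> * t\<^sup>2)"
          using \<epsilon>(1) by linarith
        then show ?thesis unfolding \<epsilon>(2) by simp
      qed
      with le show "g * cos (\<phi> + \<sigma> * t - \<phi>a) + sin t * (\<gamma> / 32 * (sin (\<phi> + \<sigma> * t - \<phi>0))\<^sup>2 + g * c) / 2 \<le> \<gamma> * t\<^sup>2"
        unfolding 2 \<epsilon>_def[symmetric] by linarith
    qed
  qed
qed

text \<open>A linear function of the direction that is nonpositive at an angle \<phi>1 stays so on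
  the quarter circle on one side of it. The orientation \<sigma> is prescribed, so this side decides
  whether the sweep starts or ends at \<phi>1; \<open>\<kappa> \<le> 1 / 2\<close> keeps the sweep
  within the quarter. Passing from \<phi>0 to the opposite angle, if necessary, secures the sign at
  \<phi>1.\<close>

lemma sector_start_angle:
  fixes a b \<kappa> \<sigma> \<phi>0 :: real
  assumes \<kappa>: "0 < \<kappa>" "\<kappa> \<le> 1 / 2" and \<sigma>: "\<sigma> = 1 \<or> \<sigma> = - 1"
  obtains \<phi> where "\<And>t. 0 \<le> t \<Longrightarrow> t \<le> pi \<Longrightarrow> a * cos (\<phi> + \<sigma> * \<kappa> * t) + b * sin (\<phi> + \<sigma> * \<kappa> * t) \<le> 0"
    "\<And>t. 0 \<le> t \<Longrightarrow> t \<le> pi \<Longrightarrow> \<exists>\<theta>. \<bar>\<theta>\<bar> \<le> \<kappa> * pi \<and>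
      (\<phi> + \<sigma> * \<kappa> * t = \<phi>0 + \<theta> \<or> \<phi> + \<sigma> * \<kappa> * t = \<phi>0 + pi + \<theta>)"
proof -
  obtain \<phi>1 where \<phi>1: "\<phi>1 = \<phi>0 \<or> \<phi>1 = \<phi>0 + pi" and A: "a * cos \<phi>1 + b * sin \<phi>1 \<le> 0"
  proof (cases "a * cos \<phi>0 + b * sin \<phi>0 \<le> 0")
    case False
    then show ?thesis using that[of "\<phi>0 + pi"] by simp
  qed (use that in auto)
  define B where "B = b * cos \<phi>1 - a * sin \<phi>1"
  have eq: "a * cos (\<phi>1 + \<theta>) + b * sin (\<phi>1 + \<theta>) = (a * cos \<phi>1 + b * sin \<phi>1) * cos \<theta> + B * sin \<theta>" for \<theta>
    by (simp add: B_def cos_add sin_add algebra_simps)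
  have neg: "a * cos (\<phi>1 + \<theta>) + b * sin (\<phi>1 + \<theta>) \<le> 0" if "\<bar>\<theta>\<bar> \<le> pi / 2" "B * sin \<theta> \<le> 0" for \<theta>
    unfolding eq using that A cos_ge_zero[of \<theta>] by (auto intro!: add_nonpos_nonpos mult_nonpos_nonneg)
  have small: "0 \<le> \<kappa> * t \<and> \<kappa> * t \<le> \<kappa> * pi \<and> \<kappa> * t \<le> pi / 2 \<and> 0 \<le> sin (\<kappa> * t)" if "0 \<le> t" "t \<le> pi" for t
  proof -
    have 1: "\<kappa> * t \<le> \<kappa> * pi" using that \<kappa> by simp
    have 2: "\<kappa> * pi \<le> (1 / 2) * pi" using \<kappa> by (intro mult_right_mono) auto
    have 0: "0 \<le> \<kappa> * t" using that \<kappa> by simp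
    have 3: "\<kappa> * t \<le> pi / 2" "\<kappa> * t \<le> pi" using 1 2 pi_gt_zero by linarith+
    show ?thesis using 0 1 3 by (auto intro!: sin_ge_zero)
  qed
  show thesis
  proof (cases "\<sigma> * B \<le> 0")
    case True
    show thesis
    proof (rule that[of \<phi>1])
      fix t :: real assume t: "0 \<le> t" "t \<le> pi"
      have "B * sin (\<sigma> * \<kappa> * t) = (\<sigma> * B) * sin (\<kappa> * t)" using \<sigma> by auto
      also have "\<dots> \<le> 0" using mult_nonpos_nonneg[OF True] small[OF t] by blast
      finally show "a * cos (\<phi>1 + \<sigma> * \<kappa> * t) + b * sin (\<phi>1 + \<sigma> * \<kappa> * t) \<le> 0"
        using small[OF t] \<sigma> by (intro neg) auto
      show "\<exists>\<theta>. \<bar>\<theta>\<bar> \<le> \<kappa> * pi \<and> (\<phi>1 + \<sigma> * \<kappa> * t = \<phi>0 + \<theta> \<or> \<phi>1 + \<sigma> * \<kappa> * t = \<phi>0 + pi + \<theta>)"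
        using \<phi>1 small[OF t] \<sigma> by (intro exI[of _ "\<sigma> * \<kappa> * t"]) auto
    qed
  next
    case False
    show thesis
    proof (rule that[of "\<phi>1 - \<sigma> * \<kappa> * pi"])
      fix t :: real assume t: "0 \<le> t" "t \<le> pi"
      define s where "s = pi - t"
      have s: "0 \<le> s" "s \<le> pi" using t by (auto simp: s_def)
      have *: "\<phi>1 - \<sigma> * \<kappa> * pi + \<sigma> * \<kappa> * t = \<phi>1 + (- \<sigma> * \<kappa> * s)" by (simp add: s_def algebra_simps)
      have "B * sin (- \<sigma> * \<kappa> * s) = - ((\<sigma> * B) * sin (\<kappa> * s))" using \<sigma> by auto
      also have "\<dots> \<le> 0" using mult_nonneg_nonneg[of "\<sigma> * B" "sin (\<kappa> * s)"] False small[OF s] by linarith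
      finally show "a * cos (\<phi>1 - \<sigma> * \<kappa> * pi + \<sigma> * \<kappa> * t) + b * sin (\<phi>1 - \<sigma> * \<kappa> * pi + \<sigma> * \<kappa> * t) \<le> 0"
        unfolding * using small[OF s] \<sigma> by (intro neg) auto
      show "\<exists>\<theta>. \<bar>\<theta>\<bar> \<le> \<kappa> * pi \<and> (\<phi>1 - \<sigma> * \<kappa> * pi + \<sigma> * \<kappa> * t = \<phi>0 + \<theta> \<or> \<phi>1 - \<sigma> * \<kappa> * pi + \<sigma> * \<kappa> * t = \<phi>0 + pi + \<theta>)"
        unfolding * using \<phi>1 small[OF s] \<sigma> by (intro exI[of _ "- \<sigma> * \<kappa> * s"]) auto
    qed
  qed
qed

text \<open>Diagonalization through double angles: half the difference of the diagonal entries and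
  the off-diagonal entry form a planar vector of modulus \<rho>. The eigenvalues are the mean m of
  the diagonal minus and plus \<rho>, and half the argument is the direction of the smaller
  one.\<close>

lemma quadratic_form_polar:
  fixes p q r :: real
  obtains \<nu> \<mu> \<phi>0 where "\<nu> \<le> \<mu>" "\<nu> * \<mu> = p * r - q\<^sup>2"
    "\<And>\<phi>. p * (cos \<phi>)\<^sup>2 + 2 * q * (cos \<phi> * sin \<phi>) + r * (sin \<phi>)\<^sup>2 = \<nu> * (cos (\<phi> - \<phi>0))\<^sup>2 + \<mu> * (sin (\<phi> - \<phi>0))\<^sup>2"
proof -
  define z where "z = Complex ((r - p) / 2) (- q)"
  define \<rho> where "\<rho> = cmod z"
  define \<psi> where "\<psi> = Arg z"
  have z: "(r - p) / 2 = \<rho> * cos \<psi>" "- q = \<rho> * sin \<psi>"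
    using rcis_cmod_Arg[of z] unfolding \<rho>_def \<psi>_def z_def by (auto simp: complex_eq_iff)
  define m where "m = (p + r) / 2"
  have pr: "p = m - \<rho> * cos \<psi>" "r = m + \<rho> * cos \<psi>" "q = - \<rho> * sin \<psi>" using z by (auto simp: m_def field_simps)
  show thesis
  proof (rule that)
    show "m - \<rho> \<le> m + \<rho>" by (simp add: \<rho>_def)
    have "p * r - q\<^sup>2 = m\<^sup>2 - ((\<rho> * cos \<psi>)\<^sup>2 + (\<rho> * sin \<psi>)\<^sup>2)"
      unfolding pr by (simp add: power2_eq_square algebra_simps)
    also have "(\<rho> * cos \<psi>)\<^sup>2 + (\<rho> * sin \<psi>)\<^sup>2 = \<rho>\<^sup>2"
      by (simp add: power_mult_distrib flip: distrib_left)
    finally show "(m - \<rho>) * (m + \<rho>) = p * r - q\<^sup>2"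
      by (simp add: power2_eq_square algebra_simps)
    fix \<phi>
    have 1: "(cos x)\<^sup>2 = (1 + cos (2 * x)) / 2" "(sin x)\<^sup>2 = (1 - cos (2 * x)) / 2" "cos x * sin x = sin (2 * x) / 2" for x :: real
      using sin_squared_eq[of x] cos_double[of x] by (simp_all add: sin_double)
    have "cos (2 * (\<phi> - \<psi> / 2)) = cos (2 * \<phi>) * cos \<psi> + sin (2 * \<phi>) * sin \<psi>"
      using cos_diff[of "2 * \<phi>" \<psi>] by (simp add: right_diff_distrib)
    then show "p * (cos \<phi>)\<^sup>2 + 2 * q * (cos \<phi> * sin \<phi>) + r * (sin \<phi>)\<^sup>2
        = (m - \<rho>) * (cos (\<phi> - \<psi> / 2))\<^sup>2 + (m + \<rho>) * (sin (\<phi> - \<psi> / 2))\<^sup>2"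
      unfolding 1 pr by (simp add: field_simps)
  qed
qed

section \<open>Inward moves\<close>

text \<open>The derivative of the polar curve of radius \<open>r * sin (s / r)\<close> at angle
  \<open>\<phi> + \<sigma> * \<kappa> * (s / r)\<close>, which returns to the origin at
  \<open>s = pi * r\<close>: a circle of diameter r if \<open>\<kappa> = 1\<close>, and a petal in a
  sector of opening \<open>\<kappa> * pi\<close> for smaller \<kappa>. Scaling time by r keeps the
  speed at most 1.\<close>

definition loop_control :: "real \<Rightarrow> real \<Rightarrow> real \<Rightarrow> real \<Rightarrow> real \<Rightarrow> real ^ 2"
  where "loop_control r \<kappa> \<sigma> \<phi> s = (\<chi> i. if i = 1
    then cos (s / r) * cos (\<phi> + \<sigma> * \<kappa> * (s / r)) - \<sigma> * \<kappa> * sin (s / r) * sin (\<phi> + \<sigma> * \<kappa> * (s / r))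
    else cos (s / r) * sin (\<phi> + \<sigma> * \<kappa> * (s / r)) + \<sigma> * \<kappa> * sin (s / r) * cos (\<phi> + \<sigma> * \<kappa> * (s / r)))"

lemma continuous_in_controls:
  assumes "continuous_on {0..} u" "\<And>t. 0 \<le> t \<Longrightarrow> u t \<in> control_values"
  shows "u \<in> controls"
  using assms continuous_imp_measurable_on_sets_lebesgue[OF assms(1)] by (auto simp: controls_def)

lemma loop_control_in_controls:
  assumes \<kappa>: "0 < \<kappa>" "\<kappa> \<le> 1" and \<sigma>: "\<sigma> = 1 \<or> \<sigma> = - 1" and r: "0 < r"
  shows "loop_control r \<kappa> \<sigma> \<phi> \<in> controls"
proof (rule continuous_in_controls)
  show "continuous_on {0..} (loop_control r \<kappa> \<sigma> \<phi>)"
  proof -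
    have "continuous_on {0..} (\<lambda>s. loop_control r \<kappa> \<sigma> \<phi> s $ i)" for i
      using r by (cases "i = 1") (auto simp: loop_control_def intro!: continuous_intros)
    then show ?thesis using continuous_on_componentwise[of "{0..}" "loop_control r \<kappa> \<sigma> \<phi>"]
      by (auto simp: Basis_vec_def inner_axis)
  qed
  fix s :: real
  define t \<theta> where "t = s / r" and "\<theta> = \<phi> + \<sigma> * \<kappa> * t"
  \<comment> \<open>Multiplicativity of the complex modulus: the control is the vector
    \<open>(cos t, \<sigma> * \<kappa> * sin t)\<close> rotated by \<theta>.\<close>
  have id: "(a * p - b * q)\<^sup>2 + (a * q + b * p)\<^sup>2 = (a\<^sup>2 + b\<^sup>2) * (p\<^sup>2 + q\<^sup>2)" for a b p q :: real
    by (simp add: power2_eq_square algebra_simps)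
  have "(cos t * cos \<theta> - \<sigma> * \<kappa> * sin t * sin \<theta>)\<^sup>2 + (cos t * sin \<theta> + \<sigma> * \<kappa> * sin t * cos \<theta>)\<^sup>2
      = ((cos t)\<^sup>2 + (\<sigma> * \<kappa> * sin t)\<^sup>2) * ((cos \<theta>)\<^sup>2 + (sin \<theta>)\<^sup>2)"
    by (rule id)
  also have "\<dots> = (cos t)\<^sup>2 + \<kappa>\<^sup>2 * (sin t)\<^sup>2"
    using \<sigma> by (auto simp: power_mult_distrib)
  also have "\<dots> \<le> (cos t)\<^sup>2 + 1 * (sin t)\<^sup>2"
    using \<kappa> by (intro add_mono mult_right_mono) (auto simp: power_le_one)
  finally show "loop_control r \<kappa> \<sigma> \<phi> s \<in> control_values"
    by (simp add: control_values_def loop_control_def t_def \<theta>_def)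
qed

context constrained_system
begin

text \<open>The radius \<open>r\<close> corresponds to a gain of order \<open>r\<^sup>2\<close> in \<open>h\<close> at the price of a displacement of the
  same order.\<close>

definition inward_move :: "real \<Rightarrow> real \<Rightarrow> real \<Rightarrow> real ^ 'n \<Rightarrow> bool"
  where "inward_move r c M \<xi> \<longleftrightarrow> (\<exists>u\<in>controls. \<exists>T. 0 \<le> T \<and> T \<le> M * r \<and>
    (\<forall>s\<in>{0..T}. h (trajectory f u \<xi> s) \<le> 0) \<and> h (trajectory f u \<xi> T) \<le> h \<xi> - c * r\<^sup>2 \<and>
    norm (trajectory f u \<xi> T - \<xi>) \<le> M * r\<^sup>2)"

text \<open>The quadratic form of \<open>S_matrix f h x\<close> at the unit vector of angle
  \<phi>.\<close>

definition quad :: "real ^ 'n \<Rightarrow> real \<Rightarrow> real"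
  where "quad x \<phi> = lie2 1 1 x * (cos \<phi>)\<^sup>2 + (lie2 1 2 x + lie2 2 1 x) * (cos \<phi> * sin \<phi>) + lie2 2 2 x * (sin \<phi>)\<^sup>2"

text \<open>By \<open>lie_bracket_lie2\<close> this is
  \<open>gradient h x \<bullet> lie_bracket (f 1) (f 2) x\<close>, the coefficient of the area in
  the expansion.\<close>

definition bracket :: "real ^ 'n \<Rightarrow> real"
  where "bracket x = lie2 2 1 x - lie2 1 2 x"

text \<open>Accounting in units of \<open>\<gamma> * r\<^sup>2 * t ^ 3\<close> with
  \<open>\<gamma> = \<alpha> * \<kappa> / 640\<close>: the area term yields a decrease of at least
  four units, 640 being 4 times the 4 of the area formula times the 40 of
  \<open>cubic_le_sub_sin_cos\<close>. The condition on the starting angle concedes one unit and,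
  for small r, the cubic error of the expansion another. So h is at most its initial value
  throughout the loop, not only at its end.\<close>

lemma loop_inward_move:
  assumes \<alpha>: "0 < \<alpha>" and \<kappa>: "0 < \<kappa>" "\<kappa> \<le> 1"
  obtains r\<^sub>0 c M where "0 < r\<^sub>0" "0 < c" "0 < M"
    "\<And>\<xi> r \<sigma> \<phi>. norm \<xi> \<le> R \<Longrightarrow> h \<xi> \<le> 0 \<Longrightarrow> 0 < r \<Longrightarrow> r < r\<^sub>0 \<Longrightarrow> \<sigma> = 1 \<or> \<sigma> = - 1 \<Longrightarrow>
      \<sigma> * bracket \<xi> \<le> - \<alpha> \<Longrightarrow>
      (\<And>t. 0 \<le> t \<Longrightarrow> t \<le> pi \<Longrightarrow>
        r * sin t * (lie1 1 \<xi> * cos (\<phi> + \<sigma> * \<kappa> * t) + lie1 2 \<xi> * sin (\<phi> + \<sigma> * \<kappa> * t))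
        + r\<^sup>2 * (sin t)\<^sup>2 * quad \<xi> (\<phi> + \<sigma> * \<kappa> * t) / 2 \<le> \<alpha> * \<kappa> / 640 * r\<^sup>2 * t ^ 3) \<Longrightarrow>
      inward_move r c M \<xi>"
proof -
  obtain K where K: "0 < K" and exp: "\<And>\<xi> u w1 w2 A T t. norm \<xi> \<le> R \<Longrightarrow> u \<in> controls \<Longrightarrow> T \<le> 1 \<Longrightarrow> t \<in> {0..T} \<Longrightarrow>
      w1 0 = 0 \<Longrightarrow> w2 0 = 0 \<Longrightarrow> A 0 = 0 \<Longrightarrow>
      (\<And>s. s \<in> {0..T} \<Longrightarrow> (w1 has_real_derivative u s $ 1) (at s within {0..T})) \<Longrightarrow>
      (\<And>s. s \<in> {0..T} \<Longrightarrow> (w2 has_real_derivative u s $ 2) (at s within {0..T})) \<Longrightarrow>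
      (\<And>s. s \<in> {0..T} \<Longrightarrow> (A has_real_derivative (w1 s * u s $ 2 - w2 s * u s $ 1) / 2) (at s within {0..T})) \<Longrightarrow>
      \<bar>h (trajectory f u \<xi> t) - h \<xi> - (lie1 1 \<xi> * w1 t + lie1 2 \<xi> * w2 t
        + (lie2 1 1 \<xi> * (w1 t)\<^sup>2 + (lie2 1 2 \<xi> + lie2 2 1 \<xi>) * w1 t * w2 t + lie2 2 2 \<xi> * (w2 t)\<^sup>2) / 2
        + (lie2 2 1 \<xi> - lie2 1 2 \<xi>) * A t)\<bar> \<le> K * t ^ 3 \<and>
      norm (trajectory f u \<xi> t - \<xi> - (w1 t *\<^sub>R f 1 \<xi> + w2 t *\<^sub>R f 2 \<xi>)) \<le> K * t\<^sup>2"
    using trajectory_expansion[of R] by blast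
  define \<gamma> where "\<gamma> = \<alpha> * \<kappa> / 640"
  have \<gamma>: "0 < \<gamma>" using \<alpha> \<kappa> by (simp add: \<gamma>_def)
  define r\<^sub>0 where "r\<^sub>0 = min (1 / pi) (\<gamma> / K)"
  define M where "M = max pi (K * pi\<^sup>2)"
  show thesis
  proof (rule that)
    show "0 < r\<^sub>0" using \<gamma> K by (simp add: r\<^sub>0_def)
    show "0 < \<gamma> * pi ^ 3" using \<gamma> by simp
    show "0 < M" by (simp add: M_def less_max_iff_disj)
    fix \<xi> :: "real ^ 'n" and r \<sigma> \<phi> :: real
    assume \<xi>: "norm \<xi> \<le> R" "h \<xi> \<le> 0" and r: "0 < r" "r < r\<^sub>0" and \<sigma>: "\<sigma> = 1 \<or> \<sigma> = - 1"
      and br: "\<sigma> * bracket \<xi> \<le> - \<alpha>"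
      and start: "\<And>t. 0 \<le> t \<Longrightarrow> t \<le> pi \<Longrightarrow>
        r * sin t * (lie1 1 \<xi> * cos (\<phi> + \<sigma> * \<kappa> * t) + lie1 2 \<xi> * sin (\<phi> + \<sigma> * \<kappa> * t))
        + r\<^sup>2 * (sin t)\<^sup>2 * quad \<xi> (\<phi> + \<sigma> * \<kappa> * t) / 2 \<le> \<alpha> * \<kappa> / 640 * r\<^sup>2 * t ^ 3"
    define u where "u = loop_control r \<kappa> \<sigma> \<phi>"
    have u: "u \<in> controls" unfolding u_def by (rule loop_control_in_controls[OF \<kappa> \<sigma> r(1)])
    define \<theta> where "\<theta> s = \<phi> + \<sigma> * \<kappa> * (s / r)" for s
    define w1 where "w1 s = r * sin (s / r) * cos (\<theta> s)" for s
    define w2 where "w2 s = r * sin (s / r) * sin (\<theta> s)" for s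
    \<comment> \<open>Half the integral of the squared radius against the angle, the polar formula
      for the signed area.\<close>
    define A where "A s = \<sigma> * \<kappa> * r\<^sup>2 / 4 * (s / r - sin (s / r) * cos (s / r))" for s
    have u1: "u s $ 1 = cos (s / r) * cos (\<theta> s) - \<sigma> * \<kappa> * sin (s / r) * sin (\<theta> s)"
      and u2: "u s $ 2 = cos (s / r) * sin (\<theta> s) + \<sigma> * \<kappa> * sin (s / r) * cos (\<theta> s)" for s
      by (simp_all add: u_def loop_control_def \<theta>_def)
    define T where "T = pi * r"
    \<comment> \<open>The bound \<open>1 / pi\<close> in \<open>r\<^sub>0\<close> is there to keep
      the loop within the time horizon 1 of the expansion.\<close>
    have T: "0 \<le> T" "T \<le> 1" using r by (auto simp: T_def r\<^sub>0_def field_simps)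
    have init: "w1 0 = 0" "w2 0 = 0" "A 0 = 0" by (auto simp: w1_def w2_def A_def)
    have \<theta>': "(\<theta> has_real_derivative \<sigma> * \<kappa> / r) (at s within S)" for s S
      unfolding \<theta>_def using r by (auto intro!: derivative_eq_intros)
    have w1': "(w1 has_real_derivative u s $ 1) (at s within S)" for s S
      unfolding w1_def u1 using r by (auto intro!: derivative_eq_intros \<theta>' simp: field_simps)
    have w2': "(w2 has_real_derivative u s $ 2) (at s within S)" for s S
      unfolding w2_def u2 using r by (auto intro!: derivative_eq_intros \<theta>' simp: field_simps)
    have A': "(A has_real_derivative (w1 s * u s $ 2 - w2 s * u s $ 1) / 2) (at s within S)" for s S
    proof -
      have id: "(r * b * p) * (a * q + \<sigma> * \<kappa> * b * p) - (r * b * q) * (a * p - \<sigma> * \<kappa> * b * q)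
          = r * \<sigma> * \<kappa> * b\<^sup>2 * (p\<^sup>2 + q\<^sup>2)" for a b p q :: real
        by (simp add: power2_eq_square algebra_simps)
      have "w1 s * u s $ 2 - w2 s * u s $ 1 = r * \<sigma> * \<kappa> * (sin (s / r))\<^sup>2 * ((cos (\<theta> s))\<^sup>2 + (sin (\<theta> s))\<^sup>2)"
        unfolding w1_def w2_def u1 u2 by (rule id)
      then have eq: "(w1 s * u s $ 2 - w2 s * u s $ 1) / 2 = r * \<sigma> * \<kappa> * (sin (s / r))\<^sup>2 / 2" by simp
      have c: "(cos (s / r))\<^sup>2 = 1 - (sin (s / r))\<^sup>2" by (simp add: cos_squared_eq)
      have "(A has_real_derivative \<sigma> * \<kappa> * r\<^sup>2 / 4 * (1 / r - (cos (s / r) * (1 / r) * cos (s / r) + - sin (s / r) * (1 / r) * sin (s / r)))) (at s within S)"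
        unfolding A_def using r by (auto intro!: derivative_eq_intros)
      moreover have "\<sigma> * \<kappa> * r\<^sup>2 / 4 * (1 / r - (cos (s / r) * (1 / r) * cos (s / r) + - sin (s / r) * (1 / r) * sin (s / r)))
          = r * \<sigma> * \<kappa> * (1 - (cos (s / r))\<^sup>2 + (sin (s / r))\<^sup>2) / 4"
        using r by (simp add: power2_eq_square field_simps)
      ultimately have "(A has_real_derivative r * \<sigma> * \<kappa> * (1 - (cos (s / r))\<^sup>2 + (sin (s / r))\<^sup>2) / 4) (at s within S)"
        by (simp only:)
      then show ?thesis unfolding eq c by (simp add: mult_ac)
    qed
    have h_le: "h (trajectory f u \<xi> s) \<le> h \<xi> - \<gamma> * r\<^sup>2 * (s / r) ^ 3"
      and d_le: "norm (trajectory f u \<xi> s - \<xi> - (w1 s *\<^sub>R f 1 \<xi> + w2 s *\<^sub>R f 2 \<xi>)) \<le> K * s\<^sup>2" if s: "s \<in> {0..T}" for s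
    proof -
      define t where "t = s / r"
      have t: "0 \<le> t" "t \<le> pi" using s r by (auto simp: t_def T_def field_simps)
      have st: "s = r * t" using r by (simp add: t_def)
      have E: "\<bar>h (trajectory f u \<xi> s) - h \<xi> - (lie1 1 \<xi> * w1 s + lie1 2 \<xi> * w2 s
        + (lie2 1 1 \<xi> * (w1 s)\<^sup>2 + (lie2 1 2 \<xi> + lie2 2 1 \<xi>) * w1 s * w2 s + lie2 2 2 \<xi> * (w2 s)\<^sup>2) / 2
        + (lie2 2 1 \<xi> - lie2 1 2 \<xi>) * A s)\<bar> \<le> K * s ^ 3 \<and>
        norm (trajectory f u \<xi> s - \<xi> - (w1 s *\<^sub>R f 1 \<xi> + w2 s *\<^sub>R f 2 \<xi>)) \<le> K * s\<^sup>2"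
        by (rule exp[OF \<xi>(1) u T(2) s init w1' w2' A'])
      then show "norm (trajectory f u \<xi> s - \<xi> - (w1 s *\<^sub>R f 1 \<xi> + w2 s *\<^sub>R f 2 \<xi>)) \<le> K * s\<^sup>2" ..
      have "lie1 1 \<xi> * w1 s + lie1 2 \<xi> * w2 s
        + (lie2 1 1 \<xi> * (w1 s)\<^sup>2 + (lie2 1 2 \<xi> + lie2 2 1 \<xi>) * w1 s * w2 s + lie2 2 2 \<xi> * (w2 s)\<^sup>2) / 2
        = r * sin t * (lie1 1 \<xi> * cos (\<phi> + \<sigma> * \<kappa> * t) + lie1 2 \<xi> * sin (\<phi> + \<sigma> * \<kappa> * t))
        + r\<^sup>2 * (sin t)\<^sup>2 * quad \<xi> (\<phi> + \<sigma> * \<kappa> * t) / 2"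
        by (simp add: w1_def w2_def quad_def \<theta>_def flip: t_def) (simp add: power2_eq_square algebra_simps)
      also have "\<dots> \<le> \<gamma> * r\<^sup>2 * t ^ 3" unfolding \<gamma>_def by (rule start[OF t])
      finally have 1: "lie1 1 \<xi> * w1 s + lie1 2 \<xi> * w2 s
        + (lie2 1 1 \<xi> * (w1 s)\<^sup>2 + (lie2 1 2 \<xi> + lie2 2 1 \<xi>) * w1 s * w2 s + lie2 2 2 \<xi> * (w2 s)\<^sup>2) / 2
        \<le> \<gamma> * r\<^sup>2 * t ^ 3" .
      have "(lie2 2 1 \<xi> - lie2 1 2 \<xi>) * A s = (\<sigma> * bracket \<xi>) * (\<kappa> * r\<^sup>2 / 4 * (t - sin t * cos t))"
        by (simp add: A_def bracket_def t_def)
      also have "\<dots> \<le> - \<alpha> * (\<kappa> * r\<^sup>2 / 4 * (t - sin t * cos t))"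
      proof (rule mult_right_mono[OF br])
        have "0 \<le> t - sin t * cos t" using cubic_le_sub_sin_cos[OF t] zero_le_power[OF t(1), of 3] by linarith
        then show "0 \<le> \<kappa> * r\<^sup>2 / 4 * (t - sin t * cos t)" using \<kappa> by simp
      qed
      also have "\<dots> \<le> - \<alpha> * (\<kappa> * r\<^sup>2 / 4 * (t ^ 3 / 40))"
        using cubic_le_sub_sin_cos[OF t] \<alpha> \<kappa> by (intro mult_left_mono_neg mult_left_mono) auto
      also have "\<dots> = - 4 * (\<gamma> * r\<^sup>2 * t ^ 3)" by (simp add: \<gamma>_def)
      finally have 2: "(lie2 2 1 \<xi> - lie2 1 2 \<xi>) * A s \<le> - 4 * (\<gamma> * r\<^sup>2 * t ^ 3)" .
      have "K * r \<le> \<gamma>" using r K by (auto simp: r\<^sub>0_def field_simps)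
      then have "(K * r) * (r\<^sup>2 * t ^ 3) \<le> \<gamma> * (r\<^sup>2 * t ^ 3)" using t by (intro mult_right_mono) auto
      then have 3: "K * s ^ 3 \<le> \<gamma> * r\<^sup>2 * t ^ 3" by (simp add: st power_mult_distrib power2_eq_square power3_eq_cube mult_ac)
      have "0 \<le> \<gamma> * r\<^sup>2 * t ^ 3" using \<gamma> t by simp
      with E 1 2 3 show "h (trajectory f u \<xi> s) \<le> h \<xi> - \<gamma> * r\<^sup>2 * (s / r) ^ 3" unfolding t_def[symmetric] by linarith
    qed
    show "inward_move r (\<gamma> * pi ^ 3) M \<xi>"
      unfolding inward_move_def
    proof (intro bexI[OF _ u] exI[of _ T] conjI ballI)
      show "T \<le> M * r" using r by (simp add: T_def M_def mult_right_mono)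
      have Tr: "T / r = pi" using r by (simp add: T_def)
      show "h (trajectory f u \<xi> T) \<le> h \<xi> - \<gamma> * pi ^ 3 * r\<^sup>2"
        using h_le[of T] T unfolding Tr by (simp add: mult_ac)
      \<comment> \<open>The loop is closed, so the displacement of order r cancels and only the
        error quadratic in T remains.\<close>
      have "w1 T = 0" "w2 T = 0" by (simp_all add: w1_def w2_def Tr)
      then have "norm (trajectory f u \<xi> T - \<xi>) \<le> K * T\<^sup>2" using d_le[of T] T by simp
      also have "\<dots> = (K * pi\<^sup>2) * r\<^sup>2" by (simp add: T_def power_mult_distrib)
      also have "\<dots> \<le> M * r\<^sup>2" by (intro mult_right_mono) (auto simp: M_def)
      finally show "norm (trajectory f u \<xi> T - \<xi>) \<le> M * r\<^sup>2" .
      fix s assume s: "s \<in> {0..T}"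
      have "0 \<le> \<gamma> * r\<^sup>2 * (s / r) ^ 3" using \<gamma> r s by auto
      then show "h (trajectory f u \<xi> s) \<le> 0" using h_le[OF s] \<xi>(2) by linarith
    qed (rule T(1))
  qed
qed

text \<open>The constant unit control opposite to the vector of first Lie derivatives at
  \<open>x\<^sub>0\<close> decreases h at a rate bounded away from 0. It is applied only for the
  time \<open>r\<^sup>2\<close>, so that gain and displacement have the same order as for the
  loops.\<close>

lemma nonsingular_inward_move:
  assumes ns: "lie1 1 x\<^sub>0 \<noteq> 0 \<or> lie1 2 x\<^sub>0 \<noteq> 0"
  obtains \<eta> r\<^sub>0 c M where "0 < \<eta>" "0 < r\<^sub>0" "0 < c" "0 < M"
    "\<And>\<xi> r. norm (\<xi> - x\<^sub>0) < \<eta> \<Longrightarrow> h \<xi> \<le> 0 \<Longrightarrow> 0 < r \<Longrightarrow> r < r\<^sub>0 \<Longrightarrow> inward_move r c M \<xi>"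
proof -
  define n where "n = sqrt ((lie1 1 x\<^sub>0)\<^sup>2 + (lie1 2 x\<^sub>0)\<^sup>2)"
  have pos: "0 < (lie1 1 x\<^sub>0)\<^sup>2 + (lie1 2 x\<^sub>0)\<^sup>2" using ns by (auto simp: sum_power2_gt_zero_iff)
  then have n: "0 < n" by (simp add: n_def)
  have n2: "n * n = (lie1 1 x\<^sub>0)\<^sup>2 + (lie1 2 x\<^sub>0)\<^sup>2" using pos by (simp add: n_def)
  define v :: "real ^ 2" where "v = vector [- lie1 1 x\<^sub>0 / n, - lie1 2 x\<^sub>0 / n]"
  have v: "v $ 1 = - lie1 1 x\<^sub>0 / n" "v $ 2 = - lie1 2 x\<^sub>0 / n" by (simp_all add: v_def vector_2)
  have vU: "v \<in> control_values"
    unfolding control_values_def using n n2 by (simp add: v power_divide flip: add_divide_distrib) (simp add: power2_eq_square)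
  define u :: "real \<Rightarrow> real ^ 2" where "u = (\<lambda>_. v)"
  have u: "u \<in> controls" by (rule continuous_in_controls) (auto simp: u_def vU)
  define g where "g y = v $ 1 * lie1 1 y + v $ 2 * lie1 2 y" for y
  have "v $ 1 * lie1 1 x\<^sub>0 + v $ 2 * lie1 2 x\<^sub>0 = - (n * n) / n"
    unfolding n2 by (simp add: v power2_eq_square diff_divide_distrib)
  then have g0: "g x\<^sub>0 = - n" using n by (simp add: g_def)
  have "continuous_on UNIV g"
    unfolding g_def by (intro continuous_intros continuous_lipschitz_on_cballs lie1_lipschitz)
  then have "isCont g x\<^sub>0" by (simp add: continuous_on_eq_continuous_at)
  then obtain d where d: "0 < d" "\<And>y. norm (y - x\<^sub>0) < d \<Longrightarrow> \<bar>g y - g x\<^sub>0\<bar> < n / 2"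
    unfolding continuous_at_eps_delta dist_norm using n by (metis half_gt_zero real_norm_def)
  have gy: "g y \<le> - n / 2" if "norm (y - x\<^sub>0) < d" for y
    using d(2)[OF that] g0 by linarith
  define r\<^sub>0 where "r\<^sub>0 = min 1 (d / (2 * (k\<^sub>0 + 1)))"
  show thesis
  proof (rule that[of "d / 2" r\<^sub>0 "n / 2" "k\<^sub>0 + 1"])
    show "0 < d / 2" "0 < n / 2" using d n by auto
    show "0 < r\<^sub>0" using d k\<^sub>0_nonneg by (simp add: r\<^sub>0_def)
    show "0 < k\<^sub>0 + 1" using k\<^sub>0_nonneg by simp
    fix \<xi> :: "real ^ 'n" and r :: real
    assume \<xi>: "norm (\<xi> - x\<^sub>0) < d / 2" "h \<xi> \<le> 0" and r: "0 < r" "r < r\<^sub>0"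
    have r1: "r\<^sup>2 \<le> r" "r \<le> 1" using r by (auto simp: r\<^sub>0_def power2_eq_square mult_left_le)
    have "(k\<^sub>0 + 1) * r < d / 2" using r k\<^sub>0_nonneg by (simp add: r\<^sub>0_def field_simps)
    have disp: "norm (trajectory f u \<xi> s - \<xi>) \<le> (k\<^sub>0 + 1) * s" if "0 \<le> s" for s
      using norm_trajectory_diff[OF u order_refl that, of \<xi>] trajectory_0[OF u] that by (simp add: distrib_right)
    have h_le: "h (trajectory f u \<xi> s) \<le> h \<xi> - n / 2 * s" if s: "0 \<le> s" "s \<le> r\<^sup>2" for s
    proof -
      have "((\<lambda>s. g (trajectory f u \<xi> s)) has_integral h (trajectory f u \<xi> s) - h \<xi>) {0..s}"
        using h_along_trajectory[OF u s(1), of \<xi>] by (simp add: g_def u_def)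
      moreover have "((\<lambda>_. - n / 2) has_integral (s - 0) *\<^sub>R (- n / 2)) {0..s}"
        using has_integral_const_real[of "- n / 2" 0 s] s by simp
      moreover have "g (trajectory f u \<xi> q) \<le> - n / 2" if q: "q \<in> {0..s}" for q
      proof (rule gy)
        have "norm (trajectory f u \<xi> q - x\<^sub>0) \<le> norm (trajectory f u \<xi> q - \<xi>) + norm (\<xi> - x\<^sub>0)"
          using norm_triangle_ineq[of "trajectory f u \<xi> q - \<xi>" "\<xi> - x\<^sub>0"] by simp
        moreover have "norm (trajectory f u \<xi> q - \<xi>) \<le> (k\<^sub>0 + 1) * q" using disp q by simp
        moreover have "(k\<^sub>0 + 1) * q \<le> (k\<^sub>0 + 1) * r" using q s r1 k\<^sub>0_nonneg by (intro mult_left_mono) auto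
        ultimately show "norm (trajectory f u \<xi> q - x\<^sub>0) < d" using \<xi>(1) \<open>(k\<^sub>0 + 1) * r < d / 2\<close> by linarith
      qed
      ultimately have "h (trajectory f u \<xi> s) - h \<xi> \<le> (s - 0) *\<^sub>R (- n / 2)"
        by (rule has_integral_le)
      then show ?thesis by (simp add: mult.commute)
    qed
    show "inward_move r (n / 2) (k\<^sub>0 + 1) \<xi>"
      unfolding inward_move_def
    proof (intro bexI[OF _ u] exI[of _ "r\<^sup>2"] conjI ballI)
      show "r\<^sup>2 \<le> (k\<^sub>0 + 1) * r" using r1 k\<^sub>0_nonneg r by (simp add: distrib_right add_increasing)
      show "h (trajectory f u \<xi> (r\<^sup>2)) \<le> h \<xi> - n / 2 * r\<^sup>2" using h_le[of "r\<^sup>2"] by simp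
      show "norm (trajectory f u \<xi> (r\<^sup>2) - \<xi>) \<le> (k\<^sub>0 + 1) * r\<^sup>2" using disp by simp
      fix s assume s: "s \<in> {0..r\<^sup>2}"
      have "0 \<le> n / 2 * s" using n s by simp
      then show "h (trajectory f u \<xi> s) \<le> 0" using h_le[of s] s \<xi>(2) by auto
    qed simp
  qed
qed


lemma abs_quad_diff_le:
  assumes N: "\<And>l m. \<bar>lie2 l m x - lie2 l m y\<bar> \<le> N"
  shows "\<bar>quad x \<phi> - quad y \<phi>\<bar> \<le> 4 * N"
proof -
  have N0: "0 \<le> N" using N[of 1 1] by linarith
  have c: "(cos \<phi>)\<^sup>2 \<le> 1" "(sin \<phi>)\<^sup>2 \<le> 1" "\<bar>cos \<phi> * sin \<phi>\<bar> \<le> 1"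
    by (auto simp: abs_square_le_1 abs_mult intro!: mult_le_one)
  have t: "\<bar>a * b\<bar> \<le> N" if "\<bar>a\<bar> \<le> N" "\<bar>b\<bar> \<le> 1" for a b
    using mult_mono[OF that N0 abs_ge_zero] by (simp add: abs_mult)
  have "quad x \<phi> - quad y \<phi> = (lie2 1 1 x - lie2 1 1 y) * (cos \<phi>)\<^sup>2
      + (lie2 1 2 x - lie2 1 2 y) * (cos \<phi> * sin \<phi>) + (lie2 2 1 x - lie2 2 1 y) * (cos \<phi> * sin \<phi>)
      + (lie2 2 2 x - lie2 2 2 y) * (sin \<phi>)\<^sup>2"
    by (simp add: quad_def algebra_simps)
  moreover have "\<bar>(lie2 1 1 x - lie2 1 1 y) * (cos \<phi>)\<^sup>2\<bar> \<le> N" "\<bar>(lie2 2 2 x - lie2 2 2 y) * (sin \<phi>)\<^sup>2\<bar> \<le> N"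
    "\<bar>(lie2 1 2 x - lie2 1 2 y) * (cos \<phi> * sin \<phi>)\<bar> \<le> N" "\<bar>(lie2 2 1 x - lie2 2 1 y) * (cos \<phi> * sin \<phi>)\<bar> \<le> N"
    using N c by (auto intro!: t)
  ultimately show ?thesis by linarith
qed

lemma quad_polar:
  obtains \<nu> \<mu> \<phi>0 where "\<nu> \<le> \<mu>" "\<nu> * \<mu> = S_matrix f h x $ 1 $ 1 * S_matrix f h x $ 2 $ 2 - (S_matrix f h x $ 1 $ 2)\<^sup>2"
    "\<And>\<phi>. quad x \<phi> = \<nu> * (cos (\<phi> - \<phi>0))\<^sup>2 + \<mu> * (sin (\<phi> - \<phi>0))\<^sup>2"
proof -
  define q where "q = (lie2 1 2 x + lie2 2 1 x) / 2"
  have q: "lie2 1 2 x + lie2 2 1 x = 2 * q" by (simp add: q_def)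
  obtain \<nu> \<mu> \<phi>0 where "\<nu> \<le> \<mu>" "\<nu> * \<mu> = lie2 1 1 x * lie2 2 2 x - q\<^sup>2"
    "\<And>\<phi>. lie2 1 1 x * (cos \<phi>)\<^sup>2 + 2 * q * (cos \<phi> * sin \<phi>) + lie2 2 2 x * (sin \<phi>)\<^sup>2
      = \<nu> * (cos (\<phi> - \<phi>0))\<^sup>2 + \<mu> * (sin (\<phi> - \<phi>0))\<^sup>2"
    using quadratic_form_polar by blast
  then show thesis
    using that[of \<nu> \<mu> \<phi>0] by (simp add: S_matrix_lie2 quad_def q)
qed

lemma quad_nonpos:
  assumes "negative_semidefinite (S_matrix f h x)"
  shows "quad x \<phi> \<le> 0"
proof -
  define v :: "real ^ 2" where "v = vector [cos \<phi>, sin \<phi>]"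
  have "v \<bullet> (S_matrix f h x *v v) \<le> 0"
    using assms by (simp add: negative_semidefinite_def)
  moreover have "v \<bullet> (S_matrix f h x *v v) = quad x \<phi>"
    by (simp add: v_def inner_vec_def matrix_vector_mult_def sum_2 vector_2 S_matrix_lie2 quad_def)
      (simp add: power2_eq_square field_simps)
  ultimately show ?thesis by simp
qed

lemma continuous_on_bracket: "continuous_on UNIV bracket"
  unfolding bracket_def[abs_def] by (intro continuous_intros continuous_lipschitz_on_cballs lie2_lipschitz)

end

section \<open>Inward moves near every point of the constraint set\<close>

locale regular_constraint = constrained_system f k k\<^sub>0 h
  for f :: "2 \<Rightarrow> real ^ 'n \<Rightarrow> real ^ 'n" and k k\<^sub>0 :: real and h :: "real ^ 'n \<Rightarrow> real" +
  fixes \<alpha> \<delta> d\<^sub>0 :: real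
  assumes \<alpha>_pos: "0 < \<alpha>"
    and bracket_bound: "\<And>x. x \<in> singular_set f h \<Longrightarrow> \<alpha> < \<bar>gradient h x \<bullet> lie_bracket (f 1) (f 2) x\<bar>"
    and S_form: "\<And>x. x \<in> singular_set f h \<Longrightarrow>
      negative_semidefinite (S_matrix f h x) \<or> indefinite (S_matrix f h x)"
    and \<delta>_pos: "0 < \<delta>" and d\<^sub>0_pos: "0 < d\<^sub>0"
    and distance: "\<And>x. x \<in> {y + b | y b. y \<in> singular_set f h \<and> b \<in> cball 0 \<delta>} \<Longrightarrow>
      sqrt ((gradient h x \<bullet> f 1 x)\<^sup>2 + (gradient h x \<bullet> f 2 x)\<^sup>2) \<ge> d\<^sub>0 * infdist x (singular_set f h)"
begin

lemma singular_iff: "x \<in> singular_set f h \<longleftrightarrow> h x \<le> 0 \<and> lie1 1 x = 0 \<and> lie1 2 x = 0"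
  by (auto simp: singular_set_def constraint_set_def lie1_def)

lemma continuous_on_h: "continuous_on A h"
  using class_C2_gradient(1)[OF h_C2] has_derivative_continuous
  by (metis continuous_at_imp_continuous_on)

lemma closed_singular: "closed (singular_set f h)"
proof -
  have "singular_set f h = {x. h x \<le> 0} \<inter> ({x. lie1 1 x = 0} \<inter> {x. lie1 2 x = 0})"
    using singular_iff by auto
  moreover have "continuous_on UNIV (lie1 l)" for l
    by (intro continuous_lipschitz_on_cballs lie1_lipschitz)
  ultimately show ?thesis
    by (auto intro!: closed_Int closed_Collect_le closed_Collect_eq continuous_on_h continuous_intros)
qed

text \<open>Either alternative of the hypothesis on S excludes two positive eigenvalues. Both are
  covered because a negative semidefinite singular point may have indefinite ones arbitrarily close
  to it, and \<open>degenerate_inward_move\<close> works with the nearest singular point.\<close>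

lemma eigenvalue_nonpos:
  assumes x: "x \<in> singular_set f h"
    and p: "\<nu> \<le> \<mu>" "\<nu> * \<mu> = S_matrix f h x $ 1 $ 1 * S_matrix f h x $ 2 $ 2 - (S_matrix f h x $ 1 $ 2)\<^sup>2"
      "\<And>\<phi>. quad x \<phi> = \<nu> * (cos (\<phi> - \<phi>0))\<^sup>2 + \<mu> * (sin (\<phi> - \<phi>0))\<^sup>2"
  shows "\<nu> \<le> 0"
  using S_form[OF x]
proof
  assume "negative_semidefinite (S_matrix f h x)"
  from quad_nonpos[OF this, of \<phi>0] show ?thesis using p(3)[of \<phi>0] by simp
next
  assume "indefinite (S_matrix f h x)"
  then have "\<nu> * \<mu> < 0" using p(2) by (simp add: indefinite_def)
  then show ?thesis using p(1) by (auto simp: mult_less_0_iff)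
qed

lemma singular_bracket_nbhd:
  assumes x\<^sub>0: "x\<^sub>0 \<in> singular_set f h"
  obtains d where "0 < d" "\<And>\<xi>. norm (\<xi> - x\<^sub>0) < d \<Longrightarrow> \<alpha> \<le> \<bar>bracket \<xi>\<bar>"
proof -
  have "\<alpha> < \<bar>bracket x\<^sub>0\<bar>" using bracket_bound[OF x\<^sub>0] by (simp add: lie_bracket_lie2 bracket_def)
  moreover have "isCont bracket x\<^sub>0" using continuous_on_bracket by (simp add: continuous_on_eq_continuous_at)
  ultimately obtain d where d: "0 < d" "\<And>y. norm (y - x\<^sub>0) < d \<Longrightarrow> \<bar>bracket y - bracket x\<^sub>0\<bar> < \<bar>bracket x\<^sub>0\<bar> - \<alpha>"
    unfolding continuous_at_eps_delta dist_norm by (metis diff_gt_0_iff_gt real_norm_def)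
  show thesis
  proof (rule that[OF d(1)])
    fix \<xi> assume "norm (\<xi> - x\<^sub>0) < d"
    from d(2)[OF this] show "\<alpha> \<le> \<bar>bracket \<xi>\<bar>" by linarith
  qed
qed

lemma orientation:
  assumes "\<alpha> \<le> \<bar>bracket \<xi>\<bar>"
  obtains \<sigma> :: real where "\<sigma> = 1 \<or> \<sigma> = - 1" "\<sigma> * bracket \<xi> \<le> - \<alpha>"
  using assms that[of 1] that[of "- 1"] by (cases "0 \<le> bracket \<xi>") auto

text \<open>The form is negative in its lowest eigendirection and, by joint continuity in point and
  angle, on a small sector around it for all nearby points; having period pi, it is nonpositive on
  the opposite sector as well. A petal inside these sectors has a nonpositive second order term, and
  the freedom left in its position is spent on the first order term.\<close>

lemma indefinite_inward_move:
  assumes x\<^sub>0: "x\<^sub>0 \<in> singular_set f h" and ind: "indefinite (S_matrix f h x\<^sub>0)"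
  obtains \<eta> r\<^sub>0 c M where "0 < \<eta>" "0 < r\<^sub>0" "0 < c" "0 < M"
    "\<And>\<xi> r. norm (\<xi> - x\<^sub>0) < \<eta> \<Longrightarrow> h \<xi> \<le> 0 \<Longrightarrow> 0 < r \<Longrightarrow> r < r\<^sub>0 \<Longrightarrow> inward_move r c M \<xi>"
proof -
  obtain \<nu> \<mu> \<phi>0 where p: "\<nu> \<le> \<mu>" "\<nu> * \<mu> = S_matrix f h x\<^sub>0 $ 1 $ 1 * S_matrix f h x\<^sub>0 $ 2 $ 2 - (S_matrix f h x\<^sub>0 $ 1 $ 2)\<^sup>2"
    "\<And>\<phi>. quad x\<^sub>0 \<phi> = \<nu> * (cos (\<phi> - \<phi>0))\<^sup>2 + \<mu> * (sin (\<phi> - \<phi>0))\<^sup>2"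
    using quad_polar by blast
  have "\<nu> * \<mu> < 0" using p(2) ind by (simp add: indefinite_def)
  then have "quad x\<^sub>0 \<phi>0 < 0" using p(1,3) by (auto simp: mult_less_0_iff)
  moreover have "isCont (\<lambda>z. quad (fst z) (snd z)) (x\<^sub>0, \<phi>0)"
  proof -
    have "continuous_on UNIV (\<lambda>z :: (real ^ 'n) \<times> real. quad (fst z) (snd z))"
      unfolding quad_def
      by (intro continuous_intros continuous_on_compose2[OF continuous_lipschitz_on_cballs[OF lie2_lipschitz]]) auto
    then show ?thesis by (simp add: continuous_on_eq_continuous_at)
  qed
  ultimately obtain d where d: "0 < d" "\<And>z. norm (z - (x\<^sub>0, \<phi>0)) < d \<Longrightarrow> \<bar>quad (fst z) (snd z) - quad x\<^sub>0 \<phi>0\<bar> < - quad x\<^sub>0 \<phi>0"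
    unfolding continuous_at_eps_delta dist_norm by (metis fst_conv neg_0_less_iff_less real_norm_def snd_conv)
  have neg: "quad \<xi> (\<phi>0 + \<theta>) \<le> 0" if "norm (\<xi> - x\<^sub>0) < d / 2" "\<bar>\<theta>\<bar> < d / 2" for \<xi> \<theta>
  proof -
    have "norm ((\<xi>, \<phi>0 + \<theta>) - (x\<^sub>0, \<phi>0)) \<le> norm (\<xi> - x\<^sub>0) + norm \<theta>"
      using sqrt_sum_squares_le_sum_abs[of "norm (\<xi> - x\<^sub>0)" \<theta>] by (simp add: norm_Pair)
    then have "norm ((\<xi>, \<phi>0 + \<theta>) - (x\<^sub>0, \<phi>0)) < d" using that by simp
    from d(2)[OF this] show ?thesis by simp
  qed
  \<comment> \<open>The petal sweeps an angle \<open>\<kappa> * pi\<close>, which must stay below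
    the tolerance \<open>d / 2\<close> of \<open>neg\<close>; the bound 1/2 is the one of
    \<open>sector_start_angle\<close>.\<close>
  define \<kappa> where "\<kappa> = min (1 / 2) (d / (4 * pi))"
  have "\<kappa> * pi \<le> d / (4 * pi) * pi" unfolding \<kappa>_def by (intro mult_right_mono) auto
  then have \<kappa>: "0 < \<kappa>" "\<kappa> \<le> 1 / 2" "\<kappa> * pi < d / 2" using d(1) by (auto simp: \<kappa>_def)
  then have \<kappa>1: "\<kappa> \<le> 1" by simp
  obtain d' where d': "0 < d'" "\<And>\<xi>. norm (\<xi> - x\<^sub>0) < d' \<Longrightarrow> \<alpha> \<le> \<bar>bracket \<xi>\<bar>"
    using singular_bracket_nbhd[OF x\<^sub>0] by blast
  define \<eta> where "\<eta> = min (d / 2) d'"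
  obtain r\<^sub>0 c M where pos: "0 < r\<^sub>0" "0 < c" "0 < M" and loop:
    "\<And>\<xi> r \<sigma> \<phi>. norm \<xi> \<le> norm x\<^sub>0 + \<eta> \<Longrightarrow> h \<xi> \<le> 0 \<Longrightarrow> 0 < r \<Longrightarrow> r < r\<^sub>0 \<Longrightarrow> \<sigma> = 1 \<or> \<sigma> = - 1 \<Longrightarrow>
      \<sigma> * bracket \<xi> \<le> - \<alpha> \<Longrightarrow>
      (\<And>t. 0 \<le> t \<Longrightarrow> t \<le> pi \<Longrightarrow>
        r * sin t * (lie1 1 \<xi> * cos (\<phi> + \<sigma> * \<kappa> * t) + lie1 2 \<xi> * sin (\<phi> + \<sigma> * \<kappa> * t))
        + r\<^sup>2 * (sin t)\<^sup>2 * quad \<xi> (\<phi> + \<sigma> * \<kappa> * t) / 2 \<le> \<alpha> * \<kappa> / 640 * r\<^sup>2 * t ^ 3) \<Longrightarrow>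
      inward_move r c M \<xi>"
    using loop_inward_move[OF \<alpha>_pos \<kappa>(1) \<kappa>1, where R = "norm x\<^sub>0 + \<eta>"] by metis
  show thesis
  proof (rule that[OF _ pos])
    show "0 < \<eta>" using d d' by (simp add: \<eta>_def)
    fix \<xi> :: "real ^ 'n" and r :: real
    assume \<xi>: "norm (\<xi> - x\<^sub>0) < \<eta>" "h \<xi> \<le> 0" and r: "0 < r" "r < r\<^sub>0"
    have \<xi>R: "norm \<xi> \<le> norm x\<^sub>0 + \<eta>" using \<xi>(1) norm_triangle_sub[of \<xi> x\<^sub>0] by linarith
    obtain \<sigma> where \<sigma>: "\<sigma> = 1 \<or> \<sigma> = - 1" "\<sigma> * bracket \<xi> \<le> - \<alpha>"
      using orientation d'(2) \<xi>(1) unfolding \<eta>_def by (metis min_less_iff_conj)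
    obtain \<phi> where \<phi>: "\<And>t. 0 \<le> t \<Longrightarrow> t \<le> pi \<Longrightarrow> lie1 1 \<xi> * cos (\<phi> + \<sigma> * \<kappa> * t) + lie1 2 \<xi> * sin (\<phi> + \<sigma> * \<kappa> * t) \<le> 0"
      "\<And>t. 0 \<le> t \<Longrightarrow> t \<le> pi \<Longrightarrow> \<exists>\<theta>. \<bar>\<theta>\<bar> \<le> \<kappa> * pi \<and>
        (\<phi> + \<sigma> * \<kappa> * t = \<phi>0 + \<theta> \<or> \<phi> + \<sigma> * \<kappa> * t = \<phi>0 + pi + \<theta>)"
      using sector_start_angle[OF \<kappa>(1,2) \<sigma>(1)] by metis
    show "inward_move r c M \<xi>"
    proof (rule loop[OF \<xi>R \<xi>(2) r \<sigma>])
      fix t :: real assume t: "0 \<le> t" "t \<le> pi"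
      have "0 \<le> sin t" using t by (rule sin_ge_zero)
      then have "r * sin t * (lie1 1 \<xi> * cos (\<phi> + \<sigma> * \<kappa> * t) + lie1 2 \<xi> * sin (\<phi> + \<sigma> * \<kappa> * t)) \<le> 0"
        using \<phi>(1)[OF t] r by (intro mult_nonneg_nonpos) auto
      moreover have "quad \<xi> (\<phi> + \<sigma> * \<kappa> * t) \<le> 0"
      proof -
        obtain \<theta> where \<theta>: "\<bar>\<theta>\<bar> \<le> \<kappa> * pi" "\<phi> + \<sigma> * \<kappa> * t = \<phi>0 + \<theta> \<or> \<phi> + \<sigma> * \<kappa> * t = (\<phi>0 + \<theta>) + pi"
          using \<phi>(2)[OF t] by (metis add.assoc add.commute)
        have "quad \<xi> (\<phi>0 + \<theta> + pi) = quad \<xi> (\<phi>0 + \<theta>)" by (simp add: quad_def)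
        then have "quad \<xi> (\<phi> + \<sigma> * \<kappa> * t) = quad \<xi> (\<phi>0 + \<theta>)" using \<theta>(2) by auto
        also have "\<dots> \<le> 0" using neg[of \<xi> \<theta>] \<theta>(1) \<kappa>(3) \<xi>(1) by (simp add: \<eta>_def)
        finally show ?thesis .
      qed
      then have "r\<^sup>2 * (sin t)\<^sup>2 * quad \<xi> (\<phi> + \<sigma> * \<kappa> * t) \<le> 0" by (intro mult_nonneg_nonpos) auto
      moreover have "0 \<le> \<alpha> * \<kappa> / 640 * r\<^sup>2 * t ^ 3" using \<alpha>_pos \<kappa> t by simp
      ultimately show "r * sin t * (lie1 1 \<xi> * cos (\<phi> + \<sigma> * \<kappa> * t) + lie1 2 \<xi> * sin (\<phi> + \<sigma> * \<kappa> * t))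
        + r\<^sup>2 * (sin t)\<^sup>2 * quad \<xi> (\<phi> + \<sigma> * \<kappa> * t) / 2 \<le> \<alpha> * \<kappa> / 640 * r\<^sup>2 * t ^ 3" by linarith
    qed
  qed
qed

text \<open>At points near \<open>x\<^sub>0\<close> the form may be slightly positive in every
  direction. Its positive part is split at the singular point x nearest to \<xi>: there one
  eigenvalue is nonpositive and the other at most tiny, while the change of the form from x to \<xi>
  is bounded by a multiple of their distance, hence, by the distance hypothesis, of the modulus of
  the first order term. Such errors are what \<open>degenerate_start_angle\<close>
  tolerates.\<close>

lemma degenerate_inward_move:
  assumes x\<^sub>0: "x\<^sub>0 \<in> singular_set f h" and nsd: "negative_semidefinite (S_matrix f h x\<^sub>0)"
  obtains \<eta> r\<^sub>0 c M where "0 < \<eta>" "0 < r\<^sub>0" "0 < c" "0 < M"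
    "\<And>\<xi> r. norm (\<xi> - x\<^sub>0) < \<eta> \<Longrightarrow> h \<xi> \<le> 0 \<Longrightarrow> 0 < r \<Longrightarrow> r < r\<^sub>0 \<Longrightarrow> inward_move r c M \<xi>"
proof -
  define \<gamma> where "\<gamma> = \<alpha> / 640"
  have \<gamma>: "0 < \<gamma>" using \<alpha>_pos by (simp add: \<gamma>_def)
  have "\<exists>K. 0 < K \<and> (\<forall>p q. norm p \<le> norm x\<^sub>0 + 2 \<longrightarrow> norm q \<le> norm x\<^sub>0 + 2 \<longrightarrow>
      norm (lie2 l m p - lie2 l m q) \<le> K * norm (p - q))" for l m
    using lipschitz_on_cballsE[OF lie2_lipschitz, of "norm x\<^sub>0 + 2" l m] by metis
  then obtain N' where N': "\<And>l m. 0 < N' l m" "\<And>l m p q. norm p \<le> norm x\<^sub>0 + 2 \<Longrightarrow> norm q \<le> norm x\<^sub>0 + 2 \<Longrightarrow>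
      norm (lie2 l m p - lie2 l m q) \<le> N' l m * norm (p - q)" by metis
  define N where "N = N' 1 1 + N' 1 2 + N' 2 1 + N' 2 2"
  have "N' l m \<le> N" for l m
    using N'(1)[of 1 1] N'(1)[of 1 2] N'(1)[of 2 1] N'(1)[of 2 2] exhaust_2[of l] exhaust_2[of m]
    unfolding N_def by auto
  then have N: "\<bar>lie2 l m p - lie2 l m q\<bar> \<le> N * norm (p - q)" if "norm p \<le> norm x\<^sub>0 + 2" "norm q \<le> norm x\<^sub>0 + 2" for l m p q
    using N'(2)[OF that] by (smt (verit) mult_right_mono norm_ge_zero real_norm_def)
  have Npos: "0 < N" unfolding N_def using N'(1) by (simp add: add_pos_pos)
  obtain d' where d': "0 < d'" "\<And>\<xi>. norm (\<xi> - x\<^sub>0) < d' \<Longrightarrow> \<alpha> \<le> \<bar>bracket \<xi>\<bar>"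
    using singular_bracket_nbhd[OF x\<^sub>0] by blast
  \<comment> \<open>\<open>d'\<close> serves the bracket, \<delta> the distance hypothesis, and 1
    keeps all points in the ball of radius \<open>norm x\<^sub>0 + 2\<close>. As x lies within
    \<open>2 * \<eta>\<close> of \<open>x\<^sub>0\<close>, the last bound makes
    \<open>4 * (N * (2 * \<eta>))\<close> at most \<open>\<gamma> / 32\<close>.\<close>
  define \<eta> where "\<eta> = min (min 1 d') (min \<delta> (\<gamma> / (256 * N)))"
  have \<eta>: "0 < \<eta>" using d' \<delta>_pos \<gamma> Npos by (simp add: \<eta>_def)
  obtain r\<^sub>1 c M where pos: "0 < r\<^sub>1" "0 < c" "0 < M" and loop:
    "\<And>\<xi> r \<sigma> \<phi>. norm \<xi> \<le> norm x\<^sub>0 + \<eta> \<Longrightarrow> h \<xi> \<le> 0 \<Longrightarrow> 0 < r \<Longrightarrow> r < r\<^sub>1 \<Longrightarrow> \<sigma> = 1 \<or> \<sigma> = - 1 \<Longrightarrow>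
      \<sigma> * bracket \<xi> \<le> - \<alpha> \<Longrightarrow>
      (\<And>t. 0 \<le> t \<Longrightarrow> t \<le> pi \<Longrightarrow>
        r * sin t * (lie1 1 \<xi> * cos (\<phi> + \<sigma> * 1 * t) + lie1 2 \<xi> * sin (\<phi> + \<sigma> * 1 * t))
        + r\<^sup>2 * (sin t)\<^sup>2 * quad \<xi> (\<phi> + \<sigma> * 1 * t) / 2 \<le> \<alpha> * 1 / 640 * r\<^sup>2 * t ^ 3) \<Longrightarrow>
      inward_move r c M \<xi>"
    using loop_inward_move[OF \<alpha>_pos zero_less_one order_refl, where R = "norm x\<^sub>0 + \<eta>"] by metis
  define r\<^sub>0 where "r\<^sub>0 = min r\<^sub>1 (d\<^sub>0 / (4 * N))"
  show thesis
  proof (rule that[OF \<eta> _ pos(2,3)])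
    show "0 < r\<^sub>0" using pos d\<^sub>0_pos Npos by (simp add: r\<^sub>0_def)
    fix \<xi> :: "real ^ 'n" and r :: real
    assume \<xi>: "norm (\<xi> - x\<^sub>0) < \<eta>" "h \<xi> \<le> 0" and r: "0 < r" "r < r\<^sub>0"
    have \<xi>R: "norm \<xi> \<le> norm x\<^sub>0 + \<eta>" using \<xi>(1) norm_triangle_sub[of \<xi> x\<^sub>0] by linarith
    obtain \<sigma> where \<sigma>: "\<sigma> = 1 \<or> \<sigma> = - 1" "\<sigma> * bracket \<xi> \<le> - \<alpha>"
      using orientation d'(2) \<xi>(1) unfolding \<eta>_def by (metis min_less_iff_conj)
    obtain x where x: "x \<in> singular_set f h" "infdist \<xi> (singular_set f h) = norm (\<xi> - x)"
      using infdist_attains_inf[OF closed_singular, of \<xi>] x\<^sub>0 unfolding dist_norm by blast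
    have "norm (\<xi> - x) \<le> norm (\<xi> - x\<^sub>0)"
      using infdist_le[OF x\<^sub>0, of \<xi>] x(2) by (simp add: dist_norm)
    then have xx\<^sub>0: "norm (x - x\<^sub>0) \<le> 2 * \<eta>"
      using norm_triangle_ineq4[of "\<xi> - x\<^sub>0" "\<xi> - x"] \<xi>(1) by simp
    have \<eta>1: "\<eta> \<le> 1" by (simp add: \<eta>_def)
    have xR: "norm x \<le> norm x\<^sub>0 + 2" using xx\<^sub>0 \<eta>1 norm_triangle_sub[of x x\<^sub>0] by linarith
    have \<xi>R2: "norm \<xi> \<le> norm x\<^sub>0 + 2" using \<xi>R \<eta>1 by linarith
    define z where "z = Complex (lie1 1 \<xi>) (lie1 2 \<xi>)"
    have z: "lie1 1 \<xi> = cmod z * cos (Arg z)" "lie1 2 \<xi> = cmod z * sin (Arg z)"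
      using rcis_cmod_Arg[of z] unfolding z_def by (auto simp: complex_eq_iff)
    have "\<xi> \<in> {y + b | y b. y \<in> singular_set f h \<and> b \<in> cball 0 \<delta>}"
    proof -
      have "\<xi> = x\<^sub>0 + (\<xi> - x\<^sub>0)" "\<xi> - x\<^sub>0 \<in> cball 0 \<delta>" using \<xi>(1) by (auto simp: \<eta>_def)
      then show ?thesis using x\<^sub>0 by blast
    qed
    from distance[OF this] have "d\<^sub>0 * norm (\<xi> - x) \<le> cmod z"
      by (simp add: x(2) z_def lie1_def cmod_def)
    then have dx: "norm (\<xi> - x) \<le> cmod z / d\<^sub>0" using d\<^sub>0_pos by (simp add: field_simps)
    obtain \<nu> \<mu> \<phi>0 where p: "\<nu> \<le> \<mu>" "\<nu> * \<mu> = S_matrix f h x $ 1 $ 1 * S_matrix f h x $ 2 $ 2 - (S_matrix f h x $ 1 $ 2)\<^sup>2"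
      "\<And>\<phi>. quad x \<phi> = \<nu> * (cos (\<phi> - \<phi>0))\<^sup>2 + \<mu> * (sin (\<phi> - \<phi>0))\<^sup>2"
      using quad_polar by blast
    have "\<nu> \<le> 0" by (rule eigenvalue_nonpos[OF x(1) p])
    have "\<mu> = quad x (\<phi>0 + pi / 2)" using p(3)[of "\<phi>0 + pi / 2"] by simp
    also have "\<dots> \<le> quad x\<^sub>0 (\<phi>0 + pi / 2) + 4 * (N * norm (x - x\<^sub>0))"
      using abs_quad_diff_le[OF N[OF xR], of x\<^sub>0 "\<phi>0 + pi / 2"] by simp
    also have "\<dots> \<le> 0 + 4 * (N * (2 * \<eta>))"
      using quad_nonpos[OF nsd] xx\<^sub>0 Npos by (intro add_mono mult_left_mono) auto
    also have "\<dots> \<le> \<gamma> / 32"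
    proof -
      have "\<eta> \<le> \<gamma> / (256 * N)" by (simp add: \<eta>_def)
      then show ?thesis using Npos by (simp add: field_simps)
    qed
    finally have \<mu>: "\<mu> \<le> \<gamma> / 32" .
    have quad: "quad \<xi> \<phi> \<le> \<gamma> / 32 * (sin (\<phi> - \<phi>0))\<^sup>2 + 4 * N / d\<^sub>0 * cmod z" for \<phi>
    proof -
      have "quad \<xi> \<phi> \<le> quad x \<phi> + 4 * (N * norm (\<xi> - x))"
        using abs_quad_diff_le[OF N[OF \<xi>R2 xR], of \<phi>] by simp
      moreover have "4 * (N * norm (\<xi> - x)) \<le> 4 * (N * (cmod z / d\<^sub>0))"
        using dx Npos by (intro mult_left_mono) auto
      moreover have "quad x \<phi> \<le> \<gamma> / 32 * (sin (\<phi> - \<phi>0))\<^sup>2"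
        unfolding p(3) using mult_right_mono[OF \<open>\<nu> \<le> 0\<close>, of "(cos (\<phi> - \<phi>0))\<^sup>2"]
          mult_right_mono[OF \<mu>, of "(sin (\<phi> - \<phi>0))\<^sup>2"] by simp
      ultimately show ?thesis by simp
    qed
    \<comment> \<open>Factoring out \<open>r\<^sup>2 * sin t\<close> turns the modulus of the first
      order term into g and the error of the form into \<open>g * e\<close>; the bound
      \<open>d\<^sub>0 / (4 * N)\<close> on r is what makes \<open>e \<le> 1\<close>.\<close>
    define g where "g = cmod z / r"
    define e where "e = 4 * N / d\<^sub>0 * r"
    have "r < d\<^sub>0 / (4 * N)" using r by (simp add: r\<^sub>0_def)
    then have e: "0 \<le> e" "e \<le> 1" using d\<^sub>0_pos Npos r by (auto simp: e_def field_simps)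
    have g: "0 \<le> g" using r by (simp add: g_def)
    obtain \<phi> where \<phi>: "\<And>t. 0 \<le> t \<Longrightarrow> t \<le> pi \<Longrightarrow>
      g * cos (\<phi> + \<sigma> * t - Arg z) + sin t * (\<gamma> / 32 * (sin (\<phi> + \<sigma> * t - \<phi>0))\<^sup>2 + g * e) / 2 \<le> \<gamma> * t\<^sup>2"
      using degenerate_start_angle[OF \<gamma> g e \<sigma>(1)] by metis
    show "inward_move r c M \<xi>"
    proof (rule loop[OF \<xi>R \<xi>(2) r(1) _ \<sigma>])
      show "r < r\<^sub>1" using r by (simp add: r\<^sub>0_def)
      fix t :: real assume t: "0 \<le> t" "t \<le> pi"
      define \<theta> where "\<theta> = \<phi> + \<sigma> * t"
      have s: "0 \<le> sin t" "sin t \<le> t" using t sin_ge_zero sin_x_le_x by auto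
      have gr: "g * r = cmod z" using r by (simp add: g_def)
      have ger: "g * e * r\<^sup>2 = r\<^sup>2 * (4 * N / d\<^sub>0 * cmod z)"
        using r by (simp add: g_def e_def power2_eq_square)
      have "lie1 1 \<xi> * cos \<theta> + lie1 2 \<xi> * sin \<theta> = cmod z * cos (\<theta> - Arg z)"
        by (simp add: z cos_diff algebra_simps)
      then have "r * sin t * (lie1 1 \<xi> * cos \<theta> + lie1 2 \<xi> * sin \<theta>) + r\<^sup>2 * (sin t)\<^sup>2 * quad \<xi> \<theta> / 2
          = r * sin t * (cmod z * cos (\<theta> - Arg z)) + r\<^sup>2 * (sin t)\<^sup>2 * quad \<xi> \<theta> / 2" by simp
      also have "\<dots> \<le> r * sin t * (cmod z * cos (\<theta> - Arg z))
          + r\<^sup>2 * (sin t)\<^sup>2 * (\<gamma> / 32 * (sin (\<theta> - \<phi>0))\<^sup>2 + 4 * N / d\<^sub>0 * cmod z) / 2"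
        by (intro add_left_mono divide_right_mono mult_left_mono quad) auto
      also have "\<dots> = r\<^sup>2 * sin t * (g * cos (\<theta> - Arg z) + sin t * (\<gamma> / 32 * (sin (\<theta> - \<phi>0))\<^sup>2 + g * e) / 2)"
      proof -
        have eq: "r * S * (G * r * C) + r\<^sup>2 * S\<^sup>2 * (Q + X) / 2 = r\<^sup>2 * S * (G * C + S * (Q + Y) / 2)"
          if "Y * r\<^sup>2 = r\<^sup>2 * X" for S G C Q X Y :: real
        proof -
          have "r\<^sup>2 * S * (G * C + S * (Q + Y) / 2) = r * S * (G * r * C) + S\<^sup>2 * (r\<^sup>2 * Q + Y * r\<^sup>2) / 2"
            by (simp add: power2_eq_square algebra_simps)
          then show ?thesis unfolding that by (simp add: algebra_simps)
        qed
        show ?thesis unfolding gr[symmetric]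
          by (rule eq) (use ger in \<open>simp add: gr\<close>)
      qed
      also have "\<dots> \<le> r\<^sup>2 * sin t * (\<gamma> * t\<^sup>2)"
        unfolding \<theta>_def by (rule mult_left_mono[OF \<phi>[OF t]]) (use s in simp)
      also have "\<dots> \<le> r\<^sup>2 * t * (\<gamma> * t\<^sup>2)"
        using s \<gamma> by (intro mult_right_mono mult_left_mono) auto
      also have "\<dots> = \<alpha> * 1 / 640 * r\<^sup>2 * t ^ 3" by (simp add: \<gamma>_def power2_eq_square power3_eq_cube)
      finally show "r * sin t * (lie1 1 \<xi> * cos (\<phi> + \<sigma> * 1 * t) + lie1 2 \<xi> * sin (\<phi> + \<sigma> * 1 * t))
        + r\<^sup>2 * (sin t)\<^sup>2 * quad \<xi> (\<phi> + \<sigma> * 1 * t) / 2 \<le> \<alpha> * 1 / 640 * r\<^sup>2 * t ^ 3"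
        by (simp add: \<theta>_def)
    qed
  qed
qed

lemma local_inward_move:
  assumes "h x\<^sub>0 \<le> 0"
  obtains \<eta> r\<^sub>0 c M where "0 < \<eta>" "0 < r\<^sub>0" "0 < c" "0 < M"
    "\<And>\<xi> r. norm (\<xi> - x\<^sub>0) < \<eta> \<Longrightarrow> h \<xi> \<le> 0 \<Longrightarrow> 0 < r \<Longrightarrow> r < r\<^sub>0 \<Longrightarrow> inward_move r c M \<xi>"
proof (cases "x\<^sub>0 \<in> singular_set f h")
  case True
  from S_form[OF this] show ?thesis
    using indefinite_inward_move[OF True] degenerate_inward_move[OF True] that by metis
next
  case False
  then have "lie1 1 x\<^sub>0 \<noteq> 0 \<or> lie1 2 x\<^sub>0 \<noteq> 0" using assms singular_iff by auto
  from nonsingular_inward_move[OF this] show ?thesis using that by metis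
qed

end

section \<open>The value function\<close>

text \<open>The difference at a pair is controlled by the difference at another pair, which is close
  if the first one is close enough. So the admissible distances are chosen backwards from the last
  of n steps, with half of the error reserved at each; then the trivial bound \<open>2 * B\<close>
  enters with the factor \<open>\<theta> ^ n\<close>. One-sided estimates suffice since the two
  points can be exchanged.\<close>

lemma uniformly_continuous_by_contraction:
  fixes V :: "'a::metric_space \<Rightarrow> real"
  assumes B: "\<And>x. x \<in> C \<Longrightarrow> \<bar>V x\<bar> \<le> B" and \<theta>: "0 \<le> \<theta>" "\<theta> < 1"
    and step: "\<And>e. 0 < e \<Longrightarrow> \<exists>d>0. \<forall>x\<in>C. \<forall>y\<in>C. dist x y < d \<longrightarrow>
      (\<exists>p\<in>C. \<exists>q\<in>C. dist q p < e \<and> V y - V x \<le> e + \<theta> * (V p - V q))"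
  shows "uniformly_continuous_on C V"
proof -
  have iter: "\<exists>d>0. \<forall>x\<in>C. \<forall>y\<in>C. dist x y < d \<longrightarrow> V y - V x \<le> e + \<theta> ^ n * (2 * B)" if "0 < e" for e n
    using that
  proof (induction n arbitrary: e)
    case 0
    have "V y - V x \<le> e + \<theta> ^ 0 * (2 * B)" if "x \<in> C" "y \<in> C" for x y
      using B[OF that(1)] B[OF that(2)] 0 by simp
    then show ?case by (intro exI[of _ 1]) auto
  next
    case (Suc n)
    obtain d where d: "0 < d" "\<And>x y. x \<in> C \<Longrightarrow> y \<in> C \<Longrightarrow> dist x y < d \<Longrightarrow> V y - V x \<le> e / 2 + \<theta> ^ n * (2 * B)"
      using Suc.IH[of "e / 2"] Suc.prems by auto
    \<comment> \<open>The minimum is used twice: below d the induction hypothesis applies to the new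
      pair, and \<open>e / 2\<close> leaves room for the error which that hypothesis
      contributes.\<close>
    obtain d' where d': "0 < d'" "\<And>x y. x \<in> C \<Longrightarrow> y \<in> C \<Longrightarrow> dist x y < d' \<Longrightarrow>
      \<exists>p\<in>C. \<exists>q\<in>C. dist q p < min d (e / 2) \<and> V y - V x \<le> min d (e / 2) + \<theta> * (V p - V q)"
      using step[of "min d (e / 2)"] d(1) Suc.prems by auto
    have "V y - V x \<le> e + \<theta> ^ Suc n * (2 * B)" if xy: "x \<in> C" "y \<in> C" "dist x y < d'" for x y
    proof -
      obtain p q where pq: "p \<in> C" "q \<in> C" "dist q p < min d (e / 2)"
        "V y - V x \<le> min d (e / 2) + \<theta> * (V p - V q)" using d'(2)[OF xy] by blast
      have "V p - V q \<le> e / 2 + \<theta> ^ n * (2 * B)" using pq by (intro d(2)) auto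
      then have "\<theta> * (V p - V q) \<le> \<theta> * (e / 2 + \<theta> ^ n * (2 * B))" using \<theta>(1) by (rule mult_left_mono)
      moreover have "\<theta> * (e / 2) \<le> e / 2" using \<theta> Suc.prems by (simp add: mult_left_le_one_le)
      ultimately show ?thesis using pq(4) by (simp add: algebra_simps)
    qed
    then show ?case using d'(1) by blast
  qed
  show ?thesis
    unfolding uniformly_continuous_on_def
  proof (intro allI impI)
    fix e :: real assume e: "0 < e"
    have "(\<lambda>n. \<theta> ^ n * (2 * B)) \<longlonglongrightarrow> 0 * (2 * B)"
      using \<theta> by (intro tendsto_mult_right LIMSEQ_realpow_zero) auto
    then have "\<forall>\<^sub>F n in sequentially. \<theta> ^ n * (2 * B) < e / 2"
      using e by (intro order_tendstoD(2)[of _ "0 * (2 * B)"]) auto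
    then obtain n where n: "\<theta> ^ n * (2 * B) < e / 2" by (auto simp: eventually_sequentially)
    obtain d where d: "0 < d" "\<And>x y. x \<in> C \<Longrightarrow> y \<in> C \<Longrightarrow> dist x y < d \<Longrightarrow> V y - V x \<le> e / 2 + \<theta> ^ n * (2 * B)"
      using iter[of "e / 2" n] e by auto
    have "dist (V y) (V x) < e" if xy: "x \<in> C" "y \<in> C" "dist y x < d" for x y
      using d(2)[of x y] d(2)[of y x] xy n by (auto simp: dist_real_def dist_commute)
    then show "\<exists>d>0. \<forall>x\<in>C. \<forall>x'\<in>C. dist x' x < d \<longrightarrow> dist (V x') (V x) < e"
      using d(1) by blast
  qed
qed

section \<open>Cost functional and dynamic programming\<close>

locale discounted_problem = control_system f k k\<^sub>0
  for f :: "2 \<Rightarrow> real ^ 'n \<Rightarrow> real ^ 'n" and k k\<^sub>0 :: real +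
  fixes h :: "real ^ 'n \<Rightarrow> real" and L :: "real ^ 'n \<Rightarrow> real ^ 2 \<Rightarrow> real" and B k\<^sub>L :: real
  assumes L_bnd: "\<And>x w. w \<in> control_values \<Longrightarrow> \<bar>L x w\<bar> \<le> B"
    and L_cont: "continuous_on (UNIV \<times> control_values) (\<lambda>(x, w). L x w)"
    and L_lip: "\<And>w. w \<in> control_values \<Longrightarrow> k\<^sub>L-lipschitz_on UNIV (\<lambda>x. L x w)"
begin

definition running :: "(real \<Rightarrow> real ^ 2) \<Rightarrow> real ^ 'n \<Rightarrow> real \<Rightarrow> real"
  where "running u \<xi> t = exp (- t) * L (trajectory f u \<xi> t) (u t)"

definition cost :: "(real \<Rightarrow> real ^ 2) \<Rightarrow> real ^ 'n \<Rightarrow> real"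
  where "cost u \<xi> = (LINT t:{0..}|lebesgue. running u \<xi> t)"

abbreviation V :: "real ^ 'n \<Rightarrow> real" where "V \<equiv> value_function f h L"

lemma V_cost: "V \<xi> = (INF u\<in>admissible_controls f h \<xi>. cost u \<xi>)"
  by (simp add: value_function_def cost_def running_def)

lemma zero_control: "(\<lambda>_. 0) \<in> controls"
  by (simp add: controls_def control_values_def)

lemma B_nonneg: "0 \<le> B"
  using L_bnd[OF controls_value[OF zero_control order_refl], of 0] by linarith

lemma k\<^sub>L_nonneg: "0 \<le> k\<^sub>L"
  using lipschitz_on_nonneg[OF L_lip[OF controls_value[OF zero_control order_refl]]] .

lemma running_measurable:
  assumes u: "u \<in> controls"
  shows "running u \<xi> \<in> borel_measurable (lebesgue_on {0..})"
proof -
  have x: "trajectory f u \<xi> \<in> borel_measurable (lebesgue_on {0..})"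
    by (rule continuous_imp_measurable_on_sets_lebesgue[OF trajectory_continuous[OF u]]) auto
  have "(\<lambda>t. (trajectory f u \<xi> t, u t)) \<in> borel_measurable (lebesgue_on {0..})"
    by (rule borel_measurable_Pair[OF x controls_measurable[OF u]])
  \<comment> \<open>L is continuous over the control values only, so the pair is regarded as a map
    into that subspace.\<close>
  then have "(\<lambda>t. (trajectory f u \<xi> t, u t)) \<in> lebesgue_on {0..} \<rightarrow>\<^sub>M restrict_space borel (UNIV \<times> control_values)"
    using controls_value[OF u] by (intro measurable_restrict_space2) auto
  from measurable_compose[OF this borel_measurable_continuous_on_restrict[OF L_cont]]
  have "(\<lambda>t. L (trajectory f u \<xi> t) (u t)) \<in> borel_measurable (lebesgue_on {0..})" by simp
  moreover have "(\<lambda>t::real. exp (- t)) \<in> borel_measurable (lebesgue_on {0..})"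
    by (rule continuous_imp_measurable_on_sets_lebesgue) (auto intro!: continuous_intros)
  ultimately show ?thesis unfolding running_def[abs_def] by (rule borel_measurable_times[rotated])
qed

lemma abs_running_le:
  assumes "u \<in> controls" "0 \<le> t" shows "\<bar>running u \<xi> t\<bar> \<le> B * exp (- t)"
  using mult_left_mono[OF L_bnd[OF controls_value[OF assms]], of "exp (- t)"]
  by (simp add: running_def abs_mult mult.commute)

lemma exp_has_integral: "((\<lambda>t. B * exp (- t)) has_integral B * exp (- c)) {c..}"
  using has_integral_mult_right[OF has_integral_exp_minus_to_infinity[of 1 c], of B] by simp

lemma running_absolutely_integrable:
  assumes u: "u \<in> controls" and S: "S \<in> sets lebesgue" "S \<subseteq> {0..}"
  shows "running u \<xi> absolutely_integrable_on S"
proof -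
  have "running u \<xi> absolutely_integrable_on {0..}"
    by (rule measurable_bounded_by_integrable_imp_absolutely_integrable[OF running_measurable[OF u] _
          has_integral_integrable[OF exp_has_integral]]) (use abs_running_le[OF u] in auto)
  then show ?thesis using set_integrable_subset S by blast
qed

lemma running_integrable: "u \<in> controls \<Longrightarrow> 0 \<le> a \<Longrightarrow> running u \<xi> integrable_on {a..b}"
  and running_integrable_inf: "u \<in> controls \<Longrightarrow> 0 \<le> a \<Longrightarrow> running u \<xi> integrable_on {a..}"
  by (rule set_lebesgue_integral_eq_integral(1)[OF running_absolutely_integrable]; auto)+

lemma cost_integral: "u \<in> controls \<Longrightarrow> cost u \<xi> = integral {0..} (running u \<xi>)"
  unfolding cost_def by (rule set_lebesgue_integral_eq_integral(2)[OF running_absolutely_integrable]) auto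

lemma abs_cost_le:
  assumes u: "u \<in> controls" shows "\<bar>cost u \<xi>\<bar> \<le> B"
proof -
  have "norm (integral {0..} (running u \<xi>)) \<le> integral {0..} (\<lambda>t. B * exp (- t))"
    by (rule Henstock_Kurzweil_Integration.integral_norm_bound_integral[OF running_integrable_inf[OF u order_refl]
          has_integral_integrable[OF exp_has_integral]]) (use abs_running_le[OF u] in auto)
  then show ?thesis
    unfolding integral_unique[OF exp_has_integral[of 0]] cost_integral[OF u] by simp
qed

lemma cost_split:
  assumes u: "u \<in> controls" and T: "0 \<le> T"
  shows "cost u \<xi> = integral {0..T} (running u \<xi>)
    + exp (- T) * cost (shift_control T u) (trajectory f u \<xi> T)"
proof -
  have sc: "shift_control T u \<in> controls" by (rule shift_control_in_controls[OF u T])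
  have un: "{0..} = {0..T} \<union> {T..}" "{0..T} \<inter> {T..} = {T}" using T by auto
  have "cost u \<xi> = integral {0..T} (running u \<xi>) + integral {T..} (running u \<xi>)"
    unfolding cost_integral[OF u] un(1)
    by (rule Henstock_Kurzweil_Integration.integral_Un)
      (use running_integrable[OF u order_refl] running_integrable_inf[OF u T] un(2) in auto)
  also have "integral {T..} (running u \<xi>) = integral {0..} (\<lambda>s. running u \<xi> (T + s))"
  proof -
    have im: "(\<lambda>s. T + s) ` {0..} = {T..}" by simp
    have "(\<lambda>x. \<bar>1\<bar> * running u \<xi> (T + x)) absolutely_integrable_on {0..} \<and>
        integral {0..} (\<lambda>x. \<bar>1\<bar> * running u \<xi> (T + x)) = integral {T..} (running u \<xi>)"
      unfolding im[symmetric]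
      by (subst has_absolute_integral_change_of_variables_1'[where S = "{0..}" and g = "\<lambda>s. T + s" and g' = "\<lambda>_. 1"])
        (use running_absolutely_integrable[OF u] T in \<open>auto intro!: derivative_eq_intros simp: im inj_on_def\<close>)
    then show ?thesis by simp
  qed
  also have "\<dots> = integral {0..} (\<lambda>s. exp (- T) * running (shift_control T u) (trajectory f u \<xi> T) s)"
    by (rule Henstock_Kurzweil_Integration.integral_cong)
      (simp add: running_def trajectory_shift[OF u T] shift_control_def exp_add[symmetric])
  also have "\<dots> = exp (- T) * cost (shift_control T u) (trajectory f u \<xi> T)"
    by (simp add: cost_integral[OF sc])
  finally show ?thesis .
qed

lemma admissible_iff: "u \<in> admissible_controls f h \<xi> \<longleftrightarrow> u \<in> controls \<and> (\<forall>t\<ge>0. h (trajectory f u \<xi> t) \<le> 0)"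
  by (simp add: admissible_controls_def constraint_set_def)

lemma admissible_nonempty:
  assumes "h \<xi> \<le> 0" shows "admissible_controls f h \<xi> \<noteq> {}"
proof -
  have "is_solution f (\<lambda>_. 0) \<xi> (\<lambda>_. \<xi>)"
    by (rule is_solutionI[OF zero_control]) (auto simp: velocity_def intro!: continuous_intros)
  then have "trajectory f (\<lambda>_. 0) \<xi> t = \<xi>" if "0 \<le> t" for t
    using trajectory_unique[OF zero_control zero_control _ _ that order_refl] by blast
  then have "(\<lambda>_. 0) \<in> admissible_controls f h \<xi>"
    using assms zero_control by (simp add: admissible_iff)
  then show ?thesis by blast
qed

lemma bdd_below_cost: "bdd_below ((\<lambda>u. cost u \<xi>) ` admissible_controls f h \<xi>)"
proof (rule bdd_belowI2[of _ "- B"])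
  fix u assume "u \<in> admissible_controls f h \<xi>"
  then show "- B \<le> cost u \<xi>" using abs_cost_le[of u \<xi>] by (simp add: admissible_iff abs_le_iff)
qed

lemma V_le: "u \<in> admissible_controls f h \<xi> \<Longrightarrow> V \<xi> \<le> cost u \<xi>"
  unfolding V_cost by (rule cINF_lower[OF bdd_below_cost])

lemma V_approx:
  assumes "h \<xi> \<le> 0" "0 < e"
  obtains u where "u \<in> admissible_controls f h \<xi>" "cost u \<xi> < V \<xi> + e"
  using cInf_lessD[of "(\<lambda>u. cost u \<xi>) ` admissible_controls f h \<xi>" "V \<xi> + e"] admissible_nonempty[OF assms(1)] assms(2)
  unfolding V_cost by auto

lemma abs_V_le:
  assumes "h \<xi> \<le> 0" shows "\<bar>V \<xi>\<bar> \<le> B"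
proof -
  obtain u where u: "u \<in> admissible_controls f h \<xi>" using admissible_nonempty[OF assms] by blast
  then have "V \<xi> \<le> B" using V_le[OF u] abs_cost_le[of u \<xi>] by (simp add: admissible_iff)
  moreover have "- B \<le> V \<xi>"
    unfolding V_cost using admissible_nonempty[OF assms]
  proof (rule cINF_greatest)
    fix v assume "v \<in> admissible_controls f h \<xi>"
    then show "- B \<le> cost v \<xi>" using abs_cost_le[of v \<xi>] by (simp add: admissible_iff)
  qed
  ultimately show ?thesis by simp
qed

text \<open>A nearly optimal control from the point reached at time T is appended to u. The opposite
  inequality enters \<open>V_compare\<close> directly through \<open>cost_split\<close>.\<close>

lemma dynamic_programming_le:
  assumes u: "u \<in> controls" and T: "0 \<le> T" and adm: "\<And>t. 0 \<le> t \<Longrightarrow> t \<le> T \<Longrightarrow> h (trajectory f u \<xi> t) \<le> 0"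
  shows "V \<xi> \<le> integral {0..T} (running u \<xi>) + exp (- T) * V (trajectory f u \<xi> T)"
proof (rule field_le_epsilon)
  fix e :: real assume e: "0 < e"
  define p where "p = trajectory f u \<xi> T"
  have "h p \<le> 0" using adm T by (simp add: p_def)
  then obtain v where v: "v \<in> admissible_controls f h p" "cost v p < V p + e"
    using V_approx e by blast
  have vc: "v \<in> controls" and vh: "\<And>t. 0 \<le> t \<Longrightarrow> h (trajectory f v p t) \<le> 0"
    using v(1) by (auto simp: admissible_iff)
  define w where "w = concat_control T u v"
  have w: "w \<in> controls" unfolding w_def by (rule concat_control_in_controls[OF u vc T])
  have left: "trajectory f w \<xi> t = trajectory f u \<xi> t" if "0 \<le> t" "t \<le> T" for t
    unfolding w_def by (rule trajectory_concat_left[OF u vc that])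
  have right: "trajectory f w \<xi> (T + t) = trajectory f v p t" if "0 \<le> t" for t
    unfolding w_def p_def by (rule trajectory_concat_right[OF u vc T that])
  have "w \<in> admissible_controls f h \<xi>"
    unfolding admissible_iff
  proof (intro conjI w allI impI)
    fix t :: real assume t: "0 \<le> t"
    show "h (trajectory f w \<xi> t) \<le> 0"
    proof (cases "t \<le> T")
      case True
      then show ?thesis using left adm t by simp
    next
      case False
      then show ?thesis using right[of "t - T"] vh[of "t - T"] by simp
    qed
  qed
  then have "V \<xi> \<le> cost w \<xi>" by (rule V_le)
  also have "cost w \<xi> = integral {0..T} (running w \<xi>) + exp (- T) * cost (shift_control T w) p"
    using cost_split[OF w T] left[OF T order_refl] by (simp add: p_def)
  also have "integral {0..T} (running w \<xi>) = integral {0..T} (running u \<xi>)"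
  proof (rule integral_spike[of "{T}"])
    fix s assume s: "s \<in> {0..T} - {T}"
    then have "w s = u s" by (simp add: w_def concat_control_def)
    with s show "running u \<xi> s = running w \<xi> s" by (simp add: running_def left)
  qed simp
  \<comment> \<open>At negative times the shifted concatenation may differ from v, so the two need
    not be equal as functions; the cost sees nonnegative times only.\<close>
  also have "shift_control T w = (\<lambda>s. if 0 \<le> s then v s else w (T + s))"
    by (auto simp: shift_control_def w_def concat_control_def fun_eq_iff)
  also have "cost \<dots> p = cost v p"
  proof -
    let ?v = "\<lambda>s. if 0 \<le> s then v s else w (T + s)"
    have eq: "?v = shift_control T w"
      by (auto simp: shift_control_def w_def concat_control_def fun_eq_iff)
    have c: "?v \<in> controls" unfolding eq by (rule shift_control_in_controls[OF w T])
    have "trajectory f ?v p t = trajectory f v p t" if "0 \<le> t" for t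
      by (rule trajectory_unique[OF c vc is_solution_trajectory[OF vc] _ that order_refl]) auto
    then show ?thesis
      unfolding cost_integral[OF c] cost_integral[OF vc]
      by (intro Henstock_Kurzweil_Integration.integral_cong) (simp add: running_def)
  qed
  also have "exp (- T) * cost v p \<le> exp (- T) * V p + e"
  proof -
    have "exp (- T) * cost v p \<le> exp (- T) * (V p + e)" using v(2) by (intro mult_left_mono) auto
    moreover have "exp (- T) * e \<le> e" using T e by (intro mult_left_le_one_le) auto
    ultimately show ?thesis by (simp add: distrib_left)
  qed
  finally show "V \<xi> \<le> integral {0..T} (running u \<xi>) + exp (- T) * V (trajectory f u \<xi> T) + e"
    by (simp add: p_def)
qed

text \<open>One \<open>B * T\<close> bounds the running cost of the move, the other the effect of
  discounting the value at its endpoint.\<close>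

lemma V_le_after_move:
  assumes u: "u \<in> controls" and T: "0 \<le> T" and adm: "\<And>t. 0 \<le> t \<Longrightarrow> t \<le> T \<Longrightarrow> h (trajectory f u \<xi> t) \<le> 0"
  shows "V \<xi> \<le> V (trajectory f u \<xi> T) + 2 * B * T"
proof -
  let ?p = "trajectory f u \<xi> T"
  have "\<bar>running u \<xi> t\<bar> \<le> B" if "t \<in> {0..T}" for t
    using abs_running_le[OF u, of t \<xi>] mult_left_mono[of "exp (- t)" 1 B] B_nonneg that by fastforce
  then have "norm (integral {0..T} (running u \<xi>)) \<le> B * (T - 0)"
    using has_integral_bound_real[OF B_nonneg finite.emptyI integrable_integral[OF running_integrable[OF u order_refl, of \<xi> T]]] T
    by simp
  moreover have "exp (- T) * V ?p \<le> V ?p + T * B"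
  proof -
    have "1 - exp (- T) \<le> T" using exp_ge_add_one_self[of "- T"] by linarith
    moreover have "- V ?p \<le> B" using abs_V_le[of ?p] adm[OF T] by simp
    moreover have "0 \<le> 1 - exp (- T)" using T by simp
    ultimately have "(1 - exp (- T)) * (- V ?p) \<le> T * B"
      using T B_nonneg by (intro order_trans[OF mult_left_mono mult_right_mono])
    then show ?thesis by (simp add: algebra_simps)
  qed
  ultimately show ?thesis using dynamic_programming_le[OF u T adm] by (simp add: algebra_simps)
qed

text \<open>A nearly optimal control of \<xi> is copied from \<eta> up to time \<tau>, as long as it
  is known to be feasible there. From q its remainder is admissible and costs at least
  \<open>V q\<close>; from p a new control is chosen at the price \<open>V p\<close>. The discount
  multiplies the difference of these values, which is the source of the contraction.\<close>

lemma V_compare: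
  assumes \<xi>: "h \<xi> \<le> 0" and \<tau>: "0 \<le> \<tau>" and e: "0 < e"
    and follow: "\<And>u t. u \<in> admissible_controls f h \<xi> \<Longrightarrow> 0 \<le> t \<Longrightarrow> t \<le> \<tau> \<Longrightarrow> h (trajectory f u \<eta> t) \<le> 0"
  obtains p q where "h p \<le> 0" "h q \<le> 0" "norm (p - q) \<le> norm (\<xi> - \<eta>) * exp (2 * k * \<tau>)"
    "V \<eta> \<le> V \<xi> + e + \<tau> * (k\<^sub>L * (norm (\<xi> - \<eta>) * exp (2 * k * \<tau>))) + exp (- \<tau>) * (V p - V q)"
proof -
  obtain u where u: "u \<in> admissible_controls f h \<xi>" "cost u \<xi> < V \<xi> + e"
    using V_approx[OF \<xi> e] by blast
  have uc: "u \<in> controls" and uh: "\<And>t. 0 \<le> t \<Longrightarrow> h (trajectory f u \<xi> t) \<le> 0"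
    using u(1) by (auto simp: admissible_iff)
  define E where "E = norm (\<xi> - \<eta>) * exp (2 * k * \<tau>)"
  define q where "q = trajectory f u \<xi> \<tau>"
  define p where "p = trajectory f u \<eta> \<tau>"
  have stab: "norm (trajectory f u \<eta> t - trajectory f u \<xi> t) \<le> E" if "0 \<le> t" "t \<le> \<tau>" for t
  proof -
    have "norm (trajectory f u \<eta> t - trajectory f u \<xi> t) \<le> norm (\<xi> - \<eta>) * exp (2 * k * t)"
      using trajectory_stability[OF uc that(1), of \<xi> \<eta>] by (simp add: norm_minus_commute)
    also have "\<dots> \<le> E"
      unfolding E_def using that k_nonneg by (intro mult_left_mono) (auto intro: mult_left_mono)
    finally show ?thesis .
  qed
  have "V q \<le> cost (shift_control \<tau> u) q"
  proof (rule V_le)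
    show "shift_control \<tau> u \<in> admissible_controls f h q"
      unfolding admissible_iff q_def using shift_control_in_controls[OF uc \<tau>] trajectory_shift[OF uc \<tau>] uh \<tau> by simp
  qed
  then have 1: "exp (- \<tau>) * V q \<le> exp (- \<tau>) * cost (shift_control \<tau> u) q" by (intro mult_left_mono) auto
  have 2: "cost u \<xi> = integral {0..\<tau>} (running u \<xi>) + exp (- \<tau>) * cost (shift_control \<tau> u) q"
    using cost_split[OF uc \<tau>] by (simp add: q_def)
  have 3: "V \<eta> \<le> integral {0..\<tau>} (running u \<eta>) + exp (- \<tau>) * V p"
    unfolding p_def using follow[OF u(1)] by (intro dynamic_programming_le[OF uc \<tau>]) auto
  have "norm (integral {0..\<tau>} (\<lambda>t. running u \<eta> t - running u \<xi> t)) \<le> (k\<^sub>L * E) * Henstock_Kurzweil_Integration.content {0..\<tau>}"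
  proof (rule has_integral_bound_real[OF _ finite.emptyI integrable_integral])
    show "0 \<le> k\<^sub>L * E" using k\<^sub>L_nonneg by (simp add: E_def)
    show "(\<lambda>t. running u \<eta> t - running u \<xi> t) integrable_on {0..\<tau>}"
      by (intro integrable_diff running_integrable[OF uc order_refl])
    fix t assume t: "t \<in> {0..\<tau>} - {}"
    then have t0: "0 \<le> t" by simp
    have "\<bar>L (trajectory f u \<eta> t) (u t) - L (trajectory f u \<xi> t) (u t)\<bar> \<le> k\<^sub>L * norm (trajectory f u \<eta> t - trajectory f u \<xi> t)"
      using lipschitz_onD[OF L_lip[OF controls_value[OF uc t0]]] by (simp add: dist_norm dist_real_def)
    also have "\<dots> \<le> k\<^sub>L * E" using stab t k\<^sub>L_nonneg by (intro mult_left_mono) auto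
    finally have le: "\<bar>L (trajectory f u \<eta> t) (u t) - L (trajectory f u \<xi> t) (u t)\<bar> \<le> k\<^sub>L * E" .
    have "norm (running u \<eta> t - running u \<xi> t) = exp (- t) * \<bar>L (trajectory f u \<eta> t) (u t) - L (trajectory f u \<xi> t) (u t)\<bar>"
      by (simp add: running_def abs_mult flip: right_diff_distrib)
    also have "\<dots> \<le> 1 * (k\<^sub>L * E)" using le t0 by (intro mult_mono) auto
    finally show "norm (running u \<eta> t - running u \<xi> t) \<le> k\<^sub>L * E" by simp
  qed
  then have 4: "integral {0..\<tau>} (running u \<eta>) - integral {0..\<tau>} (running u \<xi>) \<le> \<tau> * (k\<^sub>L * E)"
    using \<tau> by (simp add: Henstock_Kurzweil_Integration.integral_diff running_integrable[OF uc] mult.commute)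
  show thesis
  proof (rule that)
    show "h p \<le> 0" using follow[OF u(1) \<tau> order_refl] by (simp add: p_def)
    show "h q \<le> 0" using uh \<tau> by (simp add: q_def)
    show "norm (p - q) \<le> norm (\<xi> - \<eta>) * exp (2 * k * \<tau>)" using stab[OF \<tau> order_refl] by (simp add: p_def q_def E_def)
    show "V \<eta> \<le> V \<xi> + e + \<tau> * (k\<^sub>L * (norm (\<xi> - \<eta>) * exp (2 * k * \<tau>))) + exp (- \<tau>) * (V p - V q)"
      unfolding E_def[symmetric] right_diff_distrib using 1 2 3 4 u(2) by linarith
  qed
qed

end

section \<open>Uniform constants near a compact boundary, and copied controls\<close>

context regular_constraint
begin

lemma inward_move_mono:
  assumes "inward_move r c M \<xi>" "0 < r" "c' \<le> c" "M \<le> M'"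
  shows "inward_move r c' M' \<xi>"
proof -
  obtain u T where u: "u \<in> controls" and T: "0 \<le> T" "T \<le> M * r" "\<forall>s\<in>{0..T}. h (trajectory f u \<xi> s) \<le> 0"
    "h (trajectory f u \<xi> T) \<le> h \<xi> - c * r\<^sup>2" "norm (trajectory f u \<xi> T - \<xi>) \<le> M * r\<^sup>2"
    using assms(1) unfolding inward_move_def by blast
  have "M * r \<le> M' * r" "M * r\<^sup>2 \<le> M' * r\<^sup>2" "c' * r\<^sup>2 \<le> c * r\<^sup>2"
    using assms by (auto intro: mult_right_mono)
  with u T show ?thesis unfolding inward_move_def by (intro bexI[of _ u] exI[of _ T]) auto
qed

text \<open>The constraint set may be unbounded. A finite cover of its boundary gives common
  constants in a neighbourhood of the boundary, and every other feasible point is the centre of a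
  feasible ball of fixed radius. R confines the points that need a move to a ball, on which
  \<open>lie1\<close> has a Lipschitz constant.\<close>

lemma uniform_inward_move:
  assumes cpt: "compact (frontier (constraint_set h))"
  obtains \<eta> r\<^sub>0 c M R where "0 < \<eta>" "0 < r\<^sub>0" "0 < c" "0 < M"
    "\<And>\<xi>. h \<xi> \<le> 0 \<Longrightarrow> (\<forall>x\<in>ball \<xi> \<eta>. h x \<le> 0) \<or>
      (norm \<xi> \<le> R \<and> (\<forall>r. 0 < r \<longrightarrow> r < r\<^sub>0 \<longrightarrow> inward_move r c M \<xi>))"
proof -
  let ?C = "constraint_set h" and ?F = "frontier (constraint_set h)"
  have closed: "closed ?C" unfolding constraint_set_def
    by (intro closed_Collect_le continuous_on_h continuous_intros)
  have "\<exists>\<eta> r\<^sub>0 c M. 0 < \<eta> \<and> 0 < r\<^sub>0 \<and> 0 < c \<and> 0 < M \<and> (\<forall>\<xi> r. norm (\<xi> - x) < \<eta> \<longrightarrow> h \<xi> \<le> 0 \<longrightarrow>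
      0 < r \<longrightarrow> r < r\<^sub>0 \<longrightarrow> inward_move r c M \<xi>)" if "x \<in> ?F" for x
  proof -
    have "x \<in> ?C" using frontier_subset_closed[OF closed] that by (rule subsetD)
    then have "h x \<le> 0" by (simp add: constraint_set_def)
    show ?thesis
    proof (rule local_inward_move[OF \<open>h x \<le> 0\<close>])
      fix \<eta> r\<^sub>0 c M :: real
      assume "0 < \<eta>" "0 < r\<^sub>0" "0 < c" "0 < M"
        "\<And>\<xi> r. norm (\<xi> - x) < \<eta> \<Longrightarrow> h \<xi> \<le> 0 \<Longrightarrow> 0 < r \<Longrightarrow> r < r\<^sub>0 \<Longrightarrow> inward_move r c M \<xi>"
      then show ?thesis by (intro exI[of _ \<eta>] exI[of _ r\<^sub>0] exI[of _ c] exI[of _ M]) simp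
    qed
  qed
  then obtain \<eta> r\<^sub>0 c M where pos: "\<And>x. x \<in> ?F \<Longrightarrow> 0 < \<eta> x \<and> 0 < r\<^sub>0 x \<and> 0 < c x \<and> 0 < M x"
    and mv: "\<And>x \<xi> r. x \<in> ?F \<Longrightarrow> norm (\<xi> - x) < \<eta> x \<Longrightarrow> h \<xi> \<le> 0 \<Longrightarrow> 0 < r \<Longrightarrow> r < r\<^sub>0 x \<Longrightarrow> inward_move r (c x) (M x) \<xi>"
    by metis
  have "?F \<subseteq> (\<Union>x\<in>?F. ball x (\<eta> x))" using pos by fastforce
  then obtain D where D: "D \<subseteq> ?F" "finite D" "?F \<subseteq> (\<Union>x\<in>D. ball x (\<eta> x))"
    by (rule compactE_image[OF cpt open_ball])
  have "open (\<Union>x\<in>D. ball x (\<eta> x))" by auto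
  then obtain \<epsilon> where \<epsilon>: "0 < \<epsilon>" "(\<Union>x\<in>?F. ball x \<epsilon>) \<subseteq> (\<Union>x\<in>D. ball x (\<eta> x))"
    using compact_subset_open_imp_ball_epsilon_subset[OF cpt _ D(3)] by blast
  obtain R where R: "\<And>x. x \<in> ?F \<Longrightarrow> norm x \<le> R"
    using compact_imp_bounded[OF cpt] by (auto simp: bounded_iff)
  \<comment> \<open>The inserted 1 keeps the extrema meaningful when the boundary, and with it the
    cover, is empty.\<close>
  define r' where "r' = Min (insert 1 (r\<^sub>0 ` D))"
  define c' where "c' = Min (insert 1 (c ` D))"
  define M' where "M' = Max (insert 1 (M ` D))"
  have le: "r' \<le> r\<^sub>0 x" "c' \<le> c x" "M x \<le> M'" if "x \<in> D" for x
    using that D(2) by (auto simp: r'_def c'_def M'_def)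
  show thesis
  proof (rule that[of \<epsilon> r' c' M' "R + \<epsilon>"])
    show "0 < r'" "0 < c'" using D pos by (auto simp: r'_def c'_def)
    have "1 \<le> M'" using D(2) by (simp add: M'_def)
    then show "0 < M'" by simp
    fix \<xi> assume \<xi>: "h \<xi> \<le> 0"
    show "(\<forall>x\<in>ball \<xi> \<epsilon>. h x \<le> 0) \<or> (norm \<xi> \<le> R + \<epsilon> \<and> (\<forall>r. 0 < r \<longrightarrow> r < r' \<longrightarrow> inward_move r c' M' \<xi>))"
    proof (cases "ball \<xi> \<epsilon> \<inter> ?F = {}")
      case True
      have "\<xi> \<in> ball \<xi> \<epsilon> \<inter> ?C" using \<xi> \<epsilon> by (simp add: constraint_set_def)
      then have "ball \<xi> \<epsilon> \<subseteq> ?C"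
        using connected_Int_frontier[of "ball \<xi> \<epsilon>" ?C] True connected_ball by blast
      then show ?thesis by (auto simp: constraint_set_def)
    next
      case False
      then obtain y where y: "y \<in> ?F" "dist \<xi> y < \<epsilon>" by auto
      have "norm \<xi> \<le> R + \<epsilon>" using R[OF y(1)] y(2) norm_triangle_sub[of \<xi> y] by (simp add: dist_norm)
      moreover obtain x where x: "x \<in> D" "norm (\<xi> - x) < \<eta> x"
        using \<epsilon>(2) y by (force simp: dist_norm norm_minus_commute)
      have "inward_move r c' M' \<xi>" if r: "0 < r" "r < r'" for r
      proof (rule inward_move_mono)
        show "inward_move r (c x) (M x) \<xi>" using mv[of x \<xi> r] x D(1) \<xi> r le(1)[OF x(1)] by auto
      qed (use le[OF x(1)] r in auto)
      ultimately show ?thesis by blast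
    qed
  qed (rule \<epsilon>(1))
qed


text \<open>Increments of h along the two trajectories are compared, not values: by stability their
  rates differ by a multiple of \<open>norm (\<xi> - \<eta>)\<close>, so the error carries a factor
  t. A Lipschitz estimate of h at time t would leave an error that does not vanish as t tends to 0,
  and a gain smaller than the distance could not compensate for it.\<close>

lemma following_stays_feasible:
  assumes u: "u \<in> controls" and adm: "\<And>t. 0 \<le> t \<Longrightarrow> h (trajectory f u \<xi> t) \<le> 0"
    and K: "\<And>l p q. norm p \<le> R + k\<^sub>0 \<Longrightarrow> norm q \<le> R + k\<^sub>0 \<Longrightarrow> \<bar>lie1 l p - lie1 l q\<bar> \<le> K * norm (p - q)"
    and R: "norm \<xi> \<le> R" "norm \<eta> \<le> R" and K0: "0 \<le> K"
    and t: "0 \<le> t" "t \<le> 1"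
    and gain: "h \<eta> + 2 * K * exp (2 * k) * norm (\<xi> - \<eta>) * t \<le> h \<xi>"
  shows "h (trajectory f u \<eta> t) \<le> 0"
proof -
  define x y where "x = trajectory f u \<xi>" and "y = trajectory f u \<eta>"
  define E where "E = K * (norm (\<xi> - \<eta>) * exp (2 * k))"
  have "((\<lambda>s. (u s $ 1 * lie1 1 (y s) + u s $ 2 * lie1 2 (y s)) - (u s $ 1 * lie1 1 (x s) + u s $ 2 * lie1 2 (x s)))
      has_integral (h (y t) - h \<eta>) - (h (x t) - h \<xi>)) {0..t}"
    unfolding x_def y_def by (intro has_integral_diff h_along_trajectory u t)
  moreover have "norm ((u s $ 1 * lie1 1 (y s) + u s $ 2 * lie1 2 (y s)) - (u s $ 1 * lie1 1 (x s) + u s $ 2 * lie1 2 (x s))) \<le> 2 * E"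
    if s: "s \<in> {0..t}" for s
  proof -
    have "norm (\<xi> - \<eta>) * exp (2 * k * s) \<le> norm (\<xi> - \<eta>) * exp (2 * k)"
      using s t k_nonneg mult_left_mono[of s 1 "2 * k"] by (intro mult_left_mono) auto
    then have "norm (y s - x s) \<le> norm (\<xi> - \<eta>) * exp (2 * k)"
      using trajectory_stability[OF u, of s \<xi> \<eta>] s by (simp add: x_def y_def norm_minus_commute)
    then have "K * norm (y s - x s) \<le> E" unfolding E_def using K0 by (rule mult_left_mono)
    moreover have "norm (x s) \<le> R + k\<^sub>0" "norm (y s) \<le> R + k\<^sub>0"
      using norm_trajectory_le[OF u] R s t by (auto simp: x_def y_def)
    ultimately have d: "\<bar>lie1 l (y s) - lie1 l (x s)\<bar> \<le> E" for l
      using K[of "y s" "x s" l] by linarith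
    have t: "\<bar>a * b\<bar> \<le> E" if "\<bar>a\<bar> \<le> 1" "\<bar>b\<bar> \<le> E" for a b :: real
      using mult_mono[OF that] by (simp add: abs_mult)
    have "\<bar>u s $ 1 * (lie1 1 (y s) - lie1 1 (x s))\<bar> \<le> E" "\<bar>u s $ 2 * (lie1 2 (y s) - lie1 2 (x s))\<bar> \<le> E"
      using control_values_component_le[OF controls_value[OF u, of s]] s d by (auto intro!: t)
    then show ?thesis by (simp add: right_diff_distrib)
  qed
  moreover have "0 \<le> E" using K0 by (simp add: E_def)
  ultimately have "norm ((h (y t) - h \<eta>) - (h (x t) - h \<xi>)) \<le> 2 * E * Henstock_Kurzweil_Integration.content {0..t}"
    by (intro has_integral_bound_real[OF _ finite.emptyI]) auto
  also have "\<dots> = 2 * K * exp (2 * k) * norm (\<xi> - \<eta>) * t"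
    using t by (simp add: E_def)
  finally have "h (y t) - h \<eta> - (h (x t) - h \<xi>) \<le> 2 * K * exp (2 * k) * norm (\<xi> - \<eta>) * t" by simp
  then show ?thesis using gain adm[OF t(1)] unfolding x_def y_def by linarith
qed

end

section \<open>Contraction of the modulus of continuity\<close>

locale regular_discounted_problem =
  regular_constraint f k k\<^sub>0 h \<alpha> \<delta> d\<^sub>0 + discounted_problem f k k\<^sub>0 h L B k\<^sub>L
  for f :: "2 \<Rightarrow> real ^ 'n \<Rightarrow> real ^ 'n" and k k\<^sub>0 :: real and h :: "real ^ 'n \<Rightarrow> real"
    and \<alpha> \<delta> d\<^sub>0 :: real and L :: "real ^ 'n \<Rightarrow> real ^ 2 \<Rightarrow> real" and B k\<^sub>L :: real +
  fixes k\<^sub>h :: real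
  assumes h_lip: "k\<^sub>h-lipschitz_on UNIV h" and frontier_compact: "compact (frontier (constraint_set h))"
begin

lemma V_difference_step:
  obtains \<tau> where "0 < \<tau>" "\<And>e. 0 < e \<Longrightarrow> \<exists>d>0. \<forall>\<xi> \<eta>. h \<xi> \<le> 0 \<longrightarrow> h \<eta> \<le> 0 \<longrightarrow> norm (\<xi> - \<eta>) < d \<longrightarrow>
      (\<exists>p q. h p \<le> 0 \<and> h q \<le> 0 \<and> norm (p - q) < e \<and> V \<eta> - V \<xi> \<le> e + exp (- \<tau>) * (V p - V q))"
proof -
  obtain \<eta>\<^sub>0 r\<^sub>0 c M R where pos: "0 < \<eta>\<^sub>0" "0 < r\<^sub>0" "0 < c" "0 < M" and dich:
    "\<And>\<xi>. h \<xi> \<le> 0 \<Longrightarrow> (\<forall>x\<in>ball \<xi> \<eta>\<^sub>0. h x \<le> 0) \<or>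
      (norm \<xi> \<le> R \<and> (\<forall>r. 0 < r \<longrightarrow> r < r\<^sub>0 \<longrightarrow> inward_move r c M \<xi>))"
    using uniform_inward_move[OF frontier_compact] by blast
  have kh: "0 \<le> k\<^sub>h" by (rule lipschitz_on_nonneg[OF h_lip])
  \<comment> \<open>An inward move with \<open>r\<^sup>2 = m * norm (\<xi> - \<eta>)\<close> gains more than \<open>h\<close> can differ between \<open>\<xi>\<close> and \<open>\<eta>\<close>.\<close>
  define m where "m = (k\<^sub>h + 1) / c"
  \<comment> \<open>In units of \<open>norm (\<xi> - \<eta>)\<close>, this bounds the distance from
    \<xi> to the moved point: 1 from \<xi> to \<eta>, and \<open>M * m\<close> for the move.\<close>
  define M' where "M' = 1 + M * m"
  have m: "0 < m" "c * m = k\<^sub>h + 1" using kh pos by (auto simp: m_def)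
  have M': "1 \<le> M'" using m pos by (simp add: M'_def)
  define R' where "R' = R + 1 + M'"
  obtain K1 where K1: "0 < K1" "\<And>p q. norm p \<le> R' + k\<^sub>0 \<Longrightarrow> norm q \<le> R' + k\<^sub>0 \<Longrightarrow> norm (lie1 1 p - lie1 1 q) \<le> K1 * norm (p - q)"
    using lipschitz_on_cballsE[OF lie1_lipschitz, of "R' + k\<^sub>0" 1] by blast
  obtain K2 where K2: "0 < K2" "\<And>p q. norm p \<le> R' + k\<^sub>0 \<Longrightarrow> norm q \<le> R' + k\<^sub>0 \<Longrightarrow> norm (lie1 2 p - lie1 2 q) \<le> K2 * norm (p - q)"
    using lipschitz_on_cballsE[OF lie1_lipschitz, of "R' + k\<^sub>0" 2] by blast
  define K where "K = K1 + K2"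
  have Kpos: "0 < K" using K1 K2 by (simp add: K_def)
  have K: "\<bar>lie1 l p - lie1 l q\<bar> \<le> K * norm (p - q)" if "norm p \<le> R' + k\<^sub>0" "norm q \<le> R' + k\<^sub>0" for l p q
  proof -
    have "0 \<le> K1 * norm (p - q)" "0 \<le> K2 * norm (p - q)" using K1 K2 by auto
    then show ?thesis using K1(2)[OF that] K2(2)[OF that] exhaust_2[of l] by (auto simp: K_def distrib_right)
  qed
  define S where "S = 2 * K * exp (2 * k) * M'"
  have S: "0 < S" using Kpos M' by (simp add: S_def)
  \<comment> \<open>Fixed before e and the points. The bound \<open>1 / S\<close> keeps the copying
    error within the gain, the second entry keeps trajectories that start deep inside the constraint
    set in their feasible ball, and 1 is the horizon of
    \<open>following_stays_feasible\<close>.\<close>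
  define \<tau> where "\<tau> = min 1 (min (\<eta>\<^sub>0 / (2 * (k\<^sub>0 + 1))) (1 / S))"
  have \<tau>: "0 < \<tau>" "\<tau> \<le> 1" using pos k\<^sub>0_nonneg S by (auto simp: \<tau>_def)
  have \<tau>S: "S * \<tau> \<le> 1"
  proof -
    have "\<tau> \<le> 1 / S" by (simp add: \<tau>_def)
    then show ?thesis using S by (simp add: field_simps)
  qed
  have \<tau>\<eta>: "k\<^sub>0 * \<tau> < \<eta>\<^sub>0"
  proof -
    have "\<tau> \<le> \<eta>\<^sub>0 / (2 * (k\<^sub>0 + 1))" by (simp add: \<tau>_def)
    then have "2 * (k\<^sub>0 * \<tau>) + 2 * \<tau> \<le> \<eta>\<^sub>0" using k\<^sub>0_nonneg by (simp add: field_simps)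
    moreover have "0 \<le> k\<^sub>0 * \<tau>" using k\<^sub>0_nonneg \<tau> by simp
    ultimately show ?thesis using \<tau> by linarith
  qed
  define G where "G = M' * exp (2 * k)"
  have G: "0 < G" using M' by (simp add: G_def)
  show thesis
  proof (rule that[OF \<tau>(1)])
    fix e :: real assume e: "0 < e"
    \<comment> \<open>All errors in terms of the distance \<rho>: the distance of the new pair, the
      Lipschitz error of the running cost, and the price of the move, whose duration is only of the
      order of the square root of \<rho>.\<close>
    define \<psi> where "\<psi> \<rho> = G * \<rho> + k\<^sub>L * (G * \<rho>) + 2 * B * (M * sqrt (m * \<rho>))" for \<rho>
    have "isCont \<psi> 0" unfolding \<psi>_def by (intro continuous_intros)
    moreover have "\<psi> 0 = 0" by (simp add: \<psi>_def)
    ultimately obtain d1 where d1: "0 < d1" "\<And>\<rho>. \<bar>\<rho>\<bar> < d1 \<Longrightarrow> \<bar>\<psi> \<rho>\<bar> < e / 2"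
      unfolding continuous_at_eps_delta dist_real_def using e by (metis diff_zero half_gt_zero)
    define d where "d = min (min 1 d1) (r\<^sub>0\<^sup>2 / m)"
    have "\<exists>p q. h p \<le> 0 \<and> h q \<le> 0 \<and> norm (p - q) < e \<and> V \<eta> - V \<xi> \<le> e + exp (- \<tau>) * (V p - V q)"
      if \<xi>: "h \<xi> \<le> 0" and \<eta>: "h \<eta> \<le> 0" and near: "norm (\<xi> - \<eta>) < d" for \<xi> \<eta>
    \<comment> \<open>Coinciding points are treated apart: they would give the radius 0, for which
      no inward move is available.\<close>
    proof (cases "\<xi> = \<eta>")
      case True
      then show ?thesis using \<xi> e by (intro exI[of _ \<xi>]) simp
    next
      case False
      define \<rho> where "\<rho> = norm (\<xi> - \<eta>)"
      have \<rho>: "0 < \<rho>" "\<rho> < 1" "\<rho> < d1" "\<rho> < r\<^sub>0\<^sup>2 / m" using False near by (auto simp: \<rho>_def d_def)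
      define r where "r = sqrt (m * \<rho>)"
      have r2: "r\<^sup>2 = m * \<rho>" using m \<rho> by (simp add: r_def)
      have r: "0 < r" "r < r\<^sub>0"
      proof -
        show "0 < r" using m \<rho> by (simp add: r_def)
        have "r\<^sup>2 < r\<^sub>0\<^sup>2" using \<rho>(4) m by (simp add: r2 field_simps)
        then show "r < r\<^sub>0" using pos(2) power2_less_imp_less by (metis less_imp_le)
      qed
      have \<psi>: "G * \<rho> + k\<^sub>L * (G * \<rho>) + 2 * B * (M * r) < e / 2"
      proof -
        have "\<psi> \<rho> < e / 2" using d1(2)[of \<rho>] \<rho> by (simp add: abs_less_iff)
        then show ?thesis unfolding \<psi>_def r_def .
      qed
      have nn: "0 \<le> G * \<rho>" "0 \<le> k\<^sub>L * (G * \<rho>)" "0 \<le> 2 * B * (M * r)"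
        using G \<rho> k\<^sub>L_nonneg B_nonneg pos r by auto
      \<comment> \<open>The point from which the controls of \<xi> are copied: \<eta> itself if it
        lies deep inside the constraint set, otherwise the endpoint of its inward move.\<close>
      obtain \<zeta> where \<zeta>: "norm (\<xi> - \<zeta>) \<le> M' * \<rho>" "V \<eta> \<le> V \<zeta> + 2 * B * (M * r)"
        and follow: "\<And>u t. u \<in> admissible_controls f h \<xi> \<Longrightarrow> 0 \<le> t \<Longrightarrow> t \<le> \<tau> \<Longrightarrow> h (trajectory f u \<zeta> t) \<le> 0"
      proof (cases "\<forall>x\<in>ball \<eta> \<eta>\<^sub>0. h x \<le> 0")
        case True
        show ?thesis
        proof (rule that[of \<eta>])
          show "norm (\<xi> - \<eta>) \<le> M' * \<rho>" using mult_right_mono[OF M', of \<rho>] \<rho> by (simp add: \<rho>_def)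
          show "V \<eta> \<le> V \<eta> + 2 * B * (M * r)" using nn by simp
          fix u t assume u: "u \<in> admissible_controls f h \<xi>" and t: "0 \<le> t" "t \<le> \<tau>"
          have uc: "u \<in> controls" using u by (simp add: admissible_iff)
          have "norm (trajectory f u \<eta> t - \<eta>) \<le> k\<^sub>0 * t"
            using norm_trajectory_diff[OF uc order_refl t(1), of \<eta>] trajectory_0[OF uc] by simp
          also have "\<dots> \<le> k\<^sub>0 * \<tau>" using t k\<^sub>0_nonneg by (intro mult_left_mono)
          also have "\<dots> < \<eta>\<^sub>0" by (rule \<tau>\<eta>)
          finally show "h (trajectory f u \<eta> t) \<le> 0" using True by (simp add: dist_norm norm_minus_commute)
        qed
      next
        case False
        then have \<eta>R: "norm \<eta> \<le> R" and "inward_move r c M \<eta>" using dich[OF \<eta>] r by auto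
        then obtain v T where v: "v \<in> controls" and T: "0 \<le> T" "T \<le> M * r"
          "\<And>s. s \<in> {0..T} \<Longrightarrow> h (trajectory f v \<eta> s) \<le> 0" "h (trajectory f v \<eta> T) \<le> h \<eta> - c * r\<^sup>2"
          "norm (trajectory f v \<eta> T - \<eta>) \<le> M * r\<^sup>2"
          unfolding inward_move_def by blast
        let ?z = "trajectory f v \<eta> T"
        have "norm (\<xi> - ?z) \<le> norm (\<xi> - \<eta>) + norm (?z - \<eta>)"
          using norm_triangle_ineq4[of "\<xi> - \<eta>" "?z - \<eta>"] by simp
        also have "\<dots> \<le> M' * \<rho>" using T(5) by (simp add: r2 \<rho>_def M'_def algebra_simps)
        finally have \<xi>z: "norm (\<xi> - ?z) \<le> M' * \<rho>" .
        have "h \<eta> - h \<xi> \<le> k\<^sub>h * \<rho>"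
          using lipschitz_onD[OF h_lip, of \<eta> \<xi>] by (simp add: dist_norm \<rho>_def norm_minus_commute)
        moreover have "c * r\<^sup>2 = k\<^sub>h * \<rho> + \<rho>" using m(2) by (simp add: r2 algebra_simps flip: mult.assoc)
        \<comment> \<open>Of the gain \<open>(k\<^sub>h + 1) * \<rho>\<close>, the part
          \<open>k\<^sub>h * \<rho>\<close> makes up for a possibly larger value of h at \<eta>; the
          surplus \<rho> is what the copying error may consume.\<close>
        ultimately have gain: "h ?z \<le> h \<xi> - \<rho>" using T(4) by linarith
        have M\<rho>: "M' * \<rho> \<le> M'" using \<rho> M' by (simp add: mult_left_le)
        have \<xi>R: "norm \<xi> \<le> R + 1" using norm_triangle_sub[of \<xi> \<eta>] \<eta>R \<rho> by (simp add: \<rho>_def)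
        show ?thesis
        proof (rule that[OF \<xi>z])
          have "V \<eta> \<le> V ?z + 2 * B * T" using T by (intro V_le_after_move[OF v T(1)]) auto
          also have "\<dots> \<le> V ?z + 2 * B * (M * r)" using T(2) B_nonneg by (intro add_left_mono mult_left_mono) auto
          finally show "V \<eta> \<le> V ?z + 2 * B * (M * r)" .
          fix u t assume u: "u \<in> admissible_controls f h \<xi>" and t: "0 \<le> t" "t \<le> \<tau>"
          show "h (trajectory f u ?z t) \<le> 0"
          proof (rule following_stays_feasible[OF _ _ K])
            show "u \<in> controls" "\<And>t. 0 \<le> t \<Longrightarrow> h (trajectory f u \<xi> t) \<le> 0"
              using u by (auto simp: admissible_iff)
            show "norm \<xi> \<le> R'" using \<xi>R M' by (simp add: R'_def)
            show "norm ?z \<le> R'"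
              using norm_triangle_sub[of ?z \<xi>] \<xi>R \<xi>z M\<rho> by (simp add: R'_def norm_minus_commute)
            show "0 \<le> K" "0 \<le> t" "t \<le> 1" using Kpos t \<tau> by auto
            have "2 * K * exp (2 * k) * norm (\<xi> - ?z) * t \<le> 2 * K * exp (2 * k) * (M' * \<rho>) * \<tau>"
              using \<xi>z t Kpos \<rho> M' by (intro mult_mono mult_left_mono) auto
            also have "\<dots> = (S * \<tau>) * \<rho>" by (simp add: S_def)
            also have "\<dots> \<le> 1 * \<rho>" using \<tau>S \<rho> by (intro mult_right_mono) auto
            finally show "h ?z + 2 * K * exp (2 * k) * norm (\<xi> - ?z) * t \<le> h \<xi>" using gain by linarith
          qed
        qed
      qed
      have Z: "norm (\<xi> - \<zeta>) * exp (2 * k * \<tau>) \<le> G * \<rho>"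
      proof -
        have "norm (\<xi> - \<zeta>) * exp (2 * k * \<tau>) \<le> (M' * \<rho>) * exp (2 * k)"
          using \<zeta>(1) \<tau> k_nonneg M' \<rho> mult_left_mono[of \<tau> 1 "2 * k"] by (intro mult_mono) auto
        then show ?thesis by (simp add: G_def mult_ac)
      qed
      obtain p q where pq: "h p \<le> 0" "h q \<le> 0" "norm (p - q) \<le> norm (\<xi> - \<zeta>) * exp (2 * k * \<tau>)"
        "V \<zeta> \<le> V \<xi> + e / 2 + \<tau> * (k\<^sub>L * (norm (\<xi> - \<zeta>) * exp (2 * k * \<tau>))) + exp (- \<tau>) * (V p - V q)"
        using V_compare[OF \<xi> less_imp_le[OF \<tau>(1)] half_gt_zero[OF e] follow] by blast
      have "\<tau> * (k\<^sub>L * (norm (\<xi> - \<zeta>) * exp (2 * k * \<tau>))) \<le> 1 * (k\<^sub>L * (G * \<rho>))"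
        using \<tau> k\<^sub>L_nonneg by (intro mult_mono[OF _ mult_left_mono[OF Z]]) auto
      then have "V \<eta> - V \<xi> \<le> e + exp (- \<tau>) * (V p - V q)" using pq(4) \<zeta>(2) \<psi> nn by linarith
      moreover have "norm (p - q) < e" using pq(3) Z \<psi> nn e by linarith
      ultimately show ?thesis using pq(1,2) by blast
    qed
    moreover have "0 < d" using d1 pos m by (simp add: d_def)
    ultimately show "\<exists>d>0. \<forall>\<xi> \<eta>. h \<xi> \<le> 0 \<longrightarrow> h \<eta> \<le> 0 \<longrightarrow> norm (\<xi> - \<eta>) < d \<longrightarrow>
      (\<exists>p q. h p \<le> 0 \<and> h q \<le> 0 \<and> norm (p - q) < e \<and> V \<eta> - V \<xi> \<le> e + exp (- \<tau>) * (V p - V q))" by blast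
  qed
qed

lemma bounded_V: "bounded (V ` constraint_set h)"
  using abs_V_le by (auto simp: bounded_iff constraint_set_def)

lemma uniformly_continuous_V: "uniformly_continuous_on (constraint_set h) V"
proof -
  obtain \<tau> where \<tau>: "0 < \<tau>" and step: "\<And>e. 0 < e \<Longrightarrow> \<exists>d>0. \<forall>\<xi> \<eta>. h \<xi> \<le> 0 \<longrightarrow> h \<eta> \<le> 0 \<longrightarrow> norm (\<xi> - \<eta>) < d \<longrightarrow>
      (\<exists>p q. h p \<le> 0 \<and> h q \<le> 0 \<and> norm (p - q) < e \<and> V \<eta> - V \<xi> \<le> e + exp (- \<tau>) * (V p - V q))"
    using V_difference_step by blast
  show ?thesis
  proof (rule uniformly_continuous_by_contraction[where \<theta> = "exp (- \<tau>)"])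
    show "\<bar>V x\<bar> \<le> B" if "x \<in> constraint_set h" for x
      using abs_V_le that by (simp add: constraint_set_def)
    show "0 \<le> exp (- \<tau>)" "exp (- \<tau>) < 1" using \<tau> by auto
    fix e :: real assume "0 < e"
    then obtain d where "0 < d" and d: "\<And>\<xi> \<eta>. h \<xi> \<le> 0 \<Longrightarrow> h \<eta> \<le> 0 \<Longrightarrow> norm (\<xi> - \<eta>) < d \<Longrightarrow>
      \<exists>p q. h p \<le> 0 \<and> h q \<le> 0 \<and> norm (p - q) < e \<and> V \<eta> - V \<xi> \<le> e + exp (- \<tau>) * (V p - V q)"
      using step by blast
    show "\<exists>d>0. \<forall>x\<in>constraint_set h. \<forall>y\<in>constraint_set h. dist x y < d \<longrightarrow>
      (\<exists>p\<in>constraint_set h. \<exists>q\<in>constraint_set h. dist q p < e \<and> V y - V x \<le> e + exp (- \<tau>) * (V p - V q))"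
    proof (intro exI[of _ d] conjI ballI impI \<open>0 < d\<close>)
      fix x y assume "x \<in> constraint_set h" "y \<in> constraint_set h" "dist x y < d"
      then obtain p q where "h p \<le> 0" "h q \<le> 0" "norm (p - q) < e" "V y - V x \<le> e + exp (- \<tau>) * (V p - V q)"
        using d[of x y] by (auto simp: constraint_set_def dist_norm)
      then show "\<exists>p\<in>constraint_set h. \<exists>q\<in>constraint_set h. dist q p < e \<and> V y - V x \<le> e + exp (- \<tau>) * (V p - V q)"
        by (intro bexI[of _ p] bexI[of _ q]) (auto simp: constraint_set_def dist_norm norm_minus_commute)
    qed
  qed
qed

end

theorem theorem6p1:
  fixes f :: "2 \<Rightarrow> real ^ 'n \<Rightarrow> real ^ 'n"
    and h :: "real ^ 'n \<Rightarrow> real"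
    and L :: "real ^ 'n \<Rightarrow> real ^ 2 \<Rightarrow> real"
    and k\<^sub>f k\<^sub>0 k\<^sub>h \<alpha> \<delta> d\<^sub>0 k\<^sub>L :: real
  assumes f_C2: "\<And>l i. class_C2 (\<lambda>x. f l x $ i)"
    and f_lipschitz: "\<And>l. k\<^sub>f-lipschitz_on UNIV (f l)"
    and k0_pos: "k\<^sub>0 > 0"
    and f_bounded: "\<And>x. norm (f 1 x) + norm (f 2 x) \<le> k\<^sub>0"
    and h_C21: "class_C21 h"
    and h_lipschitz: "k\<^sub>h-lipschitz_on UNIV h"
    and C_nonempty: "constraint_set h \<noteq> {}"
    and gradient_nonzero: "\<And>x. h x = 0 \<Longrightarrow> gradient h x \<noteq> 0"
    and \<alpha>_pos: "\<alpha> > 0"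
    and bracket: "\<And>x. x \<in> singular_set f h \<Longrightarrow>
      \<bar>gradient h x \<bullet> lie_bracket (f 1) (f 2) x\<bar> > \<alpha>"
    and S_form: "\<And>x. x \<in> singular_set f h \<Longrightarrow>
      negative_semidefinite (S_matrix f h x) \<or> indefinite (S_matrix f h x)"
    and \<delta>_pos: "\<delta> > 0"
    and d0_pos: "d\<^sub>0 > 0"
    and distance: "\<And>x. x \<in> {y + b | y b. y \<in> singular_set f h \<and> b \<in> cball 0 \<delta>} \<Longrightarrow>
      sqrt ((gradient h x \<bullet> f 1 x)\<^sup>2 + (gradient h x \<bullet> f 2 x)\<^sup>2)
        \<ge> d\<^sub>0 * infdist x (singular_set f h)"
    and L_bounded: "bounded ((\<lambda>(x, u). L x u) ` (UNIV \<times> control_values))"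
    and L_continuous: "continuous_on (UNIV \<times> control_values) (\<lambda>(x, u). L x u)"
    and kL_pos: "k\<^sub>L > 0"
    and L_lipschitz: "\<And>u. u \<in> control_values \<Longrightarrow> k\<^sub>L-lipschitz_on UNIV (\<lambda>x. L x u)"
    and frontier_compact: "compact (frontier (constraint_set h))"
  shows "bounded (value_function f h L ` constraint_set h) \<and>
    uniformly_continuous_on (constraint_set h) (value_function f h L)"
proof -
  obtain B where B: "\<And>x w. w \<in> control_values \<Longrightarrow> \<bar>L x w\<bar> \<le> B"
    using L_bounded by (auto simp: bounded_iff)
  interpret regular_discounted_problem f k\<^sub>f k\<^sub>0 h \<alpha> \<delta> d\<^sub>0 L B k\<^sub>L k\<^sub>h
    by unfold_locales
      (use f_lipschitz f_bounded f_C2 h_C21 \<alpha>_pos bracket S_form \<delta>_pos d0_pos distance B L_continuous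
        L_lipschitz h_lipschitz frontier_compact in auto)
  show ?thesis using bounded_V uniformly_continuous_V by blast
qed

end
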